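(* Let $c\geq 1$ be a constant and let $\Pi$ be an LCL problem. If there exists a randomized LOCAL algorithm that solves $\Pi$ on trees in $o(\log n)$ rounds with failure probability at most $1/n$, then there exists a randomized CONGEST algorithm that solves $\Pi$ on trees in $O(\log \log n)$ rounds with failure probability at most $1/n^c$.
   Context: An LCL (locally checkable labeling) problem is a tuple $\Pi=(\Sigma_{\mathrm{in}},\Sigma_{\mathrm{out}},C,r)$ where $\Sigma_{\mathrm{in}},\Sigma_{\mathrm{out}}$ are finite label sets, $r$ is a constant (checkability radius), and $C$ is a finite set of pairs $(H,v)$ where $H$ is a graph, $v$ a node of $H$ of radius at most $r$ in $H$, and every node-edge pair (half-edge) of $H$ carries a label from $\Sigma_{\mathrm{in}}$ and one from $\Sigma_{\mathrm{out}}$. Input graphs have maximum degree bounded by a constant $\Delta$. Solving $\Pi$: given input labels on half-edges, assign output labels to all half-edges so that the labeled radius-$r$ ball around every node is isomorphic to a labeled graph in $C$. LOCAL model: the connected $n$-node input graph is the network; synchronous rounds with arbitrarily large messages. CONGEST model: same with $O(\log n)$-bit messages. A randomized algorithm $\mathcal{A}(n)$ is given an upper bound $n$ on the number of nodes, has a deterministic running-time bound $t_{\mathcal{A}}(n)$, has no unique IDs, and each node uses at most $h_{\mathcal{A}}(n)\in\mathbb{N}$ random bits for some (arbitrary) finite function $h_{\mathcal{A}}$; its failure probability is the probability that the output violates $\Pi$ on a graph with at most $n$ nodes. *)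

theory Defs
  imports "HOL-Analysis.Analysis" "HOL-Library.Landau_Symbols"
begin

text \<open>A graph is given by a vertex set and, for every node, the list of its
neighbours; the position of a neighbour in this list is the port number.\<close>

record pgraph =
  verts :: "nat set"
  nbrs  :: "nat \<Rightarrow> nat list"

definition adj :: "pgraph \<Rightarrow> nat \<Rightarrow> nat \<Rightarrow> bool" where
  "adj G u v \<longleftrightarrow> u \<in> verts G \<and> v \<in> set (nbrs G u)"

definition wf_pgraph :: "pgraph \<Rightarrow> bool" where
  "wf_pgraph G \<longleftrightarrow> finite (verts G) \<and> verts G \<noteq> {} \<and>
     (\<forall>v\<in>verts G. distinct (nbrs G v) \<and> v \<notin> set (nbrs G v) \<and>
        set (nbrs G v) \<subseteq> verts G \<and> (\<forall>u\<in>set (nbrs G v). v \<in> set (nbrs G u)))"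

definition max_deg_le :: "pgraph \<Rightarrow> nat \<Rightarrow> bool" where
  "max_deg_le G \<Delta> \<longleftrightarrow> (\<forall>v\<in>verts G. length (nbrs G v) \<le> \<Delta>)"

definition connected_pg :: "pgraph \<Rightarrow> bool" where
  "connected_pg G \<longleftrightarrow> (\<forall>u\<in>verts G. \<forall>v\<in>verts G. (adj G)\<^sup>*\<^sup>* u v)"

definition is_cycle :: "pgraph \<Rightarrow> nat list \<Rightarrow> bool" where
  "is_cycle G cs \<longleftrightarrow> length cs \<ge> 3 \<and> distinct cs \<and> set cs \<subseteq> verts G \<and>
     (\<forall>i<length cs. adj G (cs ! i) (cs ! ((i + 1) mod length cs)))"

definition is_tree :: "pgraph \<Rightarrow> bool" where
  "is_tree G \<longleftrightarrow> wf_pgraph G \<and> connected_pg G \<and> \<not> (\<exists>cs. is_cycle G cs)"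

definition port_of :: "pgraph \<Rightarrow> nat \<Rightarrow> nat \<Rightarrow> nat" where
  "port_of G u v = (THE j. j < length (nbrs G u) \<and> nbrs G u ! j = v)"

text \<open>A labelled centred graph: vertices, adjacency, input and output labels
on half-edges (node, neighbour), and a centre.\<close>
record ('i, 'o) lgraph =
  lverts  :: "nat set"
  ladj    :: "nat \<Rightarrow> nat \<Rightarrow> bool"
  llin    :: "nat \<Rightarrow> nat \<Rightarrow> 'i"
  llout   :: "nat \<Rightarrow> nat \<Rightarrow> 'o"
  lcenter :: nat

text \<open>The label sets are the (finite) types 'i and 'o.\<close>
record ('i, 'o) lcl =
  constraints :: "('i, 'o) lgraph set"
  radius      :: nat

definition is_lcl :: "('i::finite, 'o::finite) lcl \<Rightarrow> bool" where
  "is_lcl P \<longleftrightarrow> finite (constraints P) \<and>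
     (\<forall>H\<in>constraints P. finite (lverts H) \<and> lcenter H \<in> lverts H \<and>
        (\<forall>w\<in>lverts H. \<exists>k\<le>radius P.
            ((\<lambda>x y. x \<in> lverts H \<and> y \<in> lverts H \<and> ladj H x y) ^^ k) (lcenter H) w))"

definition in_ball :: "pgraph \<Rightarrow> nat \<Rightarrow> nat \<Rightarrow> nat \<Rightarrow> bool" where
  "in_ball G r v w \<longleftrightarrow> (\<exists>k\<le>r. (adj G ^^ k) v w)"

definition ball_iso ::
  "pgraph \<Rightarrow> (nat \<Rightarrow> nat \<Rightarrow> 'i) \<Rightarrow> (nat \<Rightarrow> nat \<Rightarrow> 'o) \<Rightarrow> nat \<Rightarrow> nat \<Rightarrow> ('i, 'o) lgraph \<Rightarrow> bool" where
  "ball_iso G inp outp r v H \<longleftrightarrow>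
     (\<exists>f. bij_betw f {w. in_ball G r v w} (lverts H) \<and> f v = lcenter H \<and>
        (\<forall>x\<in>{w. in_ball G r v w}. \<forall>y\<in>{w. in_ball G r v w}.
           (adj G x y \<longleftrightarrow> ladj H (f x) (f y)) \<and>
           (adj G x y \<longrightarrow> inp x y = llin H (f x) (f y) \<and> outp x y = llout H (f x) (f y))))"

definition lcl_solved ::
  "('i, 'o) lcl \<Rightarrow> pgraph \<Rightarrow> (nat \<Rightarrow> nat \<Rightarrow> 'i) \<Rightarrow> (nat \<Rightarrow> nat \<Rightarrow> 'o) \<Rightarrow> bool" where
  "lcl_solved P G inp outp \<longleftrightarrow>
     (\<forall>v\<in>verts G. \<exists>H\<in>constraints P. ball_iso G inp outp (radius P) v H)"

text \<open>All components get the bound n. init gets the input labels of the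
node's half-edges ordered by port (so also the degree) and its random bits;
send gives the message on a port; recv gets the messages received, indexed by
port; out gives the output label of a port; rounds is the running time t(n);
bits is the number h(n) of random bits per node.\<close>
record ('s, 'm, 'i, 'o) dalg =
  a_init   :: "nat \<Rightarrow> 'i list \<Rightarrow> bool list \<Rightarrow> 's"
  a_send   :: "nat \<Rightarrow> 's \<Rightarrow> nat \<Rightarrow> 'm"
  a_recv   :: "nat \<Rightarrow> 's \<Rightarrow> 'm list \<Rightarrow> 's"
  a_out    :: "nat \<Rightarrow> 's \<Rightarrow> nat \<Rightarrow> 'o"
  a_rounds :: "nat \<Rightarrow> nat"
  a_bits   :: "nat \<Rightarrow> nat"

primrec exec ::
  "('s, 'm, 'i, 'o) dalg \<Rightarrow> nat \<Rightarrow> pgraph \<Rightarrow> (nat \<Rightarrow> nat \<Rightarrow> 'i) \<Rightarrow> (nat \<Rightarrow> bool list)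
     \<Rightarrow> nat \<Rightarrow> nat \<Rightarrow> 's" where
  "exec A n G inp rb 0 v = a_init A n (map (inp v) (nbrs G v)) (rb v)"
| "exec A n G inp rb (Suc k) v =
     a_recv A n (exec A n G inp rb k v)
       (map (\<lambda>u. a_send A n (exec A n G inp rb k u) (port_of G u v)) (nbrs G v))"

definition alg_output ::
  "('s, 'm, 'i, 'o) dalg \<Rightarrow> nat \<Rightarrow> pgraph \<Rightarrow> (nat \<Rightarrow> nat \<Rightarrow> 'i) \<Rightarrow> (nat \<Rightarrow> bool list)
     \<Rightarrow> nat \<Rightarrow> nat \<Rightarrow> 'o" where
  "alg_output A n G inp rb x y = a_out A n (exec A n G inp rb (a_rounds A n) x) (port_of G x y)"

definition rand_space :: "pgraph \<Rightarrow> nat \<Rightarrow> (nat \<Rightarrow> bool list) set" where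
  "rand_space G h = PiE (verts G) (\<lambda>_. {bs. length bs = h})"

definition fail_prob ::
  "('s, 'm, 'i, 'o) dalg \<Rightarrow> ('i, 'o) lcl \<Rightarrow> nat \<Rightarrow> pgraph \<Rightarrow> (nat \<Rightarrow> nat \<Rightarrow> 'i) \<Rightarrow> real" where
  "fail_prob A P n G inp =
     real (card {rb \<in> rand_space G (a_bits A n). \<not> lcl_solved P G inp (alg_output A n G inp rb)})
     / real (card (rand_space G (a_bits A n)))"

definition solves_on_trees ::
  "('s, 'm, 'i, 'o) dalg \<Rightarrow> ('i, 'o) lcl \<Rightarrow> nat \<Rightarrow> (nat \<Rightarrow> real) \<Rightarrow> bool" where
  "solves_on_trees A P \<Delta> p \<longleftrightarrow>
     (\<forall>n\<ge>1. \<forall>G inp. is_tree G \<and> max_deg_le G \<Delta> \<and> card (verts G) \<le> n \<longrightarrow>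
        fail_prob A P n G inp \<le> p n)"

definition congest :: "('s, bool list, 'i, 'o) dalg \<Rightarrow> bool" where
  "congest A \<longleftrightarrow> (\<exists>K::real. \<forall>n\<ge>2. \<forall>s j. real (length (a_send A n s j)) \<le> K * ln (real n))"

end

(*
Let n0 be a large constant and let s exceed the running time of the algorithm on n0 nodes plus the
checkability radius. Since s = o(log n0), a ball of radius s + 1 is a tree with at most n0 nodes, so
in every tree the algorithm run with parameter n0 violates the constraint at a given node with
probability at most 1/n0, which beats any fixed power of the ball size. This makes the violations an
instance of the Lovasz local lemma with a polynomially strong criterion, which is solved as follows.

Nodes draw random names of O(log n) bits, which are distinct with high probability, and turn them
into a distance colouring with constantly many colours. Going through the colours, every random bit
is sampled unless some violation that depends on it has become too likely; a bit at most doubles a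
conditional probability, so all of them stay small. The regions around the frozen bits have only
O(log n) nodes with high probability. Rake and compress removes such a region within O(log log n)
iterations. Near the nodes removed by compress steps the frozen bits are set so that the conditional
probabilities stay small. By the local lemma a completion still exists, and the rest of the region
falls apart into rooted trees of depth O(log log n), on which a correct output is found by dynamic
programming. A node only ever stores one of polynomially many labels, so O(log n) bits per message
suffice.
*)

theory Submission
  imports Defs "HOL-Library.Discrete_Functions" "HOL-Real_Asymp.Real_Asymp"
begin

section \<open>Balls and locality\<close>

text \<open>The size \<open>n0\<close> is fixed independently of \<open>n\<close>. Hence the radius
  \<open>s\<close>, the number of random bits sampled per node and all distances are constants,
  however fast \<open>a_bits A\<close> grows; only the names and the regions to be completed grow
  with \<open>n\<close>.

  Two demands shape the construction. First, sampling is adaptive: whether a bit is revealed depends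
  on earlier bits. Independence survives because the revealed set can be read off its own bits, so
  that the mean of a product of violations over disjoint balls does not change
  (\<open>avg_adaptive\<close>). Second, a frozen region is too large to be gathered with short
  messages. Fixing the bits around compress nodes, called breaks, keeps them out of every unfinished
  ball, and a raked node has at most one parent. The local lemma gives existence only; its solution
  is never computed but keeps the feasible sets nonempty.

  Message size is treated once for all stages: each stage depends on a ball of constant radius, and
  a general simulation turns such a map into rounds over a fixed finite set of labels.\<close>

primrec nbh :: "pgraph \<Rightarrow> nat \<Rightarrow> nat \<Rightarrow> nat set" where
  "nbh G 0 v = {v}"
| "nbh G (Suc k) v = (\<Union>u\<in>nbh G k v. insert u (set (nbrs G u)))"

lemma nbh_refl [simp]: "v \<in> nbh G k v"
  by (induction k) auto

lemma nbh_step: "w \<in> nbh G k v \<Longrightarrow> x \<in> set (nbrs G w) \<Longrightarrow> x \<in> nbh G (Suc k) v"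
  by auto

lemma nbh_mono: "j \<le> k \<Longrightarrow> nbh G j v \<subseteq> nbh G k v"
  by (induction k) (auto simp: le_Suc_eq)

lemma nbh_trans: "w \<in> nbh G j v \<Longrightarrow> x \<in> nbh G k w \<Longrightarrow> x \<in> nbh G (j + k) v"
  by (induction k arbitrary: x) auto

lemma nbh_trans_le: "w \<in> nbh G j v \<Longrightarrow> x \<in> nbh G k w \<Longrightarrow> j + k \<le> l \<Longrightarrow> x \<in> nbh G l v"
  using nbh_trans nbh_mono by blast

lemma nbh_nbr: "u \<in> set (nbrs G v) \<Longrightarrow> x \<in> nbh G k u \<Longrightarrow> x \<in> nbh G (Suc k) v"
  using nbh_trans[of u G 1 v x k] by auto

lemma finite_nbh [simp]: "finite (nbh G k v)"
  by (induction k) auto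

lemma relpowp_imp_nbh: "(adj G ^^ k) v w \<Longrightarrow> w \<in> nbh G k v"
proof (induction k arbitrary: w)
  case (Suc k)
  then show ?case by (auto simp: adj_def)
qed simp

definition agr :: "nat \<Rightarrow> pgraph \<Rightarrow> pgraph \<Rightarrow> nat \<Rightarrow> bool" where
  "agr k G G' v \<longleftrightarrow> (\<forall>w\<in>nbh G k v. nbrs G w = nbrs G' w \<and> (w \<in> verts G \<longleftrightarrow> w \<in> verts G'))"

lemma agr_mono: "agr k G G' v \<Longrightarrow> j \<le> k \<Longrightarrow> agr j G G' v"
  unfolding agr_def using nbh_mono[of j k G v] by (auto simp del: nbh.simps)

text \<open>Agreement on radius \<open>k\<close> includes the neighbour lists of the outermost
  nodes, and these lists already name the nodes at distance \<open>k + 1\<close>.\<close>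

lemma agr_Suc_nbh: "agr k G G' v \<Longrightarrow> nbh G (Suc k) v = nbh G' (Suc k) v"
proof (induction k)
  case 0
  then show ?case by (simp add: agr_def)
next
  case (Suc k)
  have "agr k G G' v" using Suc.prems by (rule agr_mono) simp
  then have eq: "nbh G (Suc k) v = nbh G' (Suc k) v" by (rule Suc.IH)
  show ?case
    unfolding nbh.simps(2)[of _ "Suc k"] eq[symmetric]
  proof (rule SUP_cong[OF refl])
    fix u assume "u \<in> nbh G (Suc k) v"
    then have "nbrs G u = nbrs G' u" using Suc.prems unfolding agr_def by blast
    then show "insert u (set (nbrs G u)) = insert u (set (nbrs G' u))" by simp
  qed
qed

lemma agr_sub: "agr k G G' v \<Longrightarrow> w \<in> nbh G i v \<Longrightarrow> i + j \<le> k \<Longrightarrow> agr j G G' w"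
  using nbh_trans_le[of w G i v _ j k] unfolding agr_def by blast

lemma agr_nbh: "agr k G G' v \<Longrightarrow> j \<le> Suc k \<Longrightarrow> nbh G' j v = nbh G j v"
proof (cases j)
  case (Suc m)
  assume "agr k G G' v" "j \<le> Suc k"
  then have "agr m G G' v" using agr_mono Suc by blast
  then show ?thesis using agr_Suc_nbh Suc by simp
qed simp

lemma agr_nbh_sub: "agr k G G' v \<Longrightarrow> w \<in> nbh G i v \<Longrightarrow> i + j \<le> Suc k \<Longrightarrow> nbh G' j w = nbh G j w"
proof (cases j)
  case (Suc m)
  assume "agr k G G' v" "w \<in> nbh G i v" "i + j \<le> Suc k"
  then have "agr m G G' w" using agr_sub[of k G G' v w i m] Suc by simp
  then show ?thesis using agr_nbh[of m G G' w j] Suc by simp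
qed simp

section \<open>Graphs of bounded degree\<close>

locale bgraph =
  fixes G :: pgraph and \<Delta> :: nat
  assumes wf: "wf_pgraph G" and deg: "max_deg_le G \<Delta>"
begin

lemma finite_verts [simp]: "finite (verts G)"
  using wf by (simp add: wf_pgraph_def)

lemma nbrs_verts: "v \<in> verts G \<Longrightarrow> u \<in> set (nbrs G v) \<Longrightarrow> u \<in> verts G"
  using wf by (auto simp: wf_pgraph_def)

lemma nbrs_sym: "v \<in> verts G \<Longrightarrow> u \<in> set (nbrs G v) \<Longrightarrow> v \<in> set (nbrs G u)"
  using wf by (auto simp: wf_pgraph_def)

lemma nbrs_irrefl: "v \<in> verts G \<Longrightarrow> v \<notin> set (nbrs G v)"
  using wf by (auto simp: wf_pgraph_def)

lemma nbrs_distinct: "v \<in> verts G \<Longrightarrow> distinct (nbrs G v)"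
  using wf by (auto simp: wf_pgraph_def)

lemma nbh_verts: "v \<in> verts G \<Longrightarrow> nbh G k v \<subseteq> verts G"
  by (induction k) (auto dest: nbrs_verts)

lemma nbh_sym: "v \<in> verts G \<Longrightarrow> w \<in> nbh G k v \<Longrightarrow> v \<in> nbh G k w"
proof (induction k arbitrary: w)
  case (Suc k)
  then obtain u where u: "u \<in> nbh G k v" "w = u \<or> w \<in> set (nbrs G u)" by auto
  then have "u \<in> verts G" "v \<in> nbh G k u" using Suc nbh_verts by blast+
  then show ?case
    using u nbrs_sym[of u w] nbh_nbr[of u G w v k] nbh_mono[of k "Suc k" G u] by auto
qed simp

lemma nbh_common: "v \<in> verts G \<Longrightarrow> w \<in> verts G \<Longrightarrow> x \<in> nbh G i v \<Longrightarrow> x \<in> nbh G j w \<Longrightarrow> w \<in> nbh G (i + j) v"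
  using nbh_sym nbh_trans by blast

text \<open>The base \<open>\<Delta> + 2\<close> is at least 2 even when \<open>\<Delta>\<close> is
  0, so that its logarithm is positive in the choice of \<open>n0\<close>.\<close>

lemma card_nbh: "v \<in> verts G \<Longrightarrow> card (nbh G k v) \<le> (\<Delta> + 2) ^ k"
proof (induction k)
  case (Suc k)
  have "card (nbh G (Suc k) v) \<le> (\<Sum>u\<in>nbh G k v. card (insert u (set (nbrs G u))))"
    unfolding nbh.simps by (rule card_UN_le) simp
  also have "\<dots> \<le> (\<Sum>u\<in>nbh G k v. \<Delta> + 2)"
  proof (rule sum_mono)
    fix u assume "u \<in> nbh G k v"
    then have "length (nbrs G u) \<le> \<Delta>"
      using nbh_verts[OF Suc.prems] deg by (auto simp: max_deg_le_def)
    then show "card (insert u (set (nbrs G u))) \<le> \<Delta> + 2"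
      using card_length[of "nbrs G u"] card_insert_le_m1[of "Suc \<Delta>" "set (nbrs G u)" u] by simp
  qed
  also have "\<dots> = card (nbh G k v) * (\<Delta> + 2)" by simp
  also have "\<dots> \<le> (\<Delta> + 2) ^ k * (\<Delta> + 2)" using Suc by (intro mult_right_mono) auto
  finally show ?case by (simp add: mult.commute)
qed simp

lemma in_ball_nbh: "v \<in> verts G \<Longrightarrow> in_ball G k v w \<longleftrightarrow> w \<in> nbh G k v"
proof
  assume "in_ball G k v w"
  then show "w \<in> nbh G k v"
    unfolding in_ball_def using relpowp_imp_nbh nbh_mono by blast
next
  assume v: "v \<in> verts G" and "w \<in> nbh G k v"
  then have "\<exists>j\<le>k. (adj G ^^ j) v w"
  proof (induction k arbitrary: w)
    case (Suc k)
    then obtain u j where u: "u \<in> nbh G k v" "w = u \<or> w \<in> set (nbrs G u)" "j \<le> k" "(adj G ^^ j) v u"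
      by (metis (no_types, lifting) UN_E insertE nbh.simps(2))
    have "u \<in> verts G" using u(1) v nbh_verts by blast
    then show ?case
      using u by (metis Suc_le_mono adj_def le_SucI relpowp_Suc_I)
  qed auto
  then show "in_ball G k v w" by (simp add: in_ball_def)
qed

end

section \<open>Locality of executions\<close>

text \<open>Induction on the rounds. The port on which a neighbour sends is computed from that
  neighbour's own list, which lies within the radius of the additional round.\<close>

lemma exec_cong:
  assumes "\<And>x. x \<in> nbh G k v \<Longrightarrow> nbrs G x = nbrs G' x"
    and "\<And>x y. x \<in> nbh G k v \<Longrightarrow> y \<in> set (nbrs G x) \<Longrightarrow> inp x y = inp' x y"
    and "\<And>x. x \<in> nbh G k v \<Longrightarrow> rb x = rb' x"
  shows "exec A n G inp rb k v = exec A n G' inp' rb' k v"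
  using assms
proof (induction k arbitrary: v)
  case 0
  then show ?case by (simp cong: map_cong)
next
  case (Suc k)
  have sub: "x \<in> nbh G k v \<Longrightarrow> x \<in> nbh G (Suc k) v" for x using nbh_mono[of k "Suc k"] by auto
  have 1: "exec A n G inp rb k v = exec A n G' inp' rb' k v"
    by (rule Suc.IH) (use Suc.prems sub in blast)+
  have nb: "nbrs G v = nbrs G' v" using Suc.prems(1) nbh_refl by blast
  have 2: "exec A n G inp rb k u = exec A n G' inp' rb' k u \<and> port_of G u v = port_of G' u v"
    if "u \<in> set (nbrs G v)" for u
  proof
    show "exec A n G inp rb k u = exec A n G' inp' rb' k u"
    proof (rule Suc.IH)
      fix x assume "x \<in> nbh G k u"
      then have x: "x \<in> nbh G (Suc k) v" by (rule nbh_nbr[OF that])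
      show "nbrs G x = nbrs G' x" by (rule Suc.prems(1)[OF x])
      show "rb x = rb' x" by (rule Suc.prems(3)[OF x])
      show "inp x y = inp' x y" if "y \<in> set (nbrs G x)" for y by (rule Suc.prems(2)[OF x that])
    qed
    have "u \<in> nbh G (Suc k) v" by (rule nbh_nbr[OF that nbh_refl])
    then show "port_of G u v = port_of G' u v" unfolding port_of_def using Suc.prems(1)[of u] by metis
  qed
  have "map (\<lambda>u. a_send A n (exec A n G inp rb k u) (port_of G u v)) (nbrs G v) =
      map (\<lambda>u. a_send A n (exec A n G' inp' rb' k u) (port_of G' u v)) (nbrs G v)"
    by (rule map_cong) (simp_all add: 2)
  then show ?case unfolding exec.simps nb[symmetric] 1 by (rule arg_cong)
qed

lemma ball_iso_cong:
  assumes "\<And>w. in_ball G r v w \<longleftrightarrow> in_ball G' r v w"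
    and "\<And>x y. in_ball G r v x \<Longrightarrow> in_ball G r v y \<Longrightarrow> adj G x y \<longleftrightarrow> adj G' x y"
    and "\<And>x y. in_ball G r v x \<Longrightarrow> in_ball G r v y \<Longrightarrow> adj G x y \<Longrightarrow> inp x y = inp' x y \<and> outp x y = outp' x y"
  shows "ball_iso G inp outp r v H \<longleftrightarrow> ball_iso G' inp' outp' r v H"
proof -
  have eq: "{w. in_ball G' r v w} = {w. in_ball G r v w}" using assms(1) by auto
  show ?thesis unfolding ball_iso_def eq using assms(2,3)
    by (intro ex_cong1 conj_cong refl ball_cong) auto
qed

section \<open>Averages over a set of fair bits\<close>

text \<open>An assignment of bits is the set of the coordinates whose bit is 1.\<close>

definition avg :: "'b set \<Rightarrow> ('b set \<Rightarrow> real) \<Rightarrow> 'b set \<Rightarrow> real" where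
  "avg U f B = (\<Sum>W\<in>Pow U. f ((B - U) \<union> W)) / 2 ^ card U"

definition depends :: "'b set \<Rightarrow> ('b set \<Rightarrow> 'c) \<Rightarrow> bool" where
  "depends D f \<longleftrightarrow> (\<forall>B B'. B \<inter> D = B' \<inter> D \<longrightarrow> f B = f B')"

lemma dependsD: "depends D f \<Longrightarrow> B \<inter> D = B' \<inter> D \<Longrightarrow> f B = f B'"
  unfolding depends_def by blast

lemma depends_comp: "depends D f \<Longrightarrow> depends D (\<lambda>B. g (f B))"
  unfolding depends_def by metis

lemma depends_mono: "depends D f \<Longrightarrow> D \<subseteq> D' \<Longrightarrow> depends D' f"
  unfolding depends_def by blast

lemma avg_empty [simp]: "avg {} f B = f B"
  by (simp add: avg_def)

lemma avg_insert:
  assumes "finite U" "x \<notin> U"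
  shows "avg (insert x U) f B = (avg U f (insert x B) + avg U f (B - {x})) / 2"
proof -
  have inj: "inj_on (insert x) (Pow U)" using assms(2) by (auto simp: inj_on_def)
  have disj: "Pow U \<inter> insert x ` Pow U = {}" using assms(2) by auto
  have "(\<Sum>W\<in>Pow (insert x U). f ((B - insert x U) \<union> W)) =
      (\<Sum>W\<in>Pow U. f ((B - insert x U) \<union> W)) + (\<Sum>W\<in>insert x ` Pow U. f ((B - insert x U) \<union> W))"
    unfolding Pow_insert using assms(1) disj by (intro sum.union_disjoint) auto
  also have "(\<Sum>W\<in>insert x ` Pow U. f ((B - insert x U) \<union> W)) = (\<Sum>W\<in>Pow U. f ((insert x B - U) \<union> W))"
    unfolding sum.reindex[OF inj] o_def
    by (rule sum.cong[OF refl], rule arg_cong[of _ _ f]) (use assms(2) in auto)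
  also have "(\<Sum>W\<in>Pow U. f ((B - insert x U) \<union> W)) = (\<Sum>W\<in>Pow U. f (((B - {x}) - U) \<union> W))"
    by (rule sum.cong[OF refl], rule arg_cong[of _ _ f]) auto
  finally show ?thesis using assms by (simp add: avg_def field_simps)
qed

lemma avg_mono: "(\<And>B. f B \<le> g B) \<Longrightarrow> avg U f B \<le> avg U g B"
  unfolding avg_def by (intro divide_right_mono sum_mono) auto

lemma avg_const [simp]: "finite U \<Longrightarrow> avg U (\<lambda>_. c) B = c"
  by (simp add: avg_def card_Pow)

lemma avg_cmult: "avg U (\<lambda>B. c * f B) B = c * avg U f B"
  by (simp add: avg_def sum_distrib_left)

lemma avg_sum: "avg U (\<lambda>B. \<Sum>i\<in>I. f i B) B = (\<Sum>i\<in>I. avg U (f i) B)"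
  unfolding avg_def sum_divide_distrib[symmetric] by (subst sum.swap) simp

lemma avg_diff: "avg U (\<lambda>B. f B - g B) B = avg U f B - avg U g B"
  by (simp add: avg_def sum_subtractf diff_divide_distrib)

lemma avg_nonneg: "(\<And>B. 0 \<le> f B) \<Longrightarrow> 0 \<le> avg U f B"
  unfolding avg_def by (intro divide_nonneg_nonneg sum_nonneg) auto

text \<open>No function exceeds its mean everywhere. This is the derandomization step: the bits of a
  zone can be fixed without raising a sum of risks.\<close>

lemma avg_le_witness:
  assumes "finite U"
  shows "\<exists>W\<subseteq>U. f ((B - U) \<union> W) \<le> avg U f B"
proof (rule ccontr)
  assume neg: "\<not> ?thesis"
  have "(\<Sum>W\<in>Pow U. avg U f B) < (\<Sum>W\<in>Pow U. f ((B - U) \<union> W))"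
    using assms neg by (intro sum_strict_mono) (auto simp: not_le)
  also have "\<dots> = 2 ^ card U * avg U f B" by (simp add: avg_def)
  finally show False using assms by (simp add: card_Pow)
qed

lemma depends_avg:
  assumes "depends D f"
  shows "depends (D - U) (avg U f)"
  unfolding depends_def avg_def
proof (intro allI impI arg_cong[of _ _ "\<lambda>x. x / 2 ^ card U"] sum.cong refl)
  fix B B' W assume "B \<inter> (D - U) = B' \<inter> (D - U)"
  then show "f (B - U \<union> W) = f (B' - U \<union> W)" by (intro dependsD[OF assms]) blast
qed

text \<open>A coordinate outside \<open>D\<close> contributes two equal halves and drops out of the
  average.\<close>

lemma avg_Int:
  assumes "finite U" "depends D f"
  shows "avg U f B = avg (U \<inter> D) f B"
  using assms(1)
proof (induction U arbitrary: B)
  case (insert x U)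
  show ?case
  proof (cases "x \<in> D")
    case True
    then have "insert x U \<inter> D = insert x (U \<inter> D)" by auto
    then show ?thesis using insert by (simp add: avg_insert)
  next
    case False
    then have eq: "avg U f C = avg U f B" if "C \<in> {insert x B, B - {x}}" for C
      using that by (intro dependsD[OF depends_avg[OF assms(2)]]) auto
    have "avg (insert x U) f B = avg U f B"
      using eq insert by (simp add: avg_insert)
    then show ?thesis using False insert by simp
  qed
qed simp

text \<open>Tower law of conditional expectation.\<close>

lemma avg_avg:
  assumes "finite U" "finite V" "U \<inter> V = {}"
  shows "avg U (avg V f) B = avg (U \<union> V) f B"
  using assms(1,3)
proof (induction U arbitrary: B)
  case (insert x U)
  then have "avg (insert x U \<union> V) f B = (avg (U \<union> V) f (insert x B) + avg (U \<union> V) f (B - {x})) / 2"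
    using assms(2) by (simp add: avg_insert)
  then show ?case using insert by (simp add: avg_insert)
qed simp

text \<open>Independence of functions of disjoint bit sets: every averaged coordinate is invisible
  to one of the two factors, which comes out of the half sum.\<close>

lemma avg_mult:
  assumes "finite U" "depends D f" "depends D' g" "D \<inter> D' = {}"
  shows "avg U (\<lambda>B. f B * g B) B = avg U f B * avg U g B"
  using assms(1)
proof (induction U arbitrary: B)
  case (insert x U)
  have g: "avg U g (insert x B) = avg U g (B - {x})" if "x \<notin> D'"
    using that by (intro dependsD[OF depends_avg[OF assms(3)]]) auto
  have f: "avg U f (insert x B) = avg U f (B - {x})" if "x \<notin> D"
    using that by (intro dependsD[OF depends_avg[OF assms(2)]]) auto
  show ?case
  proof (cases "x \<in> D")
    case True
    then have "x \<notin> D'" using assms(4) by auto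
    then show ?thesis using insert g by (simp add: avg_insert algebra_simps)
  next
    case False
    then show ?thesis using insert f by (simp add: avg_insert algebra_simps)
  qed
qed simp

text \<open>The current value of bit \<open>x\<close> selects one of the two halves whose mean is
  the average over \<open>insert x U\<close>; the other half is nonnegative.\<close>

lemma avg_le_twice:
  assumes "finite U" "x \<notin> U" "\<And>B. 0 \<le> f B"
  shows "avg U f B \<le> 2 * avg (insert x U) f B"
proof -
  have "avg U f B \<in> {avg U f (insert x B), avg U f (B - {x})}"
    by (cases "x \<in> B") (auto simp: insert_absorb)
  moreover have "0 \<le> avg U f (insert x B)" "0 \<le> avg U f (B - {x})"
    using assms(3) by (auto intro: avg_nonneg)
  ultimately show ?thesis using assms by (auto simp: avg_insert)
qed

lemma depends_prod:
  assumes "\<And>v. v \<in> V \<Longrightarrow> depends (D v) (f v)"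
  shows "depends (\<Union>v\<in>V. D v) (\<lambda>B. \<Prod>v\<in>V. (f v B :: real))"
  unfolding depends_def
proof (intro allI impI prod.cong refl)
  fix B B' v assume "B \<inter> (\<Union>v\<in>V. D v) = B' \<inter> (\<Union>v\<in>V. D v)" "v \<in> V"
  then show "f v B = f v B'" by (intro dependsD[OF assms]) blast+
qed

lemma avg_prod:
  assumes "finite U" "finite V" "\<And>v. v \<in> V \<Longrightarrow> depends (D v) (f v)"
    "\<And>v w. v \<in> V \<Longrightarrow> w \<in> V \<Longrightarrow> v \<noteq> w \<Longrightarrow> D v \<inter> D w = {}"
  shows "avg U (\<lambda>B. \<Prod>v\<in>V. f v B) B = (\<Prod>v\<in>V. avg U (f v) B)"
  using assms(2-4)
proof (induction V)
  case (insert v V)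
  have "avg U (\<lambda>B. f v B * (\<Prod>v\<in>V. f v B)) B = avg U (f v) B * avg U (\<lambda>B. \<Prod>v\<in>V. f v B) B"
  proof (rule avg_mult[OF assms(1)])
    show "depends (D v) (f v)" using insert by simp
    show "depends (\<Union>v\<in>V. D v) (\<lambda>B. \<Prod>v\<in>V. f v B)" using insert by (intro depends_prod) simp
    show "D v \<inter> (\<Union>v\<in>V. D v) = {}" using insert by blast
  qed
  then show ?case using insert by simp
qed (use assms(1) in simp)

text \<open>If the revealed coordinates \<open>S B\<close> can be recognised from their own bits, then the
subcubes that fix them partition the cube, so revealing them does not change the mean.\<close>

lemma avg_adaptive:
  assumes "finite X" "\<And>B. S B \<subseteq> X"
    and det: "\<And>B B'. B \<inter> S B = B' \<inter> S B \<Longrightarrow> S B' = S B"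
  shows "avg X (\<lambda>B. avg (X - S B) f B) {} = avg X f {}"
proof -
  \<comment> \<open>\<open>cl B\<close> is the subcube through \<open>B\<close> that fixes the
    revealed bits. By \<open>det\<close>, two subcubes that meet coincide.\<close>
  define cl where "cl B = {C \<in> Pow X. C \<inter> S B = B \<inter> S B}" for B
  have fin: "finite (cl B)" for B using assms(1) by (simp add: cl_def)
  have avg_cl: "avg (X - S B) f B = (\<Sum>C\<in>cl B. f C / card (cl B))" if "B \<in> Pow X" for B
  proof -
    have bij: "bij_betw (\<lambda>W. (B - (X - S B)) \<union> W) (Pow (X - S B)) (cl B)"
      by (rule bij_betwI[where g = "\<lambda>C. C - S B"]) (use that assms(2)[of B] in \<open>auto simp: cl_def\<close>)
    then have "card (cl B) = 2 ^ card (X - S B)"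
      using assms(1) by (simp add: bij_betw_same_card[symmetric] card_Pow)
    moreover have "(\<Sum>W\<in>Pow (X - S B). f ((B - (X - S B)) \<union> W)) = (\<Sum>C\<in>cl B. f C)"
      by (rule sum.reindex_bij_betw[OF bij])
    ultimately show ?thesis by (simp add: avg_def sum_divide_distrib[symmetric])
  qed
  have cl_eq: "cl C = cl B" if "C \<in> cl B" for B C
    using that det[of B C] by (auto simp: cl_def)
  \<comment> \<open>Double counting: \<open>f C\<close> is collected once from every
    \<open>B\<close> in the subcube of \<open>C\<close>, each time divided by the size of that
    subcube.\<close>
  have "(\<Sum>B\<in>Pow X. avg (X - S B) f B) = (\<Sum>B\<in>Pow X. \<Sum>C\<in>{C \<in> Pow X. C \<in> cl B}. f C / card (cl B))"
    by (rule sum.cong[OF refl]) (auto simp: avg_cl cl_def intro!: sum.cong)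
  also have "\<dots> = (\<Sum>C\<in>Pow X. \<Sum>B\<in>{B \<in> Pow X. C \<in> cl B}. f C / card (cl B))"
    by (rule sum.swap_restrict) (use assms(1) in auto)
  also have "\<dots> = (\<Sum>C\<in>Pow X. f C)"
  proof (rule sum.cong[OF refl])
    fix C assume C: "C \<in> Pow X"
    have eq: "{B \<in> Pow X. C \<in> cl B} = cl C"
    proof (intro set_eqI iffI)
      fix B assume "B \<in> {B \<in> Pow X. C \<in> cl B}"
      then show "B \<in> cl C" using cl_eq[of C B] by (auto simp: cl_def)
    next
      fix B assume "B \<in> cl C"
      then show "B \<in> {B \<in> Pow X. C \<in> cl B}" using cl_eq[of B C] C by (auto simp: cl_def)
    qed
    have "(\<Sum>B\<in>cl C. f C / card (cl B)) = (\<Sum>B\<in>cl C. f C / card (cl C))"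
      by (rule sum.cong[OF refl]) (simp add: cl_eq)
    moreover have "C \<in> cl C" using C by (simp add: cl_def)
    then have "card (cl C) \<noteq> 0" using fin by auto
    ultimately show "(\<Sum>B\<in>{B \<in> Pow X. C \<in> cl B}. f C / card (cl B)) = f C" unfolding eq by simp
  qed
  finally have "(\<Sum>B\<in>Pow X. avg (X - S B) f B) = (\<Sum>C\<in>Pow X. f C)" .
  then show ?thesis by (simp add: avg_def)
qed

section \<open>The symmetric Lovasz local lemma\<close>

text \<open>Induction over sets of avoided events. The usual bound \<open>2 * q\<close> on the
  conditional probability is stated multiplied out, so that no division by the avoidance probability
  occurs. Bits outside \<open>U\<close> keep their values in \<open>B0\<close>, which is how already
  fixed bits enter.\<close>

lemma lovasz_local_lemma:
  fixes E :: "'v \<Rightarrow> 'b set \<Rightarrow> bool"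
  assumes fin: "finite U" "finite V"
    and dep: "\<And>v. v \<in> V \<Longrightarrow> depends (D v) (E v)"
    and nb: "\<And>v. v \<in> V \<Longrightarrow> finite (N v) \<and> card (N v) \<le> d"
      "\<And>v w. v \<in> V \<Longrightarrow> w \<in> V \<Longrightarrow> w \<notin> N v \<Longrightarrow> D v \<inter> D w = {}"
    and q: "\<And>v. v \<in> V \<Longrightarrow> avg U (\<lambda>B. of_bool (E v B)) B0 \<le> q" "0 \<le> q" "4 * q * d \<le> 1" "1 \<le> d"
  shows "\<exists>W\<subseteq>U. \<forall>v\<in>V. \<not> E v ((B0 - U) \<union> W)"
proof -
  define P where "P Q = avg U (\<lambda>B. of_bool (Q B) :: real) B0" for Q
  define none where "none S B \<longleftrightarrow> (\<forall>v\<in>S. \<not> E v B)" for S B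
  have q4: "q \<le> 1 / 4" using q(2-4) mult_left_mono[of 1 "real d" "4 * q"] by simp
  have Pmono: "P Q \<le> P R" if "\<And>B. Q B \<Longrightarrow> R B" for Q R
    unfolding P_def using that by (intro avg_mono) auto
  have depnone: "depends (\<Union>v\<in>S. D v) (none S)" if "S \<subseteq> V" for S
    unfolding depends_def none_def
  proof (intro allI impI ball_cong refl)
    fix B B' v assume "B \<inter> (\<Union>v\<in>S. D v) = B' \<inter> (\<Union>v\<in>S. D v)" "v \<in> S"
    then show "(\<not> E v B) = (\<not> E v B')" using that dependsD[OF dep[of v], of B B'] by blast
  qed
  have main: "P (none S) > 0 \<and> (\<forall>v\<in>V. P (\<lambda>B. E v B \<and> none S B) \<le> 2 * q * P (none S))"
    if "S \<subseteq> V" for S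
    using finite_subset[OF that fin(2)] that
  proof (induction S rule: finite_psubset_induct)
    case (psubset S)
    have step: "P (none (insert w R)) = P (none R) - P (\<lambda>B. E w B \<and> none R B)" for w R
    proof -
      have "of_bool (none (insert w R) B) = (of_bool (none R B) - of_bool (E w B \<and> none R B) :: real)" for B
        by (auto simp: none_def)
      then show ?thesis unfolding P_def by (simp add: avg_diff[symmetric])
    qed
    have pos: "P (none S) > 0"
    proof (cases "S = {}")
      case True
      then show ?thesis by (simp add: P_def none_def fin)
    next
      case False
      then obtain w where w: "w \<in> S" by auto
      let ?R = "S - {w}"
      have IH: "P (none ?R) > 0" "P (\<lambda>B. E w B \<and> none ?R B) \<le> 2 * q * P (none ?R)"
        using psubset.IH[of ?R] w psubset.prems by auto
      have "2 * q * P (none ?R) \<le> 1 / 2 * P (none ?R)" using IH(1) q4 by (intro mult_right_mono) auto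
      moreover have "insert w ?R = S" using w by auto
      ultimately show ?thesis using step[of w ?R] IH unfolding \<open>insert w ?R = S\<close> by linarith
    qed
    have "P (\<lambda>B. E v B \<and> none S B) \<le> 2 * q * P (none S)" if v: "v \<in> V" for v
    proof -
      \<comment> \<open>Events outside \<open>N v\<close> share no bits with \<open>E v\<close> and
        are independent of it; forgetting the others costs a factor of at most 2.\<close>
      define S2 where "S2 = S - N v"
      have "P (\<lambda>B. E v B \<and> none S B) \<le> P (\<lambda>B. E v B \<and> none S2 B)"
        by (rule Pmono) (auto simp: none_def S2_def)
      also have "\<dots> = avg U (\<lambda>B. of_bool (E v B) * of_bool (none S2 B)) B0"
        unfolding P_def by (intro arg_cong[of _ _ "\<lambda>f. avg U f B0"]) auto
      also have "\<dots> = avg U (\<lambda>B. of_bool (E v B)) B0 * avg U (\<lambda>B. of_bool (none S2 B)) B0"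
      proof (rule avg_mult[OF fin(1)])
        show "depends (D v) (\<lambda>B. of_bool (E v B))" by (rule depends_comp[OF dep[OF v]])
        show "depends (\<Union>v\<in>S2. D v) (\<lambda>B. of_bool (none S2 B))"
          by (rule depends_comp[OF depnone]) (use psubset.prems in \<open>auto simp: S2_def\<close>)
        show "D v \<inter> (\<Union>v\<in>S2. D v) = {}" using nb(2)[OF v] psubset.prems by (auto simp: S2_def)
      qed
      also have "\<dots> \<le> q * P (none S2)"
        unfolding P_def using q(1)[OF v] by (intro mult_right_mono avg_nonneg) auto
      finally have 1: "P (\<lambda>B. E v B \<and> none S B) \<le> q * P (none S2)" .
      have 2: "P (none S2) \<le> 2 * P (none S)"
      proof (cases "S2 = S")
        case True
        then show ?thesis using pos by simp
      next
        case False
        then have "S2 \<subset> S" by (auto simp: S2_def)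
        then have IH: "P (none S2) > 0" "\<And>w. w \<in> V \<Longrightarrow> P (\<lambda>B. E w B \<and> none S2 B) \<le> 2 * q * P (none S2)"
          using psubset.IH[of S2] psubset.prems by auto
        have finN: "finite (S \<inter> N v)" using psubset.hyps by simp
        \<comment> \<open>If the events in \<open>S2\<close> are avoided but some event in
          \<open>S\<close> occurs, that event lies in \<open>S \<inter> N v\<close> and is counted
          by the sum.\<close>
        have "of_bool (none S2 B) - (\<Sum>w\<in>S \<inter> N v. of_bool (E w B \<and> none S2 B)) \<le> (of_bool (none S B) :: real)" for B
        proof (cases "none S2 B \<and> \<not> none S B")
          case True
          then obtain w where w: "w \<in> S \<inter> N v" "E w B" by (auto simp: none_def S2_def)
          then have "(1::real) \<le> (\<Sum>w\<in>S \<inter> N v. of_bool (E w B \<and> none S2 B))"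
            using member_le_sum[of w "S \<inter> N v" "\<lambda>w. of_bool (E w B \<and> none S2 B) :: real"] finN True by simp
          moreover have "of_bool (none S2 B) = (1::real)" "of_bool (none S B) = (0::real)" using True by simp_all
          ultimately show ?thesis by linarith
        next
          case False
          have "(0::real) \<le> (\<Sum>w\<in>S \<inter> N v. of_bool (E w B \<and> none S2 B))" by (intro sum_nonneg) auto
          moreover have "of_bool (none S2 B) \<le> (of_bool (none S B) :: real)" using False by auto
          ultimately show ?thesis by linarith
        qed
        then have "avg U (\<lambda>B. of_bool (none S2 B) - (\<Sum>w\<in>S \<inter> N v. of_bool (E w B \<and> none S2 B))) B0 \<le> P (none S)"
          unfolding P_def by (rule avg_mono)
        then have "P (none S2) - (\<Sum>w\<in>S \<inter> N v. P (\<lambda>B. E w B \<and> none S2 B)) \<le> P (none S)"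
          unfolding avg_diff avg_sum P_def .
        moreover have "(\<Sum>w\<in>S \<inter> N v. P (\<lambda>B. E w B \<and> none S2 B)) \<le> (\<Sum>w\<in>S \<inter> N v. 2 * q * P (none S2))"
          using IH(2) psubset.prems by (intro sum_mono) auto
        moreover have "(\<Sum>w\<in>S \<inter> N v. 2 * q * P (none S2)) \<le> 1 / 2 * P (none S2)"
        proof -
          have "card (S \<inter> N v) \<le> d" using nb(1)[OF v] card_mono[of "N v" "S \<inter> N v"] by auto
          then have "real (card (S \<inter> N v)) * (2 * q) \<le> real d * (2 * q)" using q(2) by (intro mult_right_mono) auto
          also have "\<dots> \<le> 1 / 2" using q(3) by (simp add: mult.commute mult.left_commute)
          finally show ?thesis using IH(1) by (simp add: mult_right_mono mult.assoc[symmetric])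
        qed
        ultimately show ?thesis by simp
      qed
      show ?thesis using 1 mult_left_mono[OF 2 q(2)] by simp
    qed
    then show ?case using pos by blast
  qed
  have "P (none V) > 0" using main[of V] by simp
  then obtain W where "W \<in> Pow U" "of_bool (none V ((B0 - U) \<union> W)) \<noteq> (0::real)"
    unfolding P_def avg_def by (metis (no_types, lifting) div_0 less_irrefl sum.neutral)
  then show ?thesis by (auto simp: none_def split: if_splits)
qed

section \<open>Counting\<close>

lemma card_small_subsets:
  assumes "finite A"
  shows "finite {S. S \<subseteq> A \<and> card S \<le> D} \<and> card {S. S \<subseteq> A \<and> card S \<le> D} \<le> (card A + 1) ^ D"
proof (induction D)
  case 0
  have "{S. S \<subseteq> A \<and> card S \<le> 0} = {{}}" using assms finite_subset by fastforce
  then show ?case by simp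
next
  case (Suc D)
  let ?F = "{S. S \<subseteq> A \<and> card S \<le> D}"
  have "{S. S \<subseteq> A \<and> card S \<le> Suc D} \<subseteq> ?F \<union> (\<lambda>(x, S). insert x S) ` (A \<times> ?F)"
  proof
    fix S assume S: "S \<in> {S. S \<subseteq> A \<and> card S \<le> Suc D}"
    show "S \<in> ?F \<union> (\<lambda>(x, S). insert x S) ` (A \<times> ?F)"
    proof (cases "S = {}")
      case False
      then obtain x where x: "x \<in> S" by auto
      have "finite S" using S assms finite_subset by auto
      then have "(x, S - {x}) \<in> A \<times> ?F" using x S by auto
      moreover have "S = (\<lambda>(x, S). insert x S) (x, S - {x})" using x by auto
      ultimately show ?thesis by blast
    qed simp
  qed
  moreover have fin: "finite (?F \<union> (\<lambda>(x, S). insert x S) ` (A \<times> ?F))" using assms Suc by auto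
  moreover have "card (?F \<union> (\<lambda>(x, S). insert x S) ` (A \<times> ?F)) \<le> (card A + 1) ^ Suc D"
  proof -
    have "card (?F \<union> (\<lambda>(x, S). insert x S) ` (A \<times> ?F)) \<le> card ?F + card (A \<times> ?F)"
      by (intro order_trans[OF card_Un_le] add_mono card_image_le order_refl) (use assms Suc in auto)
    also have "\<dots> = (card A + 1) * card ?F" by (simp add: card_cartesian_product)
    also have "\<dots> \<le> (card A + 1) * (card A + 1) ^ D" using Suc by (intro mult_left_mono) auto
    finally show ?thesis by simp
  qed
  ultimately show ?case by (meson card_mono finite_subset le_trans)
qed

lemma ex_inj_on_card_le:
  assumes "finite A" "card A \<le> N"
  shows "\<exists>e::'a \<Rightarrow> nat. inj_on e A \<and> e ` A \<subseteq> {..<N}"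
  using assms by (metis card_le_inj card_lessThan finite_lessThan)

section \<open>Sampling with freezing\<close>

declare nbh.simps(2) [simp del]

definition blk :: "pgraph \<Rightarrow> nat \<Rightarrow> nat \<Rightarrow> nat \<Rightarrow> (nat \<times> nat) set" where
  "blk G s h v = nbh G s v \<times> {..<h}"

text \<open>The conditional probability of the violation at \<open>v\<close>, given the values in
  \<open>B\<close> of the bits in \<open>S\<close>.\<close>

definition risk ::
  "pgraph \<Rightarrow> nat \<Rightarrow> nat \<Rightarrow> (nat \<Rightarrow> (nat \<times> nat) set \<Rightarrow> bool) \<Rightarrow> (nat \<times> nat) set \<Rightarrow> (nat \<times> nat) set \<Rightarrow> nat \<Rightarrow> real" where
  "risk G s h E S B v = avg (blk G s h v - S) (\<lambda>B. of_bool (E v B)) B"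

text \<open>The number \<open>j\<close> encodes a colour and a bit index. Nodes of one colour are
  far apart, so a single step reveals at most one bit of each block, and a risk can at most double
  in it. A bit is withheld if any violation that reads it has risk above
  \<open>\<theta>\<close>.\<close>

definition sampled where
  "sampled G s h E \<theta> col S B j =
     {(u, i). u \<in> verts G \<and> i < h \<and> i = j mod h \<and> col u = j div h \<and> (\<forall>v\<in>nbh G s u. risk G s h E S B v \<le> \<theta>)}"

primrec presampled where
  "presampled G s h E \<theta> col B 0 = {}"
| "presampled G s h E \<theta> col B (Suc j) =
     presampled G s h E \<theta> col B j \<union> sampled G s h E \<theta> col (presampled G s h E \<theta> col B j) B j"

definition distinct_col :: "pgraph \<Rightarrow> nat \<Rightarrow> (nat \<Rightarrow> nat) \<Rightarrow> bool" where
  "distinct_col G d col \<longleftrightarrow> (\<forall>u\<in>verts G. \<forall>w\<in>nbh G d u. w \<noteq> u \<longrightarrow> col u \<noteq> col w)"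

definition walks :: "pgraph \<Rightarrow> nat \<Rightarrow> nat \<Rightarrow> nat list set" where
  "walks G t l = {xs. length xs = Suc l \<and> set xs \<subseteq> verts G \<and> successively (\<lambda>x y. x \<in> nbh G t y) xs}"

text \<open>Connectivity in cut form: no proper nonempty part is closed under taking neighbours
  inside \<open>C\<close>. The empty set counts as connected.\<close>

definition conn :: "pgraph \<Rightarrow> nat set \<Rightarrow> bool" where
  "conn G C \<longleftrightarrow> (\<forall>A\<subseteq>C. A \<noteq> {} \<longrightarrow> (\<forall>x\<in>A. set (nbrs G x) \<inter> C \<subseteq> A) \<longrightarrow> A = C)"

locale sampling = bgraph +
  fixes s h :: nat and E :: "nat \<Rightarrow> (nat \<times> nat) set \<Rightarrow> bool" and \<theta> p :: real
    and col :: "nat \<Rightarrow> nat" and K d :: nat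
  assumes dep: "v \<in> verts G \<Longrightarrow> depends (blk G s h v) (E v)"
    and prob: "v \<in> verts G \<Longrightarrow> avg (blk G s h v) (\<lambda>B. of_bool (E v B)) B \<le> p"
    and p_pos: "0 \<le> p" and p_le: "p \<le> 2 * \<theta>" and theta_pos: "0 < \<theta>"
    and col_bound: "v \<in> verts G \<Longrightarrow> col v < K" and col_distinct: "distinct_col G d col" and sd: "2 * s \<le> d"
begin

abbreviation bits where "bits \<equiv> verts G \<times> {..<h}"
abbreviation rsk where "rsk \<equiv> risk G s h E"
abbreviation pre where "pre \<equiv> presampled G s h E \<theta> col"

lemma finite_blk [simp]: "finite (blk G s h v)"
  by (simp add: blk_def)

lemma blk_bits: "v \<in> verts G \<Longrightarrow> blk G s h v \<subseteq> bits"
  using nbh_verts by (auto simp: blk_def)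

lemma depE: "v \<in> verts G \<Longrightarrow> depends (blk G s h v) (\<lambda>B. of_bool (E v B) :: real)"
  by (rule depends_comp[OF dep])

lemma risk_nonneg: "0 \<le> rsk S B v"
  unfolding risk_def by (rule avg_nonneg) simp

lemma risk_bits_cong:
  assumes "v \<in> verts G" "B \<inter> S = B' \<inter> S"
  shows "rsk S B v = rsk S B' v"
  unfolding risk_def
  by (rule dependsD[OF depends_avg[OF depE[OF assms(1)]]]) (use assms(2) in blast)

lemma risk_eq_avg_bits: "v \<in> verts G \<Longrightarrow> rsk S B v = avg (bits - S) (\<lambda>B. of_bool (E v B)) B"
proof -
  assume v: "v \<in> verts G"
  then have "(bits - S) \<inter> blk G s h v = blk G s h v - S" using blk_bits by blast
  then show ?thesis unfolding risk_def by (subst avg_Int[OF _ depE[OF v], of "bits - S"]) simp_all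
qed

lemma pre_bits: "pre B j \<subseteq> bits"
  by (induction j) (auto simp: sampled_def)

text \<open>Whether a bit is sampled depends on risks, and a risk reads only bits revealed earlier.
  This is the hypothesis \<open>det\<close> of \<open>avg_adaptive\<close>.\<close>

lemma pre_determined: "B \<inter> pre B j = B' \<inter> pre B j \<Longrightarrow> pre B' j = pre B j"
proof (induction j)
  case (Suc j)
  then have 1: "pre B' j = pre B j" "B \<inter> pre B j = B' \<inter> pre B j" by auto
  have "rsk (pre B j) B' v = rsk (pre B j) B v" if "v \<in> verts G" for v
    by (rule risk_bits_cong[OF that]) (use 1 in simp)
  then show ?case using 1 nbh_verts by (auto simp: sampled_def subset_iff)
qed simp

lemma same_col_unique:
  assumes "v \<in> verts G" "u \<in> nbh G s v" "u' \<in> nbh G s v" "col u = col u'"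
  shows "u = u'"
proof -
  have "u \<in> verts G" using assms nbh_verts by blast
  moreover have "u' \<in> nbh G d u"
    using nbh_trans_le[OF nbh_sym[OF assms(1,2)] assms(3)] sd by simp
  ultimately show ?thesis using assms(4) col_distinct unfolding distinct_col_def by metis
qed

text \<open>At most one bit of the block is new, and it was sampled only because the risk was at
  most \<open>\<theta>\<close>, so doubling stays within \<open>2 * \<theta>\<close>.\<close>

lemma risk_sampled_le:
  assumes v: "v \<in> verts G" and le: "rsk (pre B j) B v \<le> 2 * \<theta>"
  shows "rsk (pre B (Suc j)) B v \<le> 2 * \<theta>"
proof (cases "blk G s h v \<inter> sampled G s h E \<theta> col (pre B j) B j \<subseteq> pre B j")
  case True
  then have "blk G s h v - pre B (Suc j) = blk G s h v - pre B j" by auto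
  then show ?thesis using le by (simp add: risk_def)
next
  case False
  then obtain u i where u: "(u, i) \<in> blk G s h v" "(u, i) \<in> sampled G s h E \<theta> col (pre B j) B j" "(u, i) \<notin> pre B j"
    by auto
  have uniq: "x = (u, i)" if "x \<in> blk G s h v" "x \<in> sampled G s h E \<theta> col (pre B j) B j" for x
  proof (cases x)
    case (Pair u' i')
    have "u' = u" using that u same_col_unique[OF v, of u' u] unfolding Pair blk_def sampled_def by simp
    moreover have "i' = i" using that u unfolding Pair sampled_def by simp
    ultimately show ?thesis using Pair by simp
  qed
  have "blk G s h v - pre B j = insert (u, i) (blk G s h v - pre B (Suc j))"
  proof (intro equalityI subsetI)
    fix x assume x: "x \<in> blk G s h v - pre B j"
    show "x \<in> insert (u, i) (blk G s h v - pre B (Suc j))"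
      using uniq[of x] x by (cases "x \<in> sampled G s h E \<theta> col (pre B j) B j") simp_all
  qed (use u in auto)
  then have "rsk (pre B (Suc j)) B v \<le> 2 * rsk (pre B j) B v"
    using avg_le_twice[of "blk G s h v - pre B (Suc j)" "(u, i)" "\<lambda>B. of_bool (E v B)" B] u(2)
    by (simp add: risk_def)
  moreover have "v \<in> nbh G s u" using u(1) nbh_sym[OF v] by (auto simp: blk_def)
  then have "rsk (pre B j) B v \<le> \<theta>" using u(2) by (auto simp: sampled_def)
  ultimately show ?thesis by simp
qed

lemma risk_pre_le: "v \<in> verts G \<Longrightarrow> rsk (pre B j) B v \<le> 2 * \<theta>"
proof (induction j)
  case 0
  then show ?case using prob[OF 0] p_le by (auto simp: risk_def intro: order_trans)
next
  case (Suc j)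
  then show ?case using risk_sampled_le by blast
qed

definition marked :: "(nat \<times> nat) set \<Rightarrow> nat set" where
  "marked B = {v \<in> verts G. rsk (pre B (K * h)) B v > \<theta>}"

text \<open>A node above \<open>\<theta>\<close> vetoes every bit of its own block, so its risk
  never changes again.\<close>

lemma risk_frozen: "v \<in> verts G \<Longrightarrow> rsk (pre B j) B v > \<theta> \<Longrightarrow> rsk (pre B (j + k)) B v = rsk (pre B j) B v"
proof (induction k)
  case (Suc k)
  have "blk G s h v \<inter> sampled G s h E \<theta> col (pre B (j + k)) B (j + k) = {}"
    using Suc nbh_sym by (fastforce simp: sampled_def blk_def)
  then have "blk G s h v - pre B (j + Suc k) = blk G s h v - pre B (j + k)" by auto
  then show ?case using Suc by (simp add: risk_def)
qed simp

text \<open>Each bit has exactly one step in which it may be sampled. The node that vetoed it there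
  is frozen above \<open>\<theta>\<close> and hence still marked at the end.\<close>

lemma unset_near_marked:
  assumes "u \<in> verts G" "i < h" "(u, i) \<notin> pre B (K * h)"
  shows "\<exists>v\<in>marked B. v \<in> nbh G s u"
proof -
  \<comment> \<open>The step reserved for bit \<open>i\<close> of the nodes that have the colour of
    \<open>u\<close>.\<close>
  define j where "j = col u * h + i"
  have mono: "pre B j \<subseteq> pre B (j + k)" for j k by (induction k) auto
  have "col u * h + i < Suc (col u) * h" using assms(2) by simp
  also have "\<dots> \<le> K * h" using col_bound[OF assms(1)] by (intro mult_right_mono) auto
  finally have j: "Suc j \<le> K * h" by (simp add: j_def)
  then have "(u, i) \<notin> pre B (Suc j)" using mono[of "Suc j" "K * h - Suc j"] assms(3)
    unfolding le_add_diff_inverse[OF j] by blast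
  then have "(u, i) \<notin> sampled G s h E \<theta> col (pre B j) B j" by simp
  moreover have "i = j mod h" "col u = j div h" using assms(2) by (auto simp: j_def)
  ultimately obtain v where v: "v \<in> nbh G s u" "rsk (pre B j) B v > \<theta>"
    using assms(1,2) by (auto simp: sampled_def not_le)
  have "v \<in> verts G" using v assms(1) nbh_verts by blast
  then have "v \<in> marked B"
    using risk_frozen[OF _ v(2), of "K * h - j"] v(2) j by (simp add: marked_def)
  then show ?thesis using v(1) by blast
qed

text \<open>Markov's inequality for the product of the violations. If all of \<open>V\<close> is
  marked, the conditional mean of the product is at least \<open>\<theta> ^ card V\<close>, because
  the blocks are disjoint; and revealing bits adaptively leaves the overall mean at most
  \<open>p ^ card V\<close>.\<close>

lemma prob_all_marked:
  assumes V: "V \<subseteq> verts G" and disj: "\<And>u v. u \<in> V \<Longrightarrow> v \<in> V \<Longrightarrow> u \<noteq> v \<Longrightarrow> nbh G s u \<inter> nbh G s v = {}"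
  shows "avg bits (\<lambda>B. of_bool (V \<subseteq> marked B)) {} \<le> (p / \<theta>) ^ card V"
proof -
  have finV: "finite V" using V finite_verts finite_subset by blast
  define F where "F B = (\<Prod>v\<in>V. of_bool (E v B) :: real)" for B
  have disj': "blk G s h u \<inter> blk G s h v = {}" if "u \<in> V" "v \<in> V" "u \<noteq> v" for u v
    using disj[OF that] by (auto simp: blk_def)
  have avgF: "avg U F B = (\<Prod>v\<in>V. avg U (\<lambda>B. of_bool (E v B)) B)" if "finite U" for U B
    unfolding F_def
  proof (rule avg_prod[OF that finV])
    show "depends (blk G s h v) (\<lambda>B. of_bool (E v B) :: real)" if "v \<in> V" for v
      using that V by (intro depE) blast
  qed (rule disj')
  have "\<theta> ^ card V * avg bits (\<lambda>B. of_bool (V \<subseteq> marked B)) {} = avg bits (\<lambda>B. \<theta> ^ card V * of_bool (V \<subseteq> marked B)) {}"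
    by (rule avg_cmult[symmetric])
  also have "\<dots> \<le> avg bits (\<lambda>B. avg (bits - pre B (K * h)) F B) {}"
  proof (rule avg_mono)
    fix B
    have eq: "avg (bits - pre B (K * h)) F B = (\<Prod>v\<in>V. rsk (pre B (K * h)) B v)"
      using V by (subst avgF) (auto intro!: prod.cong simp: risk_eq_avg_bits)
    show "\<theta> ^ card V * of_bool (V \<subseteq> marked B) \<le> avg (bits - pre B (K * h)) F B"
    proof (cases "V \<subseteq> marked B")
      case True
      then have "(\<Prod>v\<in>V. \<theta>) \<le> (\<Prod>v\<in>V. rsk (pre B (K * h)) B v)"
        using theta_pos by (intro prod_mono) (auto simp: marked_def)
      then show ?thesis using True eq by simp
    next
      case False
      then show ?thesis unfolding eq by (simp add: prod_nonneg risk_nonneg)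
    qed
  qed
  also have "\<dots> = avg bits F {}"
    by (rule avg_adaptive[OF _ pre_bits]) (simp, rule pre_determined)
  also have "\<dots> = (\<Prod>v\<in>V. avg (blk G s h v) (\<lambda>B. of_bool (E v B)) {})"
  proof -
    have "avg bits (\<lambda>B. of_bool (E v B) :: real) {} = avg (blk G s h v) (\<lambda>B. of_bool (E v B)) {}" if "v \<in> V" for v
      using risk_eq_avg_bits[of v "{}" "{}"] that V by (auto simp: risk_def)
    then show ?thesis by (subst avgF) (auto intro: prod.cong)
  qed
  also have "\<dots> \<le> (\<Prod>v\<in>V. p)"
    using V prob by (intro prod_mono) (auto intro: avg_nonneg)
  finally have "\<theta> ^ card V * avg bits (\<lambda>B. of_bool (V \<subseteq> marked B)) {} \<le> p ^ card V" by simp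
  then show ?thesis using theta_pos by (simp add: power_divide field_simps)
qed

end

section \<open>Shattering\<close>

text \<open>A walk around a growing tree: each new element \<open>y\<close> is attached to a visited
  \<open>x\<close> by the detour \<open>x, y, x\<close>, which adds two entries for one new
  element.\<close>

lemma walk_covering:
  assumes fin: "finite M" and k: "1 \<le> k" "k \<le> card M"
    and sym: "\<And>x y. x \<in> M \<Longrightarrow> y \<in> M \<Longrightarrow> R x y \<Longrightarrow> R y x"
    and con: "\<And>A. A \<subseteq> M \<Longrightarrow> A \<noteq> {} \<Longrightarrow> (\<And>x y. x \<in> A \<Longrightarrow> y \<in> M \<Longrightarrow> R x y \<Longrightarrow> y \<in> A) \<Longrightarrow> A = M"
  shows "\<exists>xs. length xs = 2 * k - 1 \<and> set xs \<subseteq> M \<and> card (set xs) = k \<and> successively R xs"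
  using k
proof (induction k)
  case (Suc k)
  show ?case
  proof (cases "k = 0")
    case True
    have "M \<noteq> {}" using Suc.prems by auto
    then obtain x where "x \<in> M" by blast
    then show ?thesis using True by (intro exI[of _ "[x]"]) auto
  next
    case False
    then obtain xs where xs: "length xs = 2 * k - 1" "set xs \<subseteq> M" "card (set xs) = k" "successively R xs"
      using Suc by auto
    have "set xs \<noteq> M" using xs(3) Suc.prems by auto
    moreover have "set xs \<noteq> {}" using xs(3) False by auto
    ultimately obtain x y where xy: "x \<in> set xs" "y \<in> M" "R x y" "y \<notin> set xs"
      using con[OF xs(2)] by blast
    obtain as bs where sp: "xs = as @ x # bs" using split_list[OF xy(1)] by blast
    have "R y x" using sym xy xs(2) by blast
    then have "successively R (as @ x # y # x # bs)"
      using xs(4) xy(3) unfolding sp by (simp add: successively_append_iff)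
    moreover have "set (as @ x # y # x # bs) = insert y (set xs)" using sp by auto
    ultimately show ?thesis using xs xy False sp
      by (intro exI[of _ "as @ x # y # x # bs"]) auto
  qed
qed simp

context bgraph
begin

lemma walks_bound: "finite (walks G t l) \<and> card (walks G t l) \<le> card (verts G) * ((\<Delta> + 2) ^ t) ^ l"
proof (induction l)
  case 0
  have "walks G t 0 = (\<lambda>x. [x]) ` verts G"
    by (auto simp: walks_def length_Suc_conv)
  then show ?case by (simp add: card_image_le)
next
  case (Suc l)
  let ?f = "\<lambda>ys. (\<lambda>x. x # ys) ` nbh G t (hd ys)"
  have sub: "walks G t (Suc l) \<subseteq> (\<Union>ys\<in>walks G t l. ?f ys)"
  proof
    fix xs assume "xs \<in> walks G t (Suc l)"
    then obtain x ys where "xs = x # ys" "ys \<in> walks G t l" "x \<in> nbh G t (hd ys)"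
      by (auto simp: walks_def length_Suc_conv)
    then show "xs \<in> (\<Union>ys\<in>walks G t l. ?f ys)" by blast
  qed
  have "card (\<Union>ys\<in>walks G t l. ?f ys) \<le> (\<Sum>ys\<in>walks G t l. card (?f ys))"
    using Suc by (intro card_UN_le) simp
  also have "\<dots> \<le> (\<Sum>ys\<in>walks G t l. (\<Delta> + 2) ^ t)"
  proof (rule sum_mono)
    fix ys assume "ys \<in> walks G t l"
    then have "hd ys \<in> verts G" by (cases ys) (auto simp: walks_def)
    then show "card (?f ys) \<le> (\<Delta> + 2) ^ t"
      using card_nbh[of "hd ys" t] card_image_le[OF finite_nbh] le_trans by blast
  qed
  also have "\<dots> \<le> card (verts G) * ((\<Delta> + 2) ^ t) ^ l * (\<Delta> + 2) ^ t"
    using Suc by simp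
  finally have le: "card (\<Union>ys\<in>walks G t l. ?f ys) \<le> card (verts G) * ((\<Delta> + 2) ^ t) ^ Suc l"
    by (simp add: mult.commute mult.left_commute)
  moreover have "finite (\<Union>ys\<in>walks G t l. ?f ys)" using Suc by auto
  ultimately show ?case using sub by (meson card_mono finite_subset le_trans)
qed

text \<open>Take a maximal family of marked nodes whose \<open>z\<close>-balls meet \<open>C\<close>
  and whose \<open>s\<close>-balls are disjoint. By maximality the balls of radius
  \<open>z + 2 * s\<close> around it cover \<open>C\<close>, so the family is large. Since
  \<open>C\<close> is connected, the centres of adjacent balls link the whole family in steps of
  twice that radius plus 1.\<close>

lemma separated_walk:
  assumes C: "conn G C" "C \<subseteq> verts G" "C \<subseteq> (\<Union>v\<in>M. nbh G z v)" and M: "M \<subseteq> verts G"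
    and m: "1 \<le> m" "card C > m * (\<Delta> + 2) ^ (z + 2 * s)"
  shows "\<exists>xs\<in>walks G (2 * (z + 2 * s) + 1) (2 * m - 2). set xs \<subseteq> M \<and> card (set xs) = m \<and>
    (\<forall>u\<in>set xs. \<forall>v\<in>set xs. u \<noteq> v \<longrightarrow> nbh G s u \<inter> nbh G s v = {})"
proof -
  define r where "r = z + 2 * s"
  define MC where "MC = {v \<in> M. nbh G z v \<inter> C \<noteq> {}}"
  define sep where "sep N \<longleftrightarrow> N \<subseteq> MC \<and> (\<forall>u\<in>N. \<forall>v\<in>N. u \<noteq> v \<longrightarrow> nbh G s u \<inter> nbh G s v = {})" for N
  have finM: "finite M" using M finite_verts finite_subset by blast
  then have finMC: "finite MC" by (simp add: MC_def)
  then have "finite {N. sep N}" by (rule finite_subset[rotated, OF finite_Pow_iff[THEN iffD2]]) (auto simp: sep_def)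
  moreover have "sep {}" by (simp add: sep_def)
  ultimately obtain N where N: "sep N" and max: "\<And>N'. sep N' \<Longrightarrow> N \<subseteq> N' \<Longrightarrow> N' = N"
    using finite_has_maximal[of "{N. sep N}"] by auto
  have NM: "N \<subseteq> M" using N by (auto simp: sep_def MC_def)
  have finN: "finite N" using NM finM finite_subset by blast
  have near: "\<exists>v\<in>N. u \<in> nbh G (2 * s) v" if "u \<in> MC" for u
  proof (cases "u \<in> N")
    case True
    then show ?thesis by (intro bexI[of _ u]) simp_all
  next
    case False
    then have "\<not> sep (insert u N)" using max[of "insert u N"] by blast
    have "\<exists>v\<in>N. nbh G s u \<inter> nbh G s v \<noteq> {}"
    proof (rule ccontr)
      assume "\<not> ?thesis"
      then have "nbh G s u \<inter> nbh G s v = {} \<and> nbh G s v \<inter> nbh G s u = {}" if "v \<in> N" for v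
        using that by blast
      then have "sep (insert u N)" using N that unfolding sep_def by simp
      then show False using \<open>\<not> sep (insert u N)\<close> by simp
    qed
    then obtain v where v: "v \<in> N" "nbh G s u \<inter> nbh G s v \<noteq> {}" by blast
    have "v \<in> verts G" "u \<in> verts G" using v NM M that by (auto simp: MC_def)
    then show ?thesis using v nbh_common[of v u _ s s] by (auto simp: mult_2)
  qed
  have cover: "\<exists>v\<in>N. x \<in> nbh G r v" if x: "x \<in> C" for x
  proof -
    obtain u where u: "u \<in> M" "x \<in> nbh G z u" using x C(3) by blast
    then have "u \<in> MC" using x by (auto simp: MC_def)
    then obtain v where "v \<in> N" "u \<in> nbh G (2 * s) v" using near by blast
    then show ?thesis using nbh_trans_le[OF _ u(2), of "2 * s" v r] by (auto simp: r_def)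
  qed
  have "C \<subseteq> (\<Union>v\<in>N. nbh G r v)" using cover by blast
  then have "card C \<le> card (\<Union>v\<in>N. nbh G r v)" by (intro card_mono) (use finN in auto)
  also have "\<dots> \<le> (\<Sum>v\<in>N. card (nbh G r v))" by (rule card_UN_le[OF finN])
  also have "\<dots> \<le> (\<Sum>v\<in>N. (\<Delta> + 2) ^ r)" using NM M card_nbh by (intro sum_mono) blast
  finally have "card C \<le> card N * (\<Delta> + 2) ^ r" by simp
  with m(2) have "m * (\<Delta> + 2) ^ r < card N * (\<Delta> + 2) ^ r" unfolding r_def by (rule less_le_trans)
  then have mN: "m \<le> card N" by simp
  let ?R = "\<lambda>x y. x \<in> nbh G (2 * r + 1) y"
  have "\<exists>xs. length xs = 2 * m - 1 \<and> set xs \<subseteq> N \<and> card (set xs) = m \<and> successively ?R xs"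
  proof (rule walk_covering[OF finN m(1) mN])
    show "?R y x" if "x \<in> N" "y \<in> N" "?R x y" for x y
      using that nbh_sym[of y x] NM M by blast
    show "A = N" if A: "A \<subseteq> N" "A \<noteq> {}" "\<And>x y. x \<in> A \<Longrightarrow> y \<in> N \<Longrightarrow> ?R x y \<Longrightarrow> y \<in> A" for A
    proof -
      \<comment> \<open>The part of \<open>C\<close> near \<open>A\<close>. It is closed under
        neighbours in \<open>C\<close>, because the centres of two balls that hold adjacent nodes
        are related by \<open>?R\<close>.\<close>
      define D where "D = C \<inter> (\<Union>v\<in>A. nbh G r v)"
      obtain a where a: "a \<in> A" using A(2) by blast
      have "a \<in> MC" using a A(1) N by (auto simp: sep_def)
      then obtain x where "x \<in> nbh G z a" "x \<in> C" by (auto simp: MC_def)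
      then have "D \<noteq> {}" using a nbh_mono[of z r G a] by (auto simp: D_def r_def)
      moreover have "set (nbrs G x) \<inter> C \<subseteq> D" if x: "x \<in> D" for x
      proof
        fix y assume y: "y \<in> set (nbrs G x) \<inter> C"
        obtain v where v: "v \<in> A" "x \<in> nbh G r v" using x by (auto simp: D_def)
        obtain u where u: "u \<in> N" "y \<in> nbh G r u" using y cover by blast
        have V: "v \<in> verts G" "u \<in> verts G" using v(1) u(1) A(1) NM M by blast+
        have "y \<in> nbh G (Suc r) v" using y v(2) by (auto intro: nbh_step)
        then have "v \<in> nbh G (r + Suc r) u"
          using nbh_common[OF V(2) V(1) u(2)] by blast
        then have "?R v u" by (simp add: mult_2)
        then have "u \<in> A" using A(3)[OF v(1) u(1)] by blast
        then show "y \<in> D" using u(2) y by (auto simp: D_def)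
      qed
      ultimately have D: "D = C" using C(1) unfolding conn_def D_def by (metis Int_lower1)
      show "A = N"
      proof (intro subset_antisym A(1) subsetI)
        fix u assume u: "u \<in> N"
        then have "u \<in> MC" using N by (auto simp: sep_def)
        then obtain y where y: "y \<in> nbh G z u" "y \<in> C" by (auto simp: MC_def)
        then obtain v where v: "v \<in> A" "y \<in> nbh G r v" using D by (auto simp: D_def)
        have V: "v \<in> verts G" "u \<in> verts G" using v(1) u A(1) NM M by blast+
        have "v \<in> nbh G (z + r) u" using nbh_common[OF V(2) V(1) y(1) v(2)] .
        then have "?R v u" using nbh_mono[of "z + r" "2 * r + 1" G u] by (auto simp: r_def)
        then show "u \<in> A" using A(3)[OF v(1) u] by blast
      qed
    qed
  qed
  then obtain xs where xs: "length xs = 2 * m - 1" "set xs \<subseteq> N" "card (set xs) = m" "successively ?R xs" by blast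
  have "xs \<in> walks G (2 * (z + 2 * s) + 1) (2 * m - 2)"
    using xs NM M m(1) by (auto simp: walks_def r_def)
  moreover have "\<forall>u\<in>set xs. \<forall>v\<in>set xs. u \<noteq> v \<longrightarrow> nbh G s u \<inter> nbh G s v = {}"
    using N xs(2) unfolding sep_def by blast
  ultimately show ?thesis using xs NM by blast
qed

end

context sampling
begin

definition shattered :: "nat \<Rightarrow> nat \<Rightarrow> (nat \<times> nat) set \<Rightarrow> bool" where
  "shattered z L B \<longleftrightarrow> (\<forall>C. conn G C \<longrightarrow> C \<subseteq> (\<Union>v\<in>marked B. nbh G z v) \<longrightarrow> card C \<le> L)"

text \<open>Union bound over the walks of \<open>separated_walk\<close>. A walk with
  \<open>m\<close> distinct nodes has \<open>2 * m - 1\<close> entries, so each distinct node pays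
  for two steps; hence the ball size enters \<open>ratio\<close> squared.\<close>

lemma prob_not_shattered:
  assumes m: "1 \<le> m" and ratio: "4 * ((\<Delta> + 2) ^ (2 * (2 * (z + 2 * s) + 1))) * (p / \<theta>) \<le> 1"
  shows "avg bits (\<lambda>B. of_bool (\<not> shattered z (m * (\<Delta> + 2) ^ (z + 2 * s)) B)) {} \<le> card (verts G) / 4 ^ m"
proof -
  define t where "t = 2 * (z + 2 * s) + 1"
  define W where "W = {xs \<in> walks G t (2 * m - 2). card (set xs) = m \<and>
    (\<forall>u\<in>set xs. \<forall>v\<in>set xs. u \<noteq> v \<longrightarrow> nbh G s u \<inter> nbh G s v = {})}"
  define a where "a = real ((\<Delta> + 2) ^ t)"
  have a1: "1 \<le> a" unfolding a_def by simp
  have finW: "finite W" using walks_bound by (simp add: W_def)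
  have "card W \<le> card (walks G t (2 * m - 2))" using walks_bound by (intro card_mono) (auto simp: W_def)
  also have "\<dots> \<le> card (verts G) * ((\<Delta> + 2) ^ t) ^ (2 * m - 2)" using walks_bound by blast
  finally have "real (card W) \<le> real (card (verts G) * ((\<Delta> + 2) ^ t) ^ (2 * m - 2))" by (rule of_nat_mono)
  also have "\<dots> = card (verts G) * a ^ (2 * m - 2)" by (simp add: a_def)
  also have "\<dots> \<le> card (verts G) * a ^ (2 * m)" using a1 by (intro mult_left_mono power_increasing) auto
  finally have cW: "real (card W) \<le> card (verts G) * a ^ (2 * m)" .
  have "avg bits (\<lambda>B. of_bool (\<not> shattered z (m * (\<Delta> + 2) ^ (z + 2 * s)) B)) {}
    \<le> avg bits (\<lambda>B. \<Sum>xs\<in>W. of_bool (set xs \<subseteq> marked B)) {}"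
  proof (rule avg_mono)
    fix B
    show "of_bool (\<not> shattered z (m * (\<Delta> + 2) ^ (z + 2 * s)) B) \<le> (\<Sum>xs\<in>W. of_bool (set xs \<subseteq> marked B) :: real)"
    proof (cases "shattered z (m * (\<Delta> + 2) ^ (z + 2 * s)) B")
      case True
      then show ?thesis by (simp add: sum_nonneg)
    next
      case False
      have MV: "marked B \<subseteq> verts G" by (auto simp: marked_def)
      obtain C where C: "conn G C" "C \<subseteq> (\<Union>v\<in>marked B. nbh G z v)" "card C > m * (\<Delta> + 2) ^ (z + 2 * s)"
        using False by (auto simp: shattered_def not_le)
      moreover have "C \<subseteq> verts G" using C(2) MV nbh_verts by blast
      ultimately obtain xs where "xs \<in> W" "set xs \<subseteq> marked B"
        using separated_walk[OF C(1) _ C(2) MV m C(3)] unfolding W_def t_def by blast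
      then show ?thesis
        using member_le_sum[of xs W "\<lambda>xs. of_bool (set xs \<subseteq> marked B) :: real"] finW False by simp
    qed
  qed
  also have "\<dots> = (\<Sum>xs\<in>W. avg bits (\<lambda>B. of_bool (set xs \<subseteq> marked B)) {})" by (rule avg_sum)
  also have "\<dots> \<le> (\<Sum>xs\<in>W. (p / \<theta>) ^ m)"
  proof (rule sum_mono)
    fix xs assume xs: "xs \<in> W"
    show "avg bits (\<lambda>B. of_bool (set xs \<subseteq> marked B)) {} \<le> (p / \<theta>) ^ m"
      using prob_all_marked[of "set xs"] xs by (auto simp: W_def walks_def)
  qed
  also have "\<dots> = card W * (p / \<theta>) ^ m" by simp
  also have "\<dots> \<le> card (verts G) * a ^ (2 * m) * (p / \<theta>) ^ m"
    using cW p_pos theta_pos by (intro mult_right_mono) auto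
  also have "\<dots> = card (verts G) * (a ^ 2 * (p / \<theta>)) ^ m"
    by (simp only: power_mult power_mult_distrib mult.assoc)
  also have "\<dots> \<le> card (verts G) * (1 / 4) ^ m"
  proof (intro mult_left_mono power_mono)
    have "a ^ 2 = real ((\<Delta> + 2) ^ (2 * t))" by (simp add: a_def power_mult[symmetric] mult.commute)
    then have "4 * a ^ 2 * (p / \<theta>) \<le> 1" using ratio unfolding t_def by simp
    then show "a ^ 2 * (p / \<theta>) \<le> 1 / 4" by linarith
  qed (use p_pos theta_pos in auto)
  finally show ?thesis by (simp add: power_divide)
qed

end

section \<open>Rake and compress\<close>

primrec aball :: "pgraph \<Rightarrow> nat set \<Rightarrow> nat \<Rightarrow> nat \<Rightarrow> nat set" where
  "aball G A 0 u = {u}"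
| "aball G A (Suc k) u = (\<Union>x\<in>aball G A k u. insert x (set (nbrs G x) \<inter> A))"

definition adeg :: "pgraph \<Rightarrow> nat set \<Rightarrow> nat \<Rightarrow> nat" where
  "adeg G A u = card (set (nbrs G u) \<inter> A)"

definition chain_mid :: "pgraph \<Rightarrow> nat \<Rightarrow> nat set \<Rightarrow> nat \<Rightarrow> bool" where
  "chain_mid G d A u \<longleftrightarrow> (\<forall>w\<in>aball G A d u. adeg G A w = 2)"

text \<open>Only nodes of colour \<open>i mod K\<close> act in iteration \<open>i\<close>, so nodes that are removed
simultaneously are far apart and no ties have to be broken.\<close>

definition removable where
  "removable G d K col A i = {u \<in> A. col u = i mod K \<and> (adeg G A u \<le> 1 \<or> chain_mid G d A u)}"

primrec alive where
  "alive G d K col Z 0 = Z"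
| "alive G d K col Z (Suc i) = alive G d K col Z i - removable G d K col (alive G d K col Z i) i"

text \<open>The iteration in which a node disappears; 0 is also the value of nodes that have not
  disappeared.\<close>

primrec layer where
  "layer G d K col Z 0 u = (0::nat)"
| "layer G d K col Z (Suc i) u =
     (if u \<in> removable G d K col (alive G d K col Z i) i then i else layer G d K col Z i u)"

text \<open>The nodes removed by compress steps. A chain middle has degree 2 itself, so no rake step
  is counted here.\<close>

primrec breaks where
  "breaks G d K col Z 0 = {}"
| "breaks G d K col Z (Suc i) = breaks G d K col Z i \<union>
     {u \<in> removable G d K col (alive G d K col Z i) i. chain_mid G d (alive G d K col Z i) u}"

lemma aball_refl [simp]: "u \<in> aball G A k u"
  by (induction k) auto

lemma aball_mono: "j \<le> k \<Longrightarrow> aball G A j u \<subseteq> aball G A k u"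
proof (induction k)
  case (Suc k)
  have "aball G A k u \<subseteq> aball G A (Suc k) u" by auto
  then show ?case using Suc by (cases "j = Suc k") auto
qed simp

lemma aball_nbh: "aball G A k u \<subseteq> nbh G k u"
proof (induction k)
  case (Suc k)
  then show ?case by (auto simp: nbh.simps(2))
qed simp

lemma path_aball:
  "(\<And>j. j < m \<Longrightarrow> g (Suc j) \<in> set (nbrs G (g j))) \<Longrightarrow> (\<And>j. j \<le> m \<Longrightarrow> g j \<in> A) \<Longrightarrow> g m \<in> aball G A m (g 0)"
proof (induction m)
  case (Suc m)
  have "g m \<in> aball G A m (g 0)" by (rule Suc.IH) (use Suc.prems in auto)
  moreover have "g (Suc m) \<in> set (nbrs G (g m)) \<inter> A" using Suc.prems by auto
  ultimately show ?case by auto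
qed simp

lemma path_nbh:
  "(\<And>j. j < m \<Longrightarrow> g (Suc j) \<in> set (nbrs G (g j))) \<Longrightarrow> g m \<in> nbh G m (g 0)"
  using path_aball[of m g G UNIV] aball_nbh by blast

lemma ex_mod_window: "c < K \<Longrightarrow> \<exists>t'. t \<le> t' \<and> t' < t + K \<and> t' mod K = (c::nat)"
proof -
  assume c: "c < K"
  show ?thesis
  proof (cases "t mod K \<le> c")
    case True
    have "(t + (c - t mod K)) mod K = (t mod K + (c - t mod K)) mod K" by (simp add: mod_add_left_eq)
    then show ?thesis using True c by (intro exI[of _ "t + (c - t mod K)"]) auto
  next
    case False
    have "(t + (K + c - t mod K)) mod K = (t mod K + (K + c - t mod K)) mod K" by (simp add: mod_add_left_eq)
    also have "t mod K + (K + c - t mod K) = K + c" using c by (simp add: less_imp_le trans_le_add1)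
    finally show ?thesis using False c by (intro exI[of _ "t + (K + c - t mod K)"]) auto
  qed
qed

locale raking = bgraph +
  fixes Z :: "nat set" and col :: "nat \<Rightarrow> nat" and K d :: nat
  assumes Z: "Z \<subseteq> verts G" and col_lt: "v \<in> verts G \<Longrightarrow> col v < K"
    and col_dist: "distinct_col G d col" and d1: "1 \<le> d"
begin

abbreviation alv where "alv \<equiv> alive G d K col Z"
abbreviation rm where "rm i \<equiv> removable G d K col (alv i) i"

lemma alive_antimono: "i \<le> j \<Longrightarrow> alv j \<subseteq> alv i"
proof (induction j)
  case (Suc j)
  have "alv (Suc j) \<subseteq> alv j" by auto
  then show ?case using Suc by (cases "i = Suc j") auto
qed simp

lemma alive_Z: "alv i \<subseteq> Z"
  using alive_antimono[of 0 i] by simp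

lemma rm_alive: "u \<in> rm i \<Longrightarrow> u \<in> alv j \<longleftrightarrow> j \<le> i"
proof -
  assume u: "u \<in> rm i"
  then have "u \<in> alv i" "u \<notin> alv (Suc i)" by (auto simp: removable_def)
  then show ?thesis using alive_antimono[of j i] alive_antimono[of "Suc i" j] by (cases "j \<le> i") (auto simp: not_le Suc_le_eq)
qed

lemma rm_Z: "u \<in> rm i \<Longrightarrow> u \<in> Z"
  using rm_alive[of u i i] alive_Z by blast

lemma rm_unique: "u \<in> rm i \<Longrightarrow> u \<in> rm j \<Longrightarrow> i = j"
  using rm_alive by (metis le_antisym order_refl)

lemma layer_rm: "u \<in> rm i \<Longrightarrow> i < I \<Longrightarrow> layer G d K col Z I u = i"
proof (induction I)
  case (Suc I)
  show ?case
  proof (cases "i = I")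
    case False
    then have "u \<notin> rm I" using rm_unique Suc.prems by blast
    then show ?thesis using Suc False by simp
  qed (use Suc.prems in simp)
qed simp

lemma removed_before: "u \<in> Z \<Longrightarrow> u \<notin> alv I \<Longrightarrow> \<exists>i<I. u \<in> rm i"
proof (induction I)
  case (Suc I)
  then show ?case by (cases "u \<in> alv I") (auto simp: less_Suc_eq)
qed simp

lemma breaks_iff: "b \<in> breaks G d K col Z I \<longleftrightarrow> (\<exists>i<I. b \<in> rm i \<and> chain_mid G d (alv i) b)"
  by (induction I) (auto simp: less_Suc_eq)

lemma chain_mid_adeg: "chain_mid G d A u \<Longrightarrow> w \<in> aball G A k u \<Longrightarrow> k \<le> d \<Longrightarrow> adeg G A w = 2"
  using aball_mono unfolding chain_mid_def by blast

lemma rm_close_eq: "u \<in> rm i \<Longrightarrow> w \<in> rm i \<Longrightarrow> w \<in> nbh G d u \<Longrightarrow> w = u"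
proof (rule ccontr)
  assume "u \<in> rm i" "w \<in> rm i" "w \<in> nbh G d u" "w \<noteq> u"
  moreover have "u \<in> verts G" using rm_Z[OF \<open>u \<in> rm i\<close>] Z by blast
  moreover have "col u = col w" using \<open>u \<in> rm i\<close> \<open>w \<in> rm i\<close> by (simp add: removable_def)
  ultimately show False using col_dist unfolding distinct_col_def by metis
qed

lemma rm_not_break:
  "u \<in> rm i \<Longrightarrow> i < I \<Longrightarrow> u \<notin> breaks G d K col Z I \<Longrightarrow> adeg G (alv i) u \<le> 1"
  unfolding breaks_iff by (auto simp: removable_def)

text \<open>All nodes of the path have degree 2 when its end \<open>g m\<close> disappears. If
  \<open>g 0\<close> is a chain middle later on, these degrees are still 2, so no neighbour along
  the path can have vanished, and \<open>g m\<close> would still be alive.\<close>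

lemma chain_end:
  assumes path: "\<And>j. j < m \<Longrightarrow> g (Suc j) \<in> set (nbrs G (g j))" and m: "0 < m" "m \<le> d"
    and two: "\<And>j. j \<le> m \<Longrightarrow> g j \<in> alv i0 \<and> adeg G (alv i0) (g j) = 2"
    and rm: "g m \<in> rm i0" "g 0 \<in> rm i" "chain_mid G d (alv i) (g 0)" and ne: "g 0 \<noteq> g m"
  shows False
proof -
  have "i0 \<le> i" using two[of 0] rm(2) rm_alive by blast
  moreover have "i \<noteq> i0"
  proof
    assume "i = i0"
    moreover have "g m \<in> nbh G d (g 0)" using path_nbh[of m g] path nbh_mono[OF m(2)] by blast
    ultimately show False using rm_close_eq[of "g 0" i0 "g m"] rm(1,2) ne by simp
  qed
  ultimately have lt: "i0 < i" by simp
  have "g j \<in> alv i \<and> g j \<in> aball G (alv i) j (g 0)" if "j \<le> m" for j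
    using that
  proof (induction j)
    case 0
    then show ?case using rm(2) rm_alive by simp
  next
    case (Suc j)
    then have IH: "g j \<in> alv i" "g j \<in> aball G (alv i) j (g 0)" by auto
    have "adeg G (alv i) (g j) = 2"
      using chain_mid_adeg[OF rm(3) IH(2)] Suc.prems m(2) by simp
    moreover have "adeg G (alv i0) (g j) = 2" using two Suc.prems by simp
    moreover have "alv i \<subseteq> alv i0" using alive_antimono lt by simp
    ultimately have "set (nbrs G (g j)) \<inter> alv i = set (nbrs G (g j)) \<inter> alv i0"
      unfolding adeg_def by (intro card_subset_eq) auto
    moreover have "g (Suc j) \<in> set (nbrs G (g j)) \<inter> alv i0" using path two Suc.prems by simp
    ultimately have "g (Suc j) \<in> set (nbrs G (g j)) \<inter> alv i" by simp
    then show ?case using IH by auto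
  qed
  then have "g m \<in> alv i" by simp
  then show False using rm_alive[OF rm(1)] lt by simp
qed

text \<open>On a shortest connection consider a node that disappears first. It has two surviving
  neighbours on the path or is a break itself, so it is a chain middle, and the whole path has
  degree 2 at that time. An end other than this node cannot be a chain middle at its own removal, by
  \<open>chain_end\<close>.\<close>

lemma breaks_separated:
  assumes b: "b \<in> breaks G d K col Z I" "b' \<in> breaks G d K col Z I"
    and path: "f 0 = b" "f k = b'" "\<And>j. j < k \<Longrightarrow> f (Suc j) \<in> set (nbrs G (f j))" "\<And>j. j \<le> k \<Longrightarrow> f j \<in> Z"
    and k: "k \<le> d"
  shows "b = b'"
proof (rule ccontr)
  assume ne: "b \<noteq> b'"
  define Q where "Q k f \<longleftrightarrow> f 0 = b \<and> f k = b' \<and> (\<forall>j<k. f (Suc j) \<in> set (nbrs G (f j))) \<and> (\<forall>j\<le>k. f j \<in> Z)" for k f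
  define k0 where "k0 = (LEAST k. \<exists>f. Q k f)"
  have Qk: "Q k f" using path unfolding Q_def by blast
  then have "\<exists>k f. Q k f" by blast
  then have "\<exists>f. Q k0 f" unfolding k0_def by (rule LeastI_ex)
  have min: "k0 \<le> k'" if "Q k' f'" for k' f' unfolding k0_def using that by (intro Least_le) blast
  have k0d: "k0 \<le> d" using min[OF Qk] k by simp
  obtain f where f: "Q k0 f" using \<open>\<exists>f. Q k0 f\<close> by blast
  have f0: "f 0 = b" "f k0 = b'" and fn: "\<And>j. j < k0 \<Longrightarrow> f (Suc j) \<in> set (nbrs G (f j))"
    and fZ: "\<And>j. j \<le> k0 \<Longrightarrow> f j \<in> Z" using f unfolding Q_def by auto
  have fV: "\<And>j. j \<le> k0 \<Longrightarrow> f j \<in> verts G" using fZ Z by blast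
  have fb: "f j \<in> set (nbrs G (f (Suc j)))" if "j < k0" for j
    using fn[OF that] fV[of j] that nbrs_sym by simp
  have nobt: "f j \<noteq> f (Suc (Suc j))" if "Suc (Suc j) \<le> k0" for j
  proof
    assume eq: "f j = f (Suc (Suc j))"
    \<comment> \<open>Cutting the back-and-forth step out of the path contradicts
      minimality.\<close>
    define f' where "f' i = (if i \<le> j then f i else f (i + 2))" for i
    have "Q (k0 - 2) f'" unfolding Q_def
    proof (intro conjI allI impI)
      show "f' 0 = b" using f0 by (simp add: f'_def)
      show "f' (k0 - 2) = b'"
      proof (cases "k0 - 2 \<le> j")
        case True
        then have "k0 = Suc (Suc j)" using that by simp
        then show ?thesis using f0 eq by (simp add: f'_def)
      next
        case False
        then have "k0 - 2 + 2 = k0" by simp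
        then show ?thesis using f0 False unfolding f'_def by metis
      qed
      fix i assume i: "i < k0 - 2"
      show "f' (Suc i) \<in> set (nbrs G (f' i))"
      proof (cases "i = j")
        case True
        then show ?thesis using fn[of "Suc (Suc j)"] i eq by (simp add: f'_def)
      next
        case False
        then show ?thesis using fn[of i] fn[of "i + 2"] i by (auto simp: f'_def)
      qed
    next
      fix i assume "i \<le> k0 - 2"
      then show "f' i \<in> Z" using fZ that by (auto simp: f'_def)
    qed
    then show False using min[of "k0 - 2" f'] that by simp
  qed
  obtain ib where ib: "b \<in> rm ib" "chain_mid G d (alv ib) b" using b(1) breaks_iff by blast
  obtain ib' where ib': "b' \<in> rm ib'" "chain_mid G d (alv ib') b'" using b(2) breaks_iff by blast
  \<comment> \<open>The first iteration that removes a node of the path.\<close>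
  define i0 where "i0 = (LEAST i. \<exists>j\<le>k0. f j \<in> rm i)"
  have "\<exists>i. \<exists>j\<le>k0. f j \<in> rm i" using ib(1) f0(1) by (metis le0)
  then have "\<exists>j\<le>k0. f j \<in> rm i0" unfolding i0_def by (rule LeastI_ex)
  then obtain j0 where j0: "j0 \<le> k0" "f j0 \<in> rm i0" by blast
  have al: "f j \<in> alv i0" if j: "j \<le> k0" for j
  proof (rule ccontr)
    assume "f j \<notin> alv i0"
    then obtain i where "i < i0" "f j \<in> rm i" using removed_before[OF fZ[OF j]] by blast
    then show False using not_less_Least[of i "\<lambda>i. \<exists>j\<le>k0. f j \<in> rm i"] j unfolding i0_def by blast
  qed
  have mid: "chain_mid G d (alv i0) (f j0)"
  proof (cases "j0 = 0 \<or> j0 = k0")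
    case True
    then show ?thesis using j0 f0 ib ib' rm_unique by metis
  next
    case False
    then obtain j where j: "j0 = Suc j" using not0_implies_Suc by blast
    have "{f j, f (Suc j0)} \<subseteq> set (nbrs G (f j0)) \<inter> alv i0"
      using fb[of j] fn[of j0] al[of j] al[of "Suc j0"] j0 False j by auto
    then have "card {f j, f (Suc j0)} \<le> adeg G (alv i0) (f j0)" unfolding adeg_def by (intro card_mono) auto
    then have "2 \<le> adeg G (alv i0) (f j0)" using nobt[of j] j j0 False by simp
    then show ?thesis using j0(2) by (auto simp: removable_def)
  qed
  have two: "adeg G (alv i0) (f j) = 2" if j: "j \<le> k0" for j
  proof (cases "j0 \<le> j")
    case True
    have "f (j0 + (j - j0)) \<in> aball G (alv i0) (j - j0) (f (j0 + 0))"
      by (rule path_aball[of _ "\<lambda>i. f (j0 + i)"]) (use True j fn al in auto)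
    then have "f j \<in> aball G (alv i0) (j - j0) (f j0)" using True by simp
    then show ?thesis by (rule chain_mid_adeg[OF mid]) (use j k0d in simp)
  next
    case False
    have "f (j0 - (j0 - j)) \<in> aball G (alv i0) (j0 - j) (f (j0 - 0))"
    proof (rule path_aball[of _ "\<lambda>i. f (j0 - i)"])
      fix i assume "i < j0 - j"
      then have "Suc (j0 - Suc i) = j0 - i" "j0 - Suc i < k0" using j0 by auto
      then show "f (j0 - Suc i) \<in> set (nbrs G (f (j0 - i)))" using fb[of "j0 - Suc i"] by simp
    qed (use al j0 in simp)
    then have "f j \<in> aball G (alv i0) (j0 - j) (f j0)" using False by simp
    then show ?thesis by (rule chain_mid_adeg[OF mid]) (use j0 k0d in simp)
  qed
  show False
  proof (cases "f 0 = f j0")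
    case False
    show False
      by (rule chain_end[of j0 f i0 ib]) (use False j0 k0d fn al two ib f0 in \<open>auto intro: gr0I\<close>)
  next
    case True
    \<comment> \<open>The path is read backwards, so that the other break becomes its start.\<close>
    define g where "g i = f (k0 - i)" for i
    have j0k: "j0 \<noteq> k0" using True f0 ne by auto
    show False
    proof (rule chain_end[of "k0 - j0" g i0 ib'])
      fix j assume "j < k0 - j0"
      then have "Suc (k0 - Suc j) = k0 - j" "k0 - Suc j < k0" by auto
      then show "g (Suc j) \<in> set (nbrs G (g j))" using fb[of "k0 - Suc j"] by (simp add: g_def)
    qed (use j0 j0k k0d al two ib' f0 True ne in \<open>auto simp: g_def\<close>)
  qed
qed

section \<open>Branches of a region and their exponential growth\<close>

definition step_avoid :: "nat \<Rightarrow> nat \<Rightarrow> nat \<Rightarrow> bool" where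
  "step_avoid x a b \<longleftrightarrow> b \<in> set (nbrs G a) \<and> b \<in> Z \<and> b \<noteq> x"

text \<open>What is left of the component of \<open>y\<close> when \<open>x\<close> is cut off. An
  \<open>x\<close> outside the graph cuts nothing, which gives the whole component.\<close>

definition branch :: "nat \<Rightarrow> nat \<Rightarrow> nat set" where
  "branch y x = {w. (step_avoid x)\<^sup>*\<^sup>* y w}"

lemma branch_Z: "y \<in> Z \<Longrightarrow> branch y x \<subseteq> Z"
proof
  fix w assume "y \<in> Z" "w \<in> branch y x"
  from this(2) have "(step_avoid x)\<^sup>*\<^sup>* y w" by (simp add: branch_def)
  then show "w \<in> Z" by (cases rule: rtranclp.cases) (use \<open>y \<in> Z\<close> in \<open>auto simp: step_avoid_def\<close>)
qed

lemma finite_branch: "y \<in> Z \<Longrightarrow> finite (branch y x)"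
  using branch_Z Z finite_verts finite_subset by metis

lemma conn_branch:
  assumes y: "y \<in> Z"
  shows "conn G (branch y x)"
  unfolding conn_def
proof (intro allI impI)
  fix A assume A: "A \<subseteq> branch y x" "A \<noteq> {}" "\<forall>w\<in>A. set (nbrs G w) \<inter> branch y x \<subseteq> A"
  have start: "(step_avoid x)\<^sup>*\<^sup>* y w \<Longrightarrow> w \<in> A \<Longrightarrow> y \<in> A" for w
  proof (induction rule: rtranclp_induct)
    case (step w w')
    have w: "w \<in> branch y x" using step by (simp add: branch_def)
    then have "w \<in> verts G" using branch_Z[OF y] Z by blast
    then have "w \<in> set (nbrs G w')" using step nbrs_sym by (simp add: step_avoid_def)
    then have "w \<in> A" using A(3) w step by blast
    then show ?case using step by blast
  qed simp
  have yA: "y \<in> A" using A(1,2) start by (auto simp: branch_def)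
  have "w \<in> A" if "(step_avoid x)\<^sup>*\<^sup>* y w" for w
    using that yA
  proof (induction rule: rtranclp_induct)
    case (step w w')
    then have "w' \<in> branch y x" "w' \<in> set (nbrs G w)"
      by (auto simp: branch_def step_avoid_def intro: rtranclp.rtrancl_into_rtrancl)
    then show ?case using A(3) step by blast
  qed
  then show "A = branch y x" using A(1) by (auto simp: branch_def)
qed

lemma step_avoid_reverse:
  assumes "(step_avoid x)\<^sup>*\<^sup>* q w" "q \<in> Z" "q \<noteq> x"
  shows "(step_avoid x)\<^sup>*\<^sup>* w q \<and> w \<in> Z \<and> w \<noteq> x"
  using assms(1)
proof (induction rule: rtranclp_induct)
  case (step w w')
  then have "step_avoid x w' w" using Z nbrs_sym[of w w'] unfolding step_avoid_def by blast
  then show ?case using step by (auto simp: step_avoid_def intro: converse_rtranclp_into_rtranclp)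
qed (use assms in auto)

end

text \<open>A repeated element would allow a shortcut.\<close>

lemma shortest_path_inj:
  fixes R :: "'a \<Rightarrow> 'a \<Rightarrow> bool"
  assumes "(R ^^ n) p q" "\<And>m. (R ^^ m) p q \<Longrightarrow> n \<le> m"
  shows "\<exists>f. f 0 = p \<and> f n = q \<and> (\<forall>i<n. R (f i) (f (Suc i))) \<and> inj_on f {..n}"
proof -
  obtain f where f: "f 0 = p" "f n = q" "\<forall>i<n. R (f i) (f (Suc i))"
    using assms(1) by (auto simp: relpowp_fun_conv)
  have "f i \<noteq> f j" if ij: "i < j" "j \<le> n" for i j
  proof
    assume eq: "f i = f j"
    have "(R ^^ i) p (f i)" unfolding relpowp_fun_conv using f ij by (intro exI[of _ f]) auto
    moreover have "(R ^^ (n - j)) (f j) q" unfolding relpowp_fun_conv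
      using f ij by (intro exI[of _ "\<lambda>k. f (j + k)"]) auto
    ultimately have "(R ^^ (i + (n - j))) p q" unfolding relpowp_add eq by blast
    then show False using assms(2) ij by fastforce
  qed
  then have "inj_on f {..n}" unfolding inj_on_def by (metis atMost_iff linorder_neqE_nat)
  then show ?thesis using f by blast
qed

locale tree_raking = raking +
  assumes acyclic: "\<not> (\<exists>cs. is_cycle G cs)"
begin

text \<open>A shortest path from \<open>p\<close> to \<open>q\<close> that avoids \<open>y\<close>
  would close up through \<open>y\<close> to a cycle.\<close>

lemma no_detour:
  assumes y: "y \<in> verts G" and pq: "p \<in> set (nbrs G y)" "q \<in> set (nbrs G y)" "p \<noteq> q"
  shows "\<not> (step_avoid y)\<^sup>*\<^sup>* p q"
proof
  assume "(step_avoid y)\<^sup>*\<^sup>* p q"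
  then have ex: "\<exists>n. (step_avoid y ^^ n) p q" by (rule rtranclp_imp_relpowp)
  define n where "n = (LEAST n. (step_avoid y ^^ n) p q)"
  have "(step_avoid y ^^ n) p q" unfolding n_def by (rule LeastI_ex[OF ex])
  moreover have "n \<le> m" if "(step_avoid y ^^ m) p q" for m unfolding n_def using that by (rule Least_le)
  ultimately obtain f where f: "f 0 = p" "f n = q" "\<forall>i<n. step_avoid y (f i) (f (Suc i))" "inj_on f {..n}"
    using shortest_path_inj[where R = "step_avoid y" and n = n and p = p and q = q] by blast
  have n: "n \<noteq> 0"
  proof
    assume "n = 0"
    then show False using f(1,2) pq(3) by simp
  qed
  define cs where "cs = y # map f [0..<Suc n]"
  have V: "f i \<in> verts G \<and> f i \<noteq> y" if "i \<le> n" for i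
  proof (cases i)
    case 0
    then show ?thesis using f(1) pq(1) y nbrs_verts nbrs_irrefl by metis
  next
    case (Suc j)
    then show ?thesis using f(3) that Z by (auto simp: step_avoid_def)
  qed
  have "is_cycle G cs"
    unfolding is_cycle_def
  proof (intro conjI allI impI)
    show "3 \<le> length cs" using n by (simp add: cs_def)
    have "inj_on f {0..<Suc n}" using f(4) by (rule inj_on_subset) auto
    then have "distinct (map f [0..<Suc n])" unfolding distinct_map by (simp del: upt_Suc)
    moreover have "y \<notin> set (map f [0..<Suc n])" 
    proof
      assume "y \<in> set (map f [0..<Suc n])"
      then obtain i where "i < Suc n" "y = f i" by (auto simp del: upt_Suc)
      then show False using V[of i] by simp
    qed
    ultimately show "distinct cs" unfolding cs_def by simp
    show "set cs \<subseteq> verts G" using V y by (auto simp: cs_def)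
    fix i assume i: "i < length cs"
    then have i': "i \<le> Suc n" by (simp add: cs_def)
    have nth: "cs ! Suc j = f j" if "j \<le> n" for j
      using that unfolding cs_def nth_Cons_Suc by (subst nth_map) (auto simp del: upt_Suc)
    consider "i = 0" | j where "i = Suc j" "j < n" | "i = Suc n" using i' by (cases i) (auto simp: le_less)
    then show "adj G (cs ! i) (cs ! ((i + 1) mod length cs))"
    proof cases
      case 1
      then have "(i + 1) mod length cs = Suc 0" by (simp add: cs_def)
      then show ?thesis using nth[of 0] 1 f(1) pq(1) y by (simp add: adj_def cs_def)
    next
      case 2
      then have "(i + 1) mod length cs = Suc (Suc j)" by (simp add: cs_def)
      moreover have "cs ! i = f j" "cs ! Suc (Suc j) = f (Suc j)" using nth[of j] nth[of "Suc j"] 2 by auto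
      ultimately show ?thesis using f(3) 2 V[of j] by (simp add: adj_def step_avoid_def)
    next
      case 3
      then have "(i + 1) mod length cs = 0" by (simp add: cs_def)
      moreover have "cs ! i = q" using nth[of n] 3 f(2) by auto
      moreover have "cs ! 0 = y" by (simp add: cs_def)
      moreover have "q \<in> verts G" using V[of n] f(2) by auto
      ultimately show ?thesis using nbrs_sym[OF y pq(2)] by (simp add: adj_def)
    qed
  qed
  then show False using acyclic by blast
qed

text \<open>A walk that leaves \<open>v\<close> through \<open>p\<close> and reaches
  \<open>u\<close> without returning to \<open>v\<close> would be a detour between two neighbours of
  \<open>v\<close>.\<close>

lemma branch_sub:
  assumes v: "v \<in> Z" and p: "p \<in> set (nbrs G v)" "p \<in> Z" "p \<noteq> u" and u: "u \<in> set (nbrs G v) \<or> u \<notin> verts G"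
  shows "branch p v \<subseteq> branch v u"
proof
  fix w assume "w \<in> branch p v"
  then have "(step_avoid v)\<^sup>*\<^sup>* p w" by (simp add: branch_def)
  then have "(step_avoid u)\<^sup>*\<^sup>* v w"
  proof (induction rule: rtranclp_induct)
    case base
    then show ?case using p by (auto simp: step_avoid_def)
  next
    case (step w w')
    have "w' \<noteq> u"
    proof
      assume "w' = u"
      then have "(step_avoid v)\<^sup>*\<^sup>* p u" using step by auto
      moreover have "u \<in> Z" using step \<open>w' = u\<close> by (simp add: step_avoid_def)
      ultimately show False using no_detour[of v p u] u p v Z by blast
    qed
    then show ?case using step by (auto simp: step_avoid_def intro: rtranclp.rtrancl_into_rtrancl)
  qed
  then show "w \<in> branch v u" by (simp add: branch_def)
qed

lemma branch_disjoint:
  assumes v: "v \<in> Z" and p: "p \<in> set (nbrs G v)" and q: "q \<in> set (nbrs G v)" "q \<in> Z" and "p \<noteq> q"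
  shows "branch p v \<inter> branch q v = {}"
proof (rule equals0I)
  fix w assume w: "w \<in> branch p v \<inter> branch q v"
  have vV: "v \<in> verts G" using v Z by blast
  have "q \<noteq> v" using nbrs_irrefl[OF vV] q by metis
  then have "(step_avoid v)\<^sup>*\<^sup>* w q" using step_avoid_reverse[of v q w] w q by (simp add: branch_def)
  moreover have "(step_avoid v)\<^sup>*\<^sup>* p w" using w by (simp add: branch_def)
  ultimately have "(step_avoid v)\<^sup>*\<^sup>* p q" by (rule rtranclp_trans[rotated])
  then show False using no_detour[OF vV p q(1) \<open>p \<noteq> q\<close>] by blast
qed

text \<open>Within \<open>K\<close> iterations the colour of \<open>w\<close> has its turn, and a
  degree of at most 1 never grows in the meantime.\<close>

lemma dead_after:
  assumes "w \<in> verts G" "adeg G (alv t) w \<le> 1"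
  shows "w \<notin> alv (t + K)"
proof
  assume w: "w \<in> alv (t + K)"
  obtain t' where t': "t \<le> t'" "t' < t + K" "t' mod K = col w"
    using ex_mod_window[OF col_lt[OF assms(1)]] by blast
  have "alv t' \<subseteq> alv t" using alive_antimono t' by blast
  then have "adeg G (alv t') w \<le> adeg G (alv t) w" unfolding adeg_def by (intro card_mono) auto
  moreover have "w \<in> alv t'" using w alive_antimono[of t' "t + K"] t' by auto
  ultimately have "w \<in> rm t'" using assms t' by (simp add: removable_def)
  then show False using rm_alive[of w t' "t + K"] w t' by simp
qed

text \<open>Unless two surviving branches meet within distance \<open>2 * d\<close> of \<open>y\<close>, the node \<open>y\<close> hangs on a chain,
which is broken and then raked away within \<open>(2 * d + 3) * K\<close> iterations.\<close>

lemma branch_growth: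
  "y \<in> alv (i * ((2 * d + 3) * K)) \<Longrightarrow> u \<in> set (nbrs G y) \<or> u \<notin> verts G \<Longrightarrow> 2 ^ i \<le> card (branch y u)"
proof (induction i arbitrary: y u)
  case 0
  then have "y \<in> Z" by simp
  moreover have "y \<in> branch y u" by (simp add: branch_def)
  ultimately have "card (branch y u) \<noteq> 0" using finite_branch by (metis card_eq_0_iff empty_iff)
  then show ?case by simp
next
  case (Suc i)
  define c where "c = (2 * d + 3) * K"
  define t where "t = i * c"
  have yT: "y \<in> alv (t + c)" using Suc.prems(1) by (simp add: t_def c_def add.commute)
  show ?case
  proof (rule ccontr)
    assume small: "\<not> 2 ^ Suc i \<le> card (branch y u)"
    \<comment> \<open>Walk away from \<open>u\<close>: \<open>F\<close> keeps the previous and the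
      current node and moves on to some surviving neighbour other than the previous one.\<close>
    define nx where "nx x v = (SOME p. p \<in> set (nbrs G v) \<inter> alv t \<and> p \<noteq> x)" for x v
    define F where "F = rec_nat (u, y) (\<lambda>_ xv. (snd xv, nx (fst xv) (snd xv)))"
    define x where "x j = fst (F j)" for j
    define v where "v j = snd (F j)" for j
    have F0: "x 0 = u" "v 0 = y" and FS: "\<And>j. x (Suc j) = v j" "\<And>j. v (Suc j) = nx (x j) (v j)"
      by (simp_all add: x_def v_def F_def)
    define stop where "stop j \<longleftrightarrow> set (nbrs G (v j)) \<inter> alv t \<subseteq> {x j}" for j
    have y: "y \<in> alv t" using yT alive_antimono[of t "t + c"] by auto
    \<comment> \<open>By induction, two surviving forward neighbours would each carry
      \<open>2 ^ i\<close> nodes, in disjoint parts of a branch that is assumed too small for both.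
      So the walk never has a choice.\<close>
    have unique: "p = q" if V: "w \<in> alv t" "branch w z \<subseteq> branch y u" "z \<in> set (nbrs G w) \<or> z \<notin> verts G"
      and p: "p \<in> set (nbrs G w) \<inter> alv t" "p \<noteq> z" and q: "q \<in> set (nbrs G w) \<inter> alv t" "q \<noteq> z" for w z p q
    proof (rule ccontr)
      assume ne: "p \<noteq> q"
      have wZ: "w \<in> Z" and pZ: "p \<in> Z" "q \<in> Z" and wV: "w \<in> verts G" using V p q alive_Z Z by blast+
      have IH: "2 ^ i \<le> card (branch p w)" "2 ^ i \<le> card (branch q w)"
        using Suc.IH[of p w] Suc.IH[of q w] p q nbrs_sym[OF wV] by (auto simp: t_def c_def)
      have "card (branch p w) + card (branch q w) = card (branch p w \<union> branch q w)"
        using branch_disjoint[of w p q] finite_branch pZ wZ p q ne by (intro card_Un_disjoint[symmetric]) auto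
      also have "\<dots> \<le> card (branch y u)"
        using branch_sub[of w p z] branch_sub[of w q z] wZ pZ p q V finite_branch[of y u] y alive_Z
        by (intro card_mono) blast+
      finally show False using IH small by simp
    qed
    have inv: "v j \<in> alv t \<and> branch (v j) (x j) \<subseteq> branch y u \<and> (x j \<in> set (nbrs G (v j)) \<or> x j \<notin> verts G)"
      if "\<And>i. i < j \<Longrightarrow> \<not> stop i" for j
      using that
    proof (induction j)
      case 0
      then show ?case using F0 y Suc.prems by simp
    next
      case (Suc j)
      then have IH: "v j \<in> alv t" "branch (v j) (x j) \<subseteq> branch y u" "x j \<in> set (nbrs G (v j)) \<or> x j \<notin> verts G"
        by auto
      have "\<exists>p. p \<in> set (nbrs G (v j)) \<inter> alv t \<and> p \<noteq> x j" using Suc.prems[of j] by (auto simp: stop_def)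
      then have nx: "v (Suc j) \<in> set (nbrs G (v j)) \<inter> alv t" "v (Suc j) \<noteq> x j"
        unfolding FS nx_def using someI_ex[of "\<lambda>p. p \<in> set (nbrs G (v j)) \<inter> alv t \<and> p \<noteq> x j"] by blast+
      have vZ: "v j \<in> Z" "v (Suc j) \<in> Z" "v j \<in> verts G" using IH nx alive_Z Z by blast+
      have "branch (v (Suc j)) (v j) \<subseteq> branch (v j) (x j)"
        using branch_sub[of "v j" "v (Suc j)" "x j"] vZ nx IH by blast
      then show ?case using nx IH nbrs_sym[OF vZ(3)] unfolding FS(1) by blast
    qed
    have two: "set (nbrs G (v j)) \<inter> alv t \<subseteq> {x j, v (Suc j)}" if ns: "\<And>i. i < j \<Longrightarrow> \<not> stop i" for j
    proof
      fix p assume p: "p \<in> set (nbrs G (v j)) \<inter> alv t"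
      show "p \<in> {x j, v (Suc j)}"
      proof (cases "p = x j")
        case False
        then have "v (Suc j) \<in> set (nbrs G (v j)) \<inter> alv t \<and> v (Suc j) \<noteq> x j"
          unfolding FS nx_def using someI[of "\<lambda>p. p \<in> set (nbrs G (v j)) \<inter> alv t \<and> p \<noteq> x j" p] p by blast
        then have "p = v (Suc j)" using unique[of "v j" "x j" p "v (Suc j)"] inv[OF ns] p False by blast
        then show ?thesis by simp
      qed simp
    qed
    have vV: "v j \<in> verts G" if "\<And>i. i < j \<Longrightarrow> \<not> stop i" for j using inv[OF that] alive_Z Z by blast
    \<comment> \<open>Raking travels back: once the chain is interrupted at position
      \<open>j\<close>, one node after the other becomes a leaf, at \<open>K\<close> iterations
      each, until \<open>y\<close> is reached.\<close>
    have dies: "y \<notin> alv (t' + (j + 1) * K)"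
      if "\<And>i. i < j \<Longrightarrow> \<not> stop i" "t \<le> t'" "v j \<notin> alv t' \<or> adeg G (alv t') (v j) \<le> 1" for j t'
      using that
    proof (induction j arbitrary: t')
      case 0
      have "y \<notin> alv (t' + K)"
      proof (cases "y \<in> alv t'")
        case True
        then show ?thesis using dead_after[of y t'] 0 F0 alive_Z Z by auto
      qed (use alive_antimono[of t' "t' + K"] in auto)
      then show ?case by simp
    next
      case (Suc j)
      have "v (Suc j) \<notin> alv (t' + K)"
      proof (cases "v (Suc j) \<in> alv t'")
        case True
        then have "v (Suc j) \<in> verts G" using alive_Z Z by blast
        then show ?thesis using dead_after[of "v (Suc j)" t'] Suc.prems True by blast
      qed (use alive_antimono[of t' "t' + K"] in auto)
      moreover have "alv (t' + K) \<subseteq> alv t" using alive_antimono Suc.prems by simp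
      ultimately have "set (nbrs G (v j)) \<inter> alv (t' + K) \<subseteq> {x j}"
        using two[of j] Suc.prems(1) by fastforce
      then have "adeg G (alv (t' + K)) (v j) \<le> card {x j}" unfolding adeg_def by (intro card_mono) auto
      then have "y \<notin> alv (t' + K + (j + 1) * K)" using Suc.IH[of "t' + K"] Suc.prems by simp
      then show ?case by (simp add: algebra_simps)
    qed
    \<comment> \<open>Waiting for a colour takes at most \<open>K\<close> iterations and raking back
      at most \<open>(2 * d + 1) * K\<close>, which fits into one phase \<open>c\<close>.\<close>
    have dead: False if "y \<notin> alv t'" "t' \<le> t + (2 * d + 2) * K" for t'
    proof -
      have "t' \<le> t + c" using that(2) by (simp add: c_def algebra_simps)
      then show False using yT that(1) alive_antimono by blast
    qed
    show False
    proof (cases "\<exists>e\<le>2 * d. stop e")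
      case True
      define e where "e = (LEAST e. stop e)"
      have e: "stop e" "e \<le> 2 * d" "\<And>i. i < e \<Longrightarrow> \<not> stop i"
        unfolding e_def using True by (auto intro: LeastI Least_le order_trans dest: not_less_Least)
      have "adeg G (alv t) (v e) \<le> card {x e}"
        using e(1) unfolding adeg_def stop_def by (intro card_mono) auto
      then have "y \<notin> alv (t + (e + 1) * K)" using dies[of e t] e by simp
      moreover have "(e + 1) * K \<le> (2 * d + 2) * K" using e(2) by (intro mult_right_mono) auto
      ultimately show False using dead[of "t + (e + 1) * K"] by simp
    next
      case False
      then have ns: "\<not> stop j" if "j \<le> 2 * d" for j using that by blast
      \<comment> \<open>The node \<open>v d\<close> gets its turn within \<open>K\<close>
        iterations. If the chain is still intact then, there are \<open>d\<close> chain nodes of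
        degree 2 on either side of \<open>v d\<close>, and it is compressed.\<close>
      obtain t' where t': "t \<le> t'" "t' < t + K" "t' mod K = col (v d)"
        using ex_mod_window[OF col_lt[OF vV[of d]]] ns by (metis le_add2 less_imp_le_nat mult_2 le_trans)
      let ?A = "alv t'"
      have At: "?A \<subseteq> alv t" using alive_antimono t' by blast
      show False
      proof (cases "\<exists>j\<le>2 * d. v j \<notin> ?A \<or> adeg G ?A (v j) \<le> 1")
        case True
        then obtain j where j: "j \<le> 2 * d" "v j \<notin> ?A \<or> adeg G ?A (v j) \<le> 1" by blast
        then have "y \<notin> alv (t' + (j + 1) * K)" using dies[of j t'] ns t' by simp
        moreover have "(j + 1) * K \<le> (2 * d + 1) * K" using j by (intro mult_right_mono) auto
        moreover have "(2 * d + 2) * K = K + (2 * d + 1) * K" by (simp add: algebra_simps)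
        ultimately show False using dead[of "t' + (j + 1) * K"] t'(2) by linarith
      next
        case al: False
        have adeg2: "adeg G ?A (v j) = 2" if "j \<le> 2 * d" for j
        proof -
          have "set (nbrs G (v j)) \<inter> ?A \<subseteq> {x j, v (Suc j)}" using two[of j] ns that At by fastforce
          then have "adeg G ?A (v j) \<le> card {x j, v (Suc j)}" unfolding adeg_def by (intro card_mono) auto
          also have "\<dots> \<le> 2" by (simp add: card_insert_if)
          finally show ?thesis using al that by force
        qed
        have "aball G ?A k (v d) \<subseteq> v ` {d - k..d + k}" if "k \<le> d" for k
          using that
        proof (induction k)
          case (Suc k)
          show ?case
          proof
            fix w assume "w \<in> aball G ?A (Suc k) (v d)"
            then obtain w' where w': "w' \<in> aball G ?A k (v d)" "w = w' \<or> w \<in> set (nbrs G w') \<inter> ?A" by auto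
            then obtain j where j: "w' = v j" "d - k \<le> j" "j \<le> d + k" using Suc by auto
            then obtain j' where j': "j = Suc j'" using Suc.prems by (cases j) auto
            have "w \<in> {v j, v j', v (Suc j)}"
              using w' j two[of j] ns At j' Suc.prems FS(1)[of j'] by fastforce
            then show "w \<in> v ` {d - Suc k..d + Suc k}" using j j' by auto
          qed
        qed simp
        from this[of d] have "aball G ?A d (v d) \<subseteq> v ` {0..2 * d}" by (simp add: mult_2)
        then have "chain_mid G d ?A (v d)" using adeg2 unfolding chain_mid_def by auto
        moreover have "v d \<in> ?A" using al by simp
        ultimately have "v d \<in> rm t'" using t'(3) by (simp add: removable_def)
        then have "v d \<notin> alv (t + K)" using rm_alive[of "v d" t' "t + K"] t' by simp
        then have "y \<notin> alv (t + K + (d + 1) * K)" using dies[of d "t + K"] ns by simp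
        then show False by (rule dead) (simp add: algebra_simps)
      qed
    qed
  qed
qed

lemma all_removed:
  assumes "\<And>C. conn G C \<Longrightarrow> C \<subseteq> Z \<Longrightarrow> card C \<le> L" "L < 2 ^ i"
  shows "alv (i * ((2 * d + 3) * K)) = {}"
proof (rule equals0I)
  fix y assume y: "y \<in> alv (i * ((2 * d + 3) * K))"
  \<comment> \<open>With a node outside the graph as \<open>u\<close>, the branch of
    \<open>y\<close> is its whole component in \<open>Z\<close>.\<close>
  obtain u where "u \<notin> verts G" using ex_new_if_finite[OF infinite_UNIV_nat finite_verts] by blast
  then have "2 ^ i \<le> card (branch y u)" using branch_growth[OF y] by blast
  moreover have "y \<in> Z" using y alive_Z by blast
  then have "card (branch y u) \<le> L" using assms(1)[OF conn_branch branch_Z] by blast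
  ultimately show False using assms(2) by simp
qed

end

section \<open>Completing the frozen part\<close>

definition zone :: "pgraph \<Rightarrow> nat \<Rightarrow> nat \<Rightarrow> (nat \<times> nat) set \<Rightarrow> nat \<Rightarrow> (nat \<times> nat) set" where
  "zone G w h S b = nbh G w b \<times> {..<h} - S"

text \<open>The method of conditional expectations: the sum controls all affected risks at once.
  Being a \<open>SOME\<close> over data near \<open>b\<close>, the choice is the same for all nodes
  that see this neighbourhood.\<close>

definition zone_choice where
  "zone_choice G s h E w S B b = (SOME W. W \<subseteq> zone G w h S b \<and>
     (\<Sum>v\<in>nbh G (w + s) b. risk G s h E (S \<union> zone G w h S b) ((B - zone G w h S b) \<union> W) v)
       \<le> (\<Sum>v\<in>nbh G (w + s) b. risk G s h E S B v))"

definition zone_set where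
  "zone_set G w h Br S = S \<union> (\<Union>b\<in>Br. zone G w h S b)"

text \<open>Intersecting with the zone keeps the effect of \<open>zone_choice\<close> local even
  where nothing is known about the chosen set.\<close>

definition zone_bits where
  "zone_bits G s h E w Br S B =
     (B - (\<Union>b\<in>Br. zone G w h S b)) \<union> (\<Union>b\<in>Br. zone_choice G s h E w S B b \<inter> zone G w h S b)"

text \<open>With \<open>T\<close> the running time, these bits decide the output at
  \<open>x\<close>, which can then no longer change.\<close>

definition fixed_at :: "pgraph \<Rightarrow> nat \<Rightarrow> nat \<Rightarrow> (nat \<times> nat) set \<Rightarrow> nat \<Rightarrow> bool" where
  "fixed_at G T h S x \<longleftrightarrow> nbh G T x \<times> {..<h} \<subseteq> S"

text \<open>A state of a node is a guess of the output lists in its radius-\<open>r\<close> ball.\<close>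

definition states ::
  "pgraph \<Rightarrow> nat \<Rightarrow> nat \<Rightarrow> nat \<Rightarrow> (nat \<Rightarrow> (nat \<times> nat) set \<Rightarrow> 'o list) \<Rightarrow> (nat \<Rightarrow> (nat \<Rightarrow> 'o list) \<Rightarrow> bool) \<Rightarrow>
    (nat \<times> nat) set \<Rightarrow> (nat \<times> nat) set \<Rightarrow> nat \<Rightarrow> (nat \<Rightarrow> 'o list) set" where
  "states G r T h ol good S B x =
     {q \<in> PiE (nbh G r x) (\<lambda>y. {os. length os = length (nbrs G y)}).
        (\<forall>y\<in>nbh G r x. fixed_at G T h S y \<longrightarrow> q y = ol y B) \<and> good x q}"

definition agreeing :: "pgraph \<Rightarrow> nat \<Rightarrow> nat \<Rightarrow> nat \<Rightarrow> (nat \<Rightarrow> 'o list) \<Rightarrow> (nat \<Rightarrow> 'o list) \<Rightarrow> bool" where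
  "agreeing G r u w q q' \<longleftrightarrow> (\<forall>x\<in>nbh G r u \<inter> nbh G r w. q x = q' x)"

definition children :: "pgraph \<Rightarrow> nat set \<Rightarrow> nat set \<Rightarrow> (nat \<Rightarrow> nat) \<Rightarrow> nat \<Rightarrow> nat set" where
  "children G Z Br lay u = {w \<in> set (nbrs G u). w \<in> Z \<and> w \<notin> Br \<and> lay w < lay u}"

text \<open>Edges lead from a raked node to the neighbour that outlives it. A break has no parent
  and so becomes a root, which cuts the region at the breaks.\<close>

definition parents :: "pgraph \<Rightarrow> nat set \<Rightarrow> nat set \<Rightarrow> (nat \<Rightarrow> nat) \<Rightarrow> nat \<Rightarrow> nat set" where
  "parents G Z Br lay u = (if u \<in> Br then {} else {p \<in> set (nbrs G u). p \<in> Z \<and> lay u < lay p})"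

text \<open>Bottom-up pass with one layer per iteration, because the iterations are later executed
  one by one in the network.\<close>

primrec feas ::
  "pgraph \<Rightarrow> nat \<Rightarrow> nat set \<Rightarrow> nat set \<Rightarrow> (nat \<Rightarrow> nat) \<Rightarrow> (nat \<Rightarrow> (nat \<Rightarrow> 'o list) set) \<Rightarrow> nat \<Rightarrow> nat \<Rightarrow> (nat \<Rightarrow> 'o list) set"
  where
  "feas G r Z Br lay st 0 u = {}"
| "feas G r Z Br lay st (Suc i) u =
     (if u \<in> Z \<and> lay u = i
      then {q \<in> st u. \<forall>w\<in>children G Z Br lay u. \<exists>q'\<in>feas G r Z Br lay st i w. agreeing G r u w q q'}
      else feas G r Z Br lay st i u)"

text \<open>The default is the extensional function with empty domain, which keeps the value inside
  the finite set of labels also when \<open>A\<close> is empty.\<close>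

definition pick_from :: "(nat \<Rightarrow> 'o list) set \<Rightarrow> nat \<Rightarrow> 'o list" where
  "pick_from A = (if A = {} then \<lambda>_. undefined else SOME q. q \<in> A)"

text \<open>Top-down pass: layers are visited in decreasing order, so the choice of a parent has
  already been made.\<close>

primrec pick ::
  "pgraph \<Rightarrow> nat \<Rightarrow> nat set \<Rightarrow> nat set \<Rightarrow> (nat \<Rightarrow> nat) \<Rightarrow> (nat \<Rightarrow> (nat \<Rightarrow> 'o list) set) \<Rightarrow> nat \<Rightarrow> nat \<Rightarrow> nat \<Rightarrow> nat \<Rightarrow> 'o list"
  where
  "pick G r Z Br lay F I 0 u = (\<lambda>_. undefined)"
| "pick G r Z Br lay F I (Suc j) u =
     (if u \<in> Z \<and> lay u = I - Suc j
      then pick_from {q \<in> F u. \<forall>p\<in>parents G Z Br lay u. agreeing G r p u (pick G r Z Br lay F I j p) q}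
      else pick G r Z Br lay F I j u)"

definition final_output where
  "final_output Z ol B pk x = (if x \<in> Z then pk x x else ol x B)"

lemma pick_from_in: "A \<noteq> {} \<Longrightarrow> pick_from A \<in> A"
  unfolding pick_from_def by (simp add: some_in_eq)

lemma nbh_path: "w \<in> nbh G k v \<Longrightarrow> \<exists>j\<le>k. \<exists>f. f 0 = v \<and> f j = w \<and> (\<forall>i<j. f (Suc i) \<in> set (nbrs G (f i)))"
proof (induction k arbitrary: w)
  case 0
  then show ?case by (intro exI[of _ 0]) auto
next
  case (Suc k)
  then obtain u where u: "u \<in> nbh G k v" "w = u \<or> w \<in> set (nbrs G u)" by (auto simp: nbh.simps(2))
  then obtain j f where f: "j \<le> k" "f 0 = v" "f j = u" "\<forall>i<j. f (Suc i) \<in> set (nbrs G (f i))"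
    using Suc.IH by blast
  show ?case
  proof (cases "w = u")
    case True
    then show ?thesis using f by (intro exI[of _ j]) auto
  next
    case False
    then show ?thesis using u f
      by (intro exI[of _ "Suc j"] conjI exI[of _ "f(Suc j := w)"]) (auto simp: less_Suc_eq)
  qed
qed

text \<open>A zone has radius \<open>r + s\<close>, so it influences risks within
  \<open>r + s + s\<close>. Two breaks that influence the same risk are within \<open>d\<close> of
  each other, and \<open>z\<close> leaves room for a path of length \<open>d\<close> that starts
  within \<open>r + s + s\<close> of a marked node. The premise \<open>lll\<close> is the local
  lemma condition for risks bounded by a sum of values \<open>2 * \<theta>\<close> over a ball of
  radius \<open>r + s + s\<close>. The number \<open>I\<close> allows for \<open>J\<close> doublings
  of the branch size.\<close>

locale solver = sampling +
  fixes ol :: "nat \<Rightarrow> (nat \<times> nat) set \<Rightarrow> 'o list" and good :: "nat \<Rightarrow> (nat \<Rightarrow> 'o list) \<Rightarrow> bool"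
    and r T z I L J :: nat
  assumes E_eq: "v \<in> verts G \<Longrightarrow> E v B \<longleftrightarrow> \<not> good v (\<lambda>x. ol x B)"
    and good_cong: "v \<in> verts G \<Longrightarrow> (\<And>x. x \<in> nbh G r v \<Longrightarrow> f x = g x) \<Longrightarrow> good v f \<longleftrightarrow> good v g"
    and ol_dep: "x \<in> verts G \<Longrightarrow> depends (nbh G T x \<times> {..<h}) (ol x)"
    and ol_length: "x \<in> verts G \<Longrightarrow> length (ol x B) = length (nbrs G x)"
    and acyclic: "\<not> (\<exists>cs. is_cycle G cs)"
    and rT: "r + T \<le> s" and s1: "1 \<le> s" and d_def: "d = 2 * (r + s + s)" and z_def: "z = 3 * (r + s + s)"
    and lll: "4 * (2 * \<theta> * (\<Delta> + 2) ^ (r + s + s)) * (\<Delta> + 2) ^ (2 * s) \<le> 1"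
    and I_def: "I = J * ((2 * d + 3) * K)" and L_J: "L < 2 ^ J"
begin

context
  fixes B0 :: "(nat \<times> nat) set"
  assumes sh: "shattered z L B0"
begin

definition S0 where "S0 = pre B0 (K * h)"
definition Zs where "Zs = (\<Union>v\<in>marked B0. nbh G z v)"
definition Br where "Br = breaks G d K col Zs I"
definition lay where "lay = layer G d K col Zs I"
definition S1 where "S1 = zone_set G (r + s) h Br S0"
definition B1 where "B1 = zone_bits G s h E (r + s) Br S0 B0"
definition st where "st = states G r T h ol good S1 B1"
definition F where "F = feas G r Zs Br lay st I"
definition pk where "pk = pick G r Zs Br lay F I I"

lemma marked_verts: "marked B0 \<subseteq> verts G"
  by (auto simp: marked_def)

lemma Zs_verts: "Zs \<subseteq> verts G"
  using marked_verts nbh_verts by (auto simp: Zs_def)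

lemma tree_raking: "tree_raking G \<Delta> Zs col K d"
  using Zs_verts col_bound col_distinct acyclic s1 d_def by unfold_locales auto

interpretation tree_raking G \<Delta> Zs col K d
  by (rule tree_raking)

lemma alive_end: "alv I = {}"
  unfolding I_def
proof (rule all_removed[OF _ L_J])
  fix C assume "conn G C" "C \<subseteq> Zs"
  then show "card C \<le> L" using sh unfolding shattered_def Zs_def by blast
qed

lemma Zs_removed: "u \<in> Zs \<Longrightarrow> u \<in> rm (lay u) \<and> lay u < I"
  using removed_before[of u I] alive_end layer_rm[of u _ I] by (auto simp: lay_def)

text \<open>Equal layers mean equal colours, which neighbours do not have.\<close>

lemma nbr_layer_neq:
  assumes "u \<in> Zs" "w \<in> Zs" "w \<in> set (nbrs G u)"
  shows "lay u \<noteq> lay w"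
proof
  assume eq: "lay u = lay w"
  have "w \<in> nbh G d u" using nbh_nbr[OF assms(3) nbh_refl, of 0] d1 nbh_mono[of 1 d G u] by auto
  then have "w = u" using rm_close_eq[of u "lay u" w] Zs_removed assms(1,2) eq by metis
  then show False using nbrs_irrefl[of u] assms Zs_verts by blast
qed

lemma Br_Zs: "Br \<subseteq> Zs"
  unfolding Br_def using breaks_iff rm_Z by blast

text \<open>A node that is not a break is raked, with at most one surviving neighbour, and parents
  survive it.\<close>

lemma parent_unique:
  assumes u: "u \<in> Zs" and y: "y \<in> parents G Zs Br lay u" "y' \<in> parents G Zs Br lay u"
  shows "y = y'"
proof -
  have uB: "u \<notin> Br" using y(1) by (auto simp: parents_def split: if_splits)
  have "adeg G (alv (lay u)) u \<le> 1"
    using rm_not_break[of u "lay u" I] Zs_removed[OF u] uB unfolding Br_def by blast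
  then have "card (set (nbrs G u) \<inter> alv (lay u)) \<le> Suc 0" by (simp add: adeg_def)
  moreover have "x \<in> set (nbrs G u) \<inter> alv (lay u)" if "x \<in> parents G Zs Br lay u" for x
  proof -
    have x: "x \<in> set (nbrs G u)" "x \<in> Zs" "lay u < lay x" using that uB by (auto simp: parents_def)
    then show ?thesis using rm_alive[of x "lay x" "lay u"] Zs_removed[OF x(2)] by auto
  qed
  ultimately show ?thesis using y by (meson card_le_Suc0_iff_eq finite_Int finite_set)
qed

lemma unset_near:
  assumes "(u, i) \<notin> S0" "u \<in> verts G" "i < h"
  shows "\<exists>v\<in>marked B0. u \<in> nbh G s v"
  using unset_near_marked[OF assms(2,3)] assms nbh_sym unfolding S0_def by blast

text \<open>An unset bit in the zone of \<open>b\<close> lies near a marked node. So every path of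
  length at most \<open>d\<close> from \<open>b\<close> stays inside \<open>Zs\<close>, and
  \<open>breaks_separated\<close> applies. Zones without unset bits may be close together, but they
  change nothing.\<close>

lemma effective_unique:
  assumes b: "b \<in> Br" "zone G (r + s) h S0 b \<noteq> {}" and b': "b' \<in> Br" "b' \<in> nbh G d b"
  shows "b' = b"
proof -
  have bV: "b \<in> verts G" using b(1) Br_Zs Zs_verts by blast
  obtain u i where u: "u \<in> nbh G (r + s) b" "i < h" "(u, i) \<notin> S0" using b(2) by (auto simp: zone_def)
  have uV: "u \<in> verts G" using u(1) nbh_verts[OF bV] by blast
  obtain v where v: "v \<in> marked B0" "u \<in> nbh G s v" using unset_near[OF u(3) uV u(2)] by blast
  have bv: "b \<in> nbh G (s + (r + s)) v" using nbh_trans[OF v(2) nbh_sym[OF bV u(1)]] .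
  obtain k f where f: "k \<le> d" "f 0 = b" "f k = b'" "\<forall>i<k. f (Suc i) \<in> set (nbrs G (f i))"
    using nbh_path[OF b'(2)] by blast
  have "f j \<in> Zs" if "j \<le> k" for j
  proof -
    have "f j \<in> nbh G j (f 0)" by (rule path_nbh) (use f that in auto)
    then have "f j \<in> nbh G z v" using nbh_trans_le[OF bv, of "f j" j z] f that d_def z_def by simp
    then show ?thesis using v(1) by (auto simp: Zs_def)
  qed
  then show ?thesis
    using breaks_separated[of b I b' f k] b(1) b'(1) f unfolding Br_def by auto
qed

lemma risk_cong_sets:
  assumes "v \<in> verts G" "S \<inter> blk G s h v = S' \<inter> blk G s h v" "B \<inter> blk G s h v = B' \<inter> blk G s h v"
  shows "rsk S B v = rsk S' B' v"
proof -
  have "blk G s h v - S = blk G s h v - S'" using assms(2) by blast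
  then show ?thesis unfolding risk_def
    using dependsD[OF depends_mono[OF depends_avg[OF depE[OF assms(1)]]], of _ "blk G s h v"] assms(3)
    by (metis Diff_subset)
qed

text \<open>By the tower law each risk is the mean of its values over the bits of the zone, hence so
  is their sum; some assignment does not exceed this mean.\<close>

lemma zone_choice:
  assumes b: "b \<in> verts G"
  shows "zone_choice G s h E (r + s) S0 B0 b \<subseteq> zone G (r + s) h S0 b \<and>
     (\<Sum>v\<in>nbh G (r + s + s) b. rsk (S0 \<union> zone G (r + s) h S0 b)
        ((B0 - zone G (r + s) h S0 b) \<union> zone_choice G s h E (r + s) S0 B0 b) v)
       \<le> (\<Sum>v\<in>nbh G (r + s + s) b. rsk S0 B0 v)"
proof -
  let ?U = "zone G (r + s) h S0 b"
  have fin: "finite ?U" by (simp add: zone_def)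
  have "avg ?U (\<lambda>B. rsk (S0 \<union> ?U) B v) B0 = rsk S0 B0 v" if v: "v \<in> nbh G (r + s + s) b" for v
  proof -
    have vV: "v \<in> verts G" using v b nbh_verts by blast
    have "avg ?U (\<lambda>B. rsk (S0 \<union> ?U) B v) B0 =
        avg (?U \<union> (blk G s h v - (S0 \<union> ?U))) (\<lambda>B. of_bool (E v B)) B0"
      unfolding risk_def by (rule avg_avg) (use fin in auto)
    also have "\<dots> = avg ((?U \<union> (blk G s h v - (S0 \<union> ?U))) \<inter> blk G s h v) (\<lambda>B. of_bool (E v B)) B0"
      by (rule avg_Int[OF _ depE[OF vV]]) (use fin in simp)
    also have "(?U \<union> (blk G s h v - (S0 \<union> ?U))) \<inter> blk G s h v = blk G s h v - S0"
      by (auto simp: zone_def)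
    finally show ?thesis by (simp add: risk_def)
  qed
  then have "avg ?U (\<lambda>B. \<Sum>v\<in>nbh G (r + s + s) b. rsk (S0 \<union> ?U) B v) B0 = (\<Sum>v\<in>nbh G (r + s + s) b. rsk S0 B0 v)"
    unfolding avg_sum by (rule sum.cong[OF refl])
  then have "\<exists>W. W \<subseteq> ?U \<and> (\<Sum>v\<in>nbh G (r + s + s) b. rsk (S0 \<union> ?U) ((B0 - ?U) \<union> W) v)
       \<le> (\<Sum>v\<in>nbh G (r + s + s) b. rsk S0 B0 v)"
    using avg_le_witness[OF fin] by metis
  then show ?thesis unfolding zone_choice_def by (rule someI_ex)
qed

lemma zone_far:
  assumes "v \<in> verts G" "b \<in> Br" "zone G (r + s) h S0 b \<inter> blk G s h v \<noteq> {}"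
  shows "v \<in> nbh G (r + s + s) b"
proof -
  have bV: "b \<in> verts G" using assms(2) Br_Zs Zs_verts by blast
  obtain u where u: "u \<in> nbh G (r + s) b" "u \<in> nbh G s v" using assms(3) by (auto simp: zone_def blk_def)
  then show ?thesis using nbh_common[OF bV assms(1) u] by simp
qed

lemma zone_choice_sub: "b \<in> Br \<Longrightarrow> zone_choice G s h E (r + s) S0 B0 b \<subseteq> zone G (r + s) h S0 b"
  using zone_choice Br_Zs Zs_verts by blast

text \<open>At most one zone with unset bits meets the block of \<open>v\<close>. The risk of
  \<open>v\<close> is then a summand of the sum controlled by \<open>zone_choice\<close>, and that
  sum is bounded by at most \<open>(\<Delta> + 2) ^ (r + s + s)\<close> terms
  \<open>2 * \<theta>\<close>.\<close>

lemma risk_after_zones: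
  assumes v: "v \<in> verts G"
  shows "rsk S1 B1 v \<le> 2 * \<theta> * (\<Delta> + 2) ^ (r + s + s)"
proof (cases "\<exists>b\<in>Br. zone G (r + s) h S0 b \<inter> blk G s h v \<noteq> {}")
  case False
  then have no: "zone G (r + s) h S0 b \<inter> blk G s h v = {}" if "b \<in> Br" for b using that by blast
  have "rsk S1 B1 v = rsk S0 B0 v"
  proof (rule risk_cong_sets[OF v])
    show "S1 \<inter> blk G s h v = S0 \<inter> blk G s h v" using no by (auto simp: S1_def zone_set_def)
    show "B1 \<inter> blk G s h v = B0 \<inter> blk G s h v"
      using no zone_choice_sub unfolding B1_def zone_bits_def by blast
  qed
  also have "\<dots> \<le> 2 * \<theta>" unfolding S0_def by (rule risk_pre_le[OF v])
  also have "\<dots> \<le> 2 * \<theta> * (\<Delta> + 2) ^ (r + s + s)" using theta_pos by (simp add: one_le_power)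
  finally show ?thesis .
next
  case True
  then obtain b where b: "b \<in> Br" "zone G (r + s) h S0 b \<inter> blk G s h v \<noteq> {}" by blast
  have bV: "b \<in> verts G" using b(1) Br_Zs Zs_verts by blast
  have vb: "v \<in> nbh G (r + s + s) b" by (rule zone_far[OF v b])
  have uniq: "b' = b" if b': "b' \<in> Br" "zone G (r + s) h S0 b' \<inter> blk G s h v \<noteq> {}" for b'
  proof (rule effective_unique[OF b(1) _ b'(1)])
    show "zone G (r + s) h S0 b \<noteq> {}" using b(2) by blast
    have b'V: "b' \<in> verts G" using b'(1) Br_Zs Zs_verts by blast
    show "b' \<in> nbh G d b"
      using nbh_trans_le[OF vb nbh_sym[OF b'V zone_far[OF v b']], of d] d_def by simp
  qed
  let ?U = "zone G (r + s) h S0 b"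
  let ?W = "zone_choice G s h E (r + s) S0 B0 b"
  have "rsk S1 B1 v = rsk (S0 \<union> ?U) ((B0 - ?U) \<union> ?W) v"
  proof (rule risk_cong_sets[OF v])
    show "S1 \<inter> blk G s h v = (S0 \<union> ?U) \<inter> blk G s h v" using uniq b(1) unfolding S1_def zone_set_def by blast
    have "(\<Union>b\<in>Br. zone G (r + s) h S0 b) \<inter> blk G s h v = ?U \<inter> blk G s h v" using uniq b(1) by blast
    moreover have "(\<Union>b\<in>Br. zone_choice G s h E (r + s) S0 B0 b \<inter> zone G (r + s) h S0 b) \<inter> blk G s h v = ?W \<inter> blk G s h v"
      using uniq b(1) zone_choice_sub by blast
    ultimately show "B1 \<inter> blk G s h v = ((B0 - ?U) \<union> ?W) \<inter> blk G s h v"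
      unfolding B1_def zone_bits_def by blast
  qed
  also have "\<dots> \<le> (\<Sum>v\<in>nbh G (r + s + s) b. rsk (S0 \<union> ?U) ((B0 - ?U) \<union> ?W) v)"
    by (rule member_le_sum[OF vb]) (auto simp: risk_nonneg)
  also have "\<dots> \<le> (\<Sum>v\<in>nbh G (r + s + s) b. rsk S0 B0 v)" using zone_choice[OF bV] by blast
  also have "\<dots> \<le> (\<Sum>v\<in>nbh G (r + s + s) b. 2 * \<theta>)"
    unfolding S0_def using nbh_verts[OF bV] by (intro sum_mono risk_pre_le) blast
  also have "\<dots> = real (card (nbh G (r + s + s) b)) * (2 * \<theta>)" by simp
  also have "\<dots> \<le> real ((\<Delta> + 2) ^ (r + s + s)) * (2 * \<theta>)"
    using card_nbh[OF bV, of "r + s + s"] theta_pos by (intro mult_right_mono of_nat_mono) auto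
  finally show ?thesis by (simp add: mult.commute)
qed

text \<open>The local lemma for the bits outside \<open>S1\<close>. The assignment only witnesses
  that the dynamic programming below cannot get stuck.\<close>

lemma completion: "\<exists>B. B \<inter> S1 = B1 \<inter> S1 \<and> (\<forall>v\<in>verts G. \<not> E v B)"
proof -
  let ?U = "bits - S1"
  have "\<exists>W\<subseteq>?U. \<forall>v\<in>verts G. \<not> E v ((B1 - ?U) \<union> W)"
  proof (rule lovasz_local_lemma[where D = "blk G s h" and N = "nbh G (2 * s)"])
    show "finite ?U" "finite (verts G)" by simp_all
    show "depends (blk G s h v) (E v)" if "v \<in> verts G" for v by (rule dep[OF that])
    show "finite (nbh G (2 * s) v) \<and> card (nbh G (2 * s) v) \<le> (\<Delta> + 2) ^ (2 * s)" if "v \<in> verts G" for v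
      using card_nbh[OF that] by simp
    show "blk G s h v \<inter> blk G s h w = {}" if vw: "v \<in> verts G" "w \<in> verts G" "w \<notin> nbh G (2 * s) v" for v w
      using vw(3) nbh_common[OF vw(1,2), of _ s s] by (auto simp: blk_def mult_2)
    show "avg ?U (\<lambda>B. of_bool (E v B)) B1 \<le> 2 * \<theta> * (\<Delta> + 2) ^ (r + s + s)" if "v \<in> verts G" for v
      using risk_after_zones[OF that] risk_eq_avg_bits[OF that] by simp
    show "0 \<le> 2 * \<theta> * real ((\<Delta> + 2) ^ (r + s + s))" using theta_pos by simp
    show "4 * (2 * \<theta> * real ((\<Delta> + 2) ^ (r + s + s))) * real ((\<Delta> + 2) ^ (2 * s)) \<le> 1" using lll by simp
    show "1 \<le> (\<Delta> + 2) ^ (2 * s)" by simp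
  qed
  then obtain W where "W \<subseteq> ?U" "\<forall>v\<in>verts G. \<not> E v ((B1 - ?U) \<union> W)" by blast
  then show ?thesis by (intro exI[of _ "(B1 - ?U) \<union> W"]) blast
qed

lemma fixed_ol:
  assumes "x \<in> verts G" "fixed_at G T h S1 x" "B \<inter> S1 = B1 \<inter> S1"
  shows "ol x B = ol x B1"
  by (rule dependsD[OF ol_dep[OF assms(1)]]) (use assms(2,3) in \<open>auto simp: fixed_at_def\<close>)

lemma feas_stable: "u \<in> Zs \<Longrightarrow> lay u < i \<Longrightarrow> i \<le> j \<Longrightarrow> feas G r Zs Br lay st j u = feas G r Zs Br lay st i u"
  by (induction j) (auto simp: le_Suc_eq)

lemma F_unfold:
  assumes u: "u \<in> Zs"
  shows "F u = {q \<in> st u. \<forall>w\<in>children G Zs Br lay u. \<exists>q'\<in>F w. agreeing G r u w q q'}"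
proof -
  have "lay u < I" using Zs_removed[OF u] by simp
  then have "F u = feas G r Zs Br lay st (Suc (lay u)) u"
    unfolding F_def using feas_stable[OF u, of "Suc (lay u)" I] by simp
  also have "\<dots> = {q \<in> st u. \<forall>w\<in>children G Zs Br lay u. \<exists>q'\<in>feas G r Zs Br lay st (lay u) w. agreeing G r u w q q'}"
    using u by simp
  also have "\<dots> = {q \<in> st u. \<forall>w\<in>children G Zs Br lay u. \<exists>q'\<in>F w. agreeing G r u w q q'}"
  proof -
    have "feas G r Zs Br lay st (lay u) w = F w" if "w \<in> children G Zs Br lay u" for w
      unfolding F_def using feas_stable[of w "lay u" I] that \<open>lay u < I\<close> by (auto simp: children_def)
    then show ?thesis by (intro Collect_cong conj_cong ball_cong refl) simp
  qed
  finally show ?thesis .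
qed

text \<open>The restrictions of a global completion to balls agree with each other, so they survive
  every step of the bottom-up pass.\<close>

lemma F_nonempty:
  assumes "B \<inter> S1 = B1 \<inter> S1" "\<forall>v\<in>verts G. \<not> E v B" and u: "u \<in> Zs"
  shows "restrict (\<lambda>x. ol x B) (nbh G r u) \<in> F u"
  using u
proof (induction "lay u" arbitrary: u rule: less_induct)
  case less
  let ?q = "\<lambda>u. restrict (\<lambda>x. ol x B) (nbh G r u)"
  have uV: "u \<in> verts G" using less Zs_verts by blast
  have sub: "nbh G r u \<subseteq> verts G" by (rule nbh_verts[OF uV])
  have "good u (\<lambda>x. ol x B)" using assms(2) uV E_eq by blast
  then have "good u (?q u)" using good_cong[OF uV, of "?q u" "\<lambda>x. ol x B"] by simp
  moreover have "?q u \<in> PiE (nbh G r u) (\<lambda>y. {os. length os = length (nbrs G y)})"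
    using ol_length sub by (auto simp: subset_iff)
  moreover have "?q u y = ol y B1" if "y \<in> nbh G r u" "fixed_at G T h S1 y" for y
    using fixed_ol[of y B] that sub assms(1) by (simp add: subset_iff)
  ultimately have "?q u \<in> st u" unfolding st_def states_def by blast
  moreover have "?q w \<in> F w \<and> agreeing G r u w (?q u) (?q w)" if "w \<in> children G Zs Br lay u" for w
    using less that by (auto simp: children_def agreeing_def)
  ultimately show ?case unfolding F_unfold[OF less.prems] by blast
qed

lemma pick_stable:
  "u \<in> Zs \<Longrightarrow> I \<le> lay u + i \<Longrightarrow> i \<le> j \<Longrightarrow> j \<le> I \<Longrightarrow> pick G r Zs Br lay F I j u = pick G r Zs Br lay F I i u"
proof (induction j)
  case (Suc j)
  show ?case
  proof (cases "i = Suc j")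
    case False
    then have "lay u \<noteq> I - Suc j" using Suc.prems Zs_removed[of u] by auto
    then show ?thesis using Suc False by simp
  qed simp
qed simp

lemma pk_unfold:
  assumes u: "u \<in> Zs"
  shows "pk u = pick_from {q \<in> F u. \<forall>y\<in>parents G Zs Br lay u. agreeing G r y u (pk y) q}"
proof -
  define j where "j = I - Suc (lay u)"
  have lt: "lay u < I" using Zs_removed[OF u] by simp
  then have j: "lay u = I - Suc j" "Suc j \<le> I" "I \<le> lay u + Suc j" by (auto simp: j_def)
  have "pk u = pick G r Zs Br lay F I (Suc j) u"
    unfolding pk_def by (rule pick_stable[OF u j(3,2)]) simp
  also have "\<dots> = pick_from {q \<in> F u. \<forall>y\<in>parents G Zs Br lay u. agreeing G r y u (pick G r Zs Br lay F I j y) q}"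
    using u j by simp
  also have "\<dots> = pick_from {q \<in> F u. \<forall>y\<in>parents G Zs Br lay u. agreeing G r y u (pk y) q}"
  proof -
    have "pick G r Zs Br lay F I j y = pk y" if "y \<in> parents G Zs Br lay u" for y
      unfolding pk_def using pick_stable[of y j I] that j by (auto simp: parents_def split: if_splits)
    then show ?thesis by (intro arg_cong[of _ _ pick_from] Collect_cong conj_cong ball_cong refl) simp
  qed
  finally show ?thesis .
qed

text \<open>The guess chosen by a parent is feasible, so the child has a feasible guess that agrees
  with it; with a single parent no conflicting demand arises.\<close>

lemma pk_props:
  assumes "u \<in> Zs"
  shows "pk u \<in> F u \<and> (\<forall>y\<in>parents G Zs Br lay u. agreeing G r y u (pk y) (pk u))"
  using assms
proof (induction "I - lay u" arbitrary: u rule: less_induct)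
  case less
  let ?A = "{q \<in> F u. \<forall>y\<in>parents G Zs Br lay u. agreeing G r y u (pk y) q}"
  have "?A \<noteq> {}"
  proof (cases "parents G Zs Br lay u = {}")
    case True
    obtain B where "B \<inter> S1 = B1 \<inter> S1" "\<forall>v\<in>verts G. \<not> E v B" using completion by blast
    then show ?thesis using F_nonempty[OF _ _ less.prems] True by blast
  next
    case False
    then obtain y where y: "y \<in> parents G Zs Br lay u" by blast
    then have y': "y \<in> set (nbrs G u)" "y \<in> Zs" "lay u < lay y" "u \<notin> Br"
      by (auto simp: parents_def split: if_splits)
    have "pk y \<in> F y" using less.hyps[of y] y' Zs_removed[OF y'(2)] by auto
    moreover have "u \<in> set (nbrs G y)" using y' less.prems Zs_verts nbrs_sym by blast
    then have "u \<in> children G Zs Br lay y" using y' less.prems by (simp add: children_def)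
    ultimately obtain q where "q \<in> F u" "agreeing G r y u (pk y) q" using F_unfold[OF y'(2)] by blast
    then show ?thesis using parent_unique[OF less.prems y] by blast
  qed
  then have "pk u \<in> ?A" unfolding pk_unfold[OF less.prems] by (rule pick_from_in)
  then show ?case by blast
qed

lemma pk_states: "u \<in> Zs \<Longrightarrow> pk u \<in> st u"
  using pk_props F_unfold by blast

lemma pk_nbr_agree:
  assumes "u \<in> Zs" "w \<in> Zs" "w \<in> set (nbrs G u)" "u \<notin> Br" "w \<notin> Br" "x \<in> nbh G r u" "x \<in> nbh G r w"
  shows "pk u x = pk w x"
proof (cases "lay u < lay w")
  case True
  then have "w \<in> parents G Zs Br lay u" using assms by (simp add: parents_def)
  then have "agreeing G r w u (pk w) (pk u)" using pk_props[OF assms(1)] by blast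
  then show ?thesis using assms by (simp add: agreeing_def)
next
  case False
  then have "lay w < lay u" using nbr_layer_neq[OF assms(1-3)] by simp
  moreover have "u \<in> set (nbrs G w)" using assms Zs_verts nbrs_sym by blast
  ultimately have "u \<in> parents G Zs Br lay w" using assms by (simp add: parents_def)
  then have "agreeing G r u w (pk u) (pk w)" using pk_props[OF assms(2)] by blast
  then show ?thesis using assms by (simp add: agreeing_def)
qed

text \<open>If all bits of the block of \<open>v\<close> are set, the outputs around
  \<open>v\<close> are those of a completion. Otherwise an unset bit puts the whole
  \<open>r\<close>-ball into \<open>Zs\<close> and keeps breaks out of it; then guesses agree along
  paths in the ball, and the final output around \<open>v\<close> is the guess of
  \<open>v\<close>.\<close>

lemma final_good:
  assumes v: "v \<in> verts G"
  shows "good v (final_output Zs ol B1 pk)"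
proof (cases "blk G s h v \<subseteq> S1")
  case True
  obtain B where B: "B \<inter> S1 = B1 \<inter> S1" "\<forall>v\<in>verts G. \<not> E v B" using completion by blast
  have sub: "nbh G r v \<subseteq> verts G" by (rule nbh_verts[OF v])
  have "final_output Zs ol B1 pk x = ol x B" if x: "x \<in> nbh G r v" for x
  proof -
    have xV: "x \<in> verts G" using x sub by blast
    have "nbh G T x \<subseteq> nbh G s v" using nbh_trans_le[OF x _ rT] by blast
    then have fx: "fixed_at G T h S1 x" using True by (auto simp: fixed_at_def blk_def)
    have "pk x x = ol x B1" if "x \<in> Zs"
      using pk_states[OF that] fx by (simp add: st_def states_def)
    then show ?thesis using fixed_ol[OF xV fx B(1)] by (simp add: final_output_def)
  qed
  then have "good v (final_output Zs ol B1 pk) \<longleftrightarrow> good v (\<lambda>x. ol x B)" by (rule good_cong[OF v])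
  then show ?thesis using B(2) v E_eq by blast
next
  case False
  then obtain u i where u: "u \<in> nbh G s v" "i < h" "(u, i) \<notin> S1" by (auto simp: blk_def)
  have uV: "u \<in> verts G" using u(1) v nbh_verts by blast
  have "(u, i) \<notin> S0" using u(3) by (simp add: S1_def zone_set_def)
  then obtain m where m: "m \<in> marked B0" "u \<in> nbh G s m" using unset_near uV u(2) by blast
  have vm: "v \<in> nbh G (s + s) m" using nbh_trans[OF m(2) nbh_sym[OF v u(1)]] .
  have Z: "x \<in> Zs" if "x \<in> nbh G r v" for x
  proof -
    have "x \<in> nbh G z m" using nbh_trans_le[OF vm that, of z] z_def by simp
    then show ?thesis using m(1) by (auto simp: Zs_def)
  qed
  \<comment> \<open>This is why zones have radius \<open>r + s\<close>: a break in the ball would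
    have had the bit of \<open>u\<close> fixed.\<close>
  have nb: "b \<notin> Br" if b: "b \<in> nbh G r v" for b
  proof
    assume bB: "b \<in> Br"
    have "u \<in> nbh G (r + s) b" using nbh_trans[OF nbh_sym[OF v b] u(1)] .
    then have "(u, i) \<in> S1" using u(2) bB by (auto simp: S1_def zone_set_def zone_def)
    then show False using u(3) by simp
  qed
  have same: "pk v x = pk x x" if x: "x \<in> nbh G r v" for x
  proof -
    obtain k f where f: "k \<le> r" "f 0 = v" "f k = x" "\<forall>i<k. f (Suc i) \<in> set (nbrs G (f i))"
      using nbh_path[OF x] by blast
    have fv: "f j \<in> nbh G r v" if "j \<le> k" for j
    proof -
      have "f j \<in> nbh G j (f 0)" by (rule path_nbh) (use f that in auto)
      then show ?thesis using f that nbh_mono[of j r G v] by auto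
    qed
    have fx: "x \<in> nbh G r (f j)" if "j \<le> k" for j
    proof -
      have "f (j + (k - j)) \<in> nbh G (k - j) (f (j + 0))"
        by (rule path_nbh[of _ "\<lambda>i. f (j + i)"]) (use f that in auto)
      then have "x \<in> nbh G (k - j) (f j)" using f(3) that by simp
      moreover have "k - j \<le> r" using f(1) by simp
      ultimately show ?thesis using nbh_mono by blast
    qed
    have "j \<le> k \<Longrightarrow> pk v x = pk (f j) x" for j
    proof (induction j)
      case (Suc j)
      then have "pk (f j) x = pk (f (Suc j)) x"
        using f fv[of j] fv[of "Suc j"] fx[of j] fx[of "Suc j"] Z nb by (intro pk_nbr_agree) auto
      then show ?case using Suc by simp
    qed (use f in simp)
    then show ?thesis using f by blast
  qed
  have "good v (pk v)" using pk_states[OF Z[of v]] by (simp add: st_def states_def)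
  moreover have "final_output Zs ol B1 pk x = pk v x" if "x \<in> nbh G r v" for x
    using same[OF that] Z[OF that] by (simp add: final_output_def)
  ultimately show ?thesis using good_cong[OF v, of "final_output Zs ol B1 pk" "pk v"] by simp
qed

end

end

section \<open>Distance colouring\<close>

definition first_diff :: "nat \<Rightarrow> nat \<Rightarrow> nat" where
  "first_diff m m' = (LEAST i. bit m i \<noteq> bit m' i)"

text \<open>If nearby nodes had equal signatures, both would have recorded the same bit at the first position
where their colours differ.\<close>

definition signature :: "pgraph \<Rightarrow> nat \<Rightarrow> (nat \<Rightarrow> nat) \<Rightarrow> nat \<Rightarrow> (nat \<times> bool) set" where
  "signature G d c u = (\<lambda>w. (first_diff (c u) (c w), bit (c u) (first_diff (c u) (c w)))) ` {w \<in> nbh G d u. c w \<noteq> c u}"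

text \<open>One injection for given \<open>L\<close> and \<open>D\<close>, shared by all nodes, so
  that different signatures stay different colours.\<close>

definition enc_sig :: "nat \<Rightarrow> nat \<Rightarrow> (nat \<times> bool) set \<Rightarrow> nat" where
  "enc_sig L D = (SOME e. inj_on e {S. S \<subseteq> {..<L} \<times> UNIV \<and> card S \<le> D} \<and>
     e ` {S. S \<subseteq> {..<L} \<times> UNIV \<and> card S \<le> D} \<subseteq> {..<(2 * L + 1) ^ D})"

definition recolour :: "pgraph \<Rightarrow> nat \<Rightarrow> nat \<Rightarrow> nat \<Rightarrow> (nat \<Rightarrow> nat) \<Rightarrow> nat \<Rightarrow> nat" where
  "recolour G d L D c u = enc_sig L D (signature G d c u)"

definition next_width :: "nat \<Rightarrow> nat \<Rightarrow> nat" where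
  "next_width D L = D * (floor_log (2 * L + 1) + 1)"

text \<open>Widths of the colours in bits. Below the threshold \<open>m\<close> recolouring no
  longer guarantees a decrease, so the sequence stays constant there.\<close>

primrec width :: "nat \<Rightarrow> nat \<Rightarrow> nat \<Rightarrow> nat \<Rightarrow> nat" where
  "width D m l 0 = l"
| "width D m l (Suc j) = (if width D m l j \<le> m then width D m l j else next_width D (width D m l j))"

primrec colouring :: "pgraph \<Rightarrow> nat \<Rightarrow> nat \<Rightarrow> nat \<Rightarrow> nat \<Rightarrow> nat \<Rightarrow> nat \<Rightarrow> nat" where
  "colouring G d D m l 0 = (\<lambda>u. u)"
| "colouring G d D m l (Suc j) =
     (if width D m l j \<le> m then colouring G d D m l j
      else recolour G d (width D m l j) D (colouring G d D m l j))"

lemma first_diff: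
  assumes "m \<noteq> m'" "m < 2 ^ L" "m' < 2 ^ L"
  shows "first_diff m m' < L" "bit m (first_diff m m') \<noteq> bit m' (first_diff m m')"
proof -
  have "\<exists>i. bit m i \<noteq> bit m' i" using assms(1) bit_eqI by blast
  then show *: "bit m (first_diff m m') \<noteq> bit m' (first_diff m m')"
    unfolding first_diff_def by (rule LeastI_ex)
  show "first_diff m m' < L"
  proof (rule ccontr)
    assume "\<not> ?thesis"
    then have le: "(2::nat) ^ L \<le> 2 ^ first_diff m m'" by (intro power_increasing) auto
    have "m div 2 ^ first_diff m m' = 0" "m' div 2 ^ first_diff m m' = 0"
      by (rule div_less, use le assms in linarith)+
    then show False using * by (simp add: bit_iff_odd)
  qed
qed

lemma enc_sig:
  "inj_on (enc_sig L D) {S. S \<subseteq> {..<L} \<times> UNIV \<and> card S \<le> D} \<and>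
   enc_sig L D ` {S. S \<subseteq> {..<L} \<times> UNIV \<and> card S \<le> D} \<subseteq> {..<(2 * L + 1) ^ D}"
proof -
  have fin: "finite {S. S \<subseteq> {..<L} \<times> (UNIV::bool set) \<and> card S \<le> D}"
    using card_small_subsets[of "{..<L} \<times> (UNIV::bool set)" D] by simp
  have "card {S. S \<subseteq> {..<L} \<times> (UNIV::bool set) \<and> card S \<le> D} \<le> (2 * L + 1) ^ D"
    using card_small_subsets[of "{..<L} \<times> (UNIV::bool set)" D] by (simp add: card_cartesian_product mult.commute)
  from ex_inj_on_card_le[OF fin this] show ?thesis unfolding enc_sig_def by (rule someI_ex)
qed

context bgraph
begin

lemma recolour_distinct:
  assumes c: "distinct_col G d c" "\<And>v. v \<in> verts G \<Longrightarrow> c v < 2 ^ L" and D: "(\<Delta> + 2) ^ d \<le> D"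
  shows "distinct_col G d (recolour G d L D c)" "v \<in> verts G \<Longrightarrow> recolour G d L D c v < (2 * L + 1) ^ D"
proof -
  have sig: "signature G d c u \<in> {S. S \<subseteq> {..<L} \<times> UNIV \<and> card S \<le> D}" if u: "u \<in> verts G" for u
  proof -
    have sub: "nbh G d u \<subseteq> verts G" by (rule nbh_verts[OF u])
    have "card (signature G d c u) \<le> card {w \<in> nbh G d u. c w \<noteq> c u}"
      unfolding signature_def by (rule card_image_le) simp
    also have "\<dots> \<le> card (nbh G d u)" by (rule card_mono) auto
    also have "\<dots> \<le> D" using card_nbh[OF u, of d] D by simp
    finally have "card (signature G d c u) \<le> D" .
    moreover have "first_diff (c u) (c w) < L" if "w \<in> nbh G d u" "c w \<noteq> c u" for w
      by (rule first_diff) (use that c(2) u sub in auto)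
    ultimately show ?thesis by (auto simp: signature_def)
  qed
  show "distinct_col G d (recolour G d L D c)"
    unfolding distinct_col_def
  proof (intro ballI impI notI)
    fix u w assume u: "u \<in> verts G" and w: "w \<in> nbh G d u" "w \<noteq> u" and eq: "recolour G d L D c u = recolour G d L D c w"
    have wV: "w \<in> verts G" using w(1) nbh_verts[OF u] by blast
    have ne: "c w \<noteq> c u" using c(1) u w unfolding distinct_col_def by metis
    have "signature G d c u = signature G d c w"
      using eq enc_sig sig[OF u] sig[OF wV] unfolding recolour_def by (meson inj_onD)
    moreover let ?i = "first_diff (c u) (c w)"
    have "(?i, bit (c u) ?i) \<in> signature G d c u" unfolding signature_def using w ne by blast
    ultimately have "(?i, bit (c u) ?i) \<in> signature G d c w" by simp
    then have "bit (c u) ?i = bit (c w) ?i" unfolding signature_def by auto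
    then show False using first_diff(2)[of "c u" "c w" L] ne c(2)[OF u] c(2)[OF wV] by auto
  qed
  show "recolour G d L D c v < (2 * L + 1) ^ D" if "v \<in> verts G"
    unfolding recolour_def using enc_sig sig[OF that] by blast
qed

lemma next_width: "(2 * L + 1) ^ D \<le> 2 ^ next_width D L"
proof -
  have "2 * L + 1 \<le> 2 * 2 ^ floor_log (2 * L + 1)" by (rule floor_log_exp2_ge)
  then have "(2 * L + 1) ^ D \<le> (2 ^ (floor_log (2 * L + 1) + 1)) ^ D" by (intro power_mono) simp_all
  also have "\<dots> = 2 ^ next_width D L"
    unfolding next_width_def power_mult[symmetric] by (simp only: mult.commute)
  finally show ?thesis .
qed

lemma colouring_distinct:
  assumes V: "verts G \<subseteq> {..<2 ^ l}" and D: "(\<Delta> + 2) ^ d \<le> D"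
  shows "distinct_col G d (colouring G d D m l j) \<and> (\<forall>v\<in>verts G. colouring G d D m l j v < 2 ^ width D m l j)"
proof (induction j)
  case 0
  then show ?case using V by (auto simp: distinct_col_def)
next
  case (Suc j)
  then show ?case
    using recolour_distinct[of d "colouring G d D m l j" "width D m l j" D] D next_width
    by (auto intro: less_le_trans)
qed

end

lemma width_le:
  assumes m: "\<And>L. L > m \<Longrightarrow> 2 * next_width D L \<le> L"
  shows "width D m l j \<le> max m (l div 2 ^ j)" "width D m l j \<le> l"
proof -
  show "width D m l j \<le> max m (l div 2 ^ j)"
  proof (induction j)
    case (Suc j)
    show ?case
    proof (cases "width D m l j \<le> m")
      case False
      then have "width D m l j \<le> l div 2 ^ j" using Suc by simp
      then have "2 * next_width D (width D m l j) \<le> l div 2 ^ j" using m[of "width D m l j"] False by simp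
      then have "next_width D (width D m l j) \<le> l div 2 ^ j div 2" by simp
      also have "\<dots> = l div 2 ^ Suc j" by (simp only: div_mult2_eq[symmetric] power_Suc2)
      finally show ?thesis using False by simp
    qed simp
  qed simp
  show "width D m l j \<le> l"
  proof (induction j)
    case (Suc j)
    then show ?case using m[of "width D m l j"] by auto
  qed simp
qed

text \<open>Halving is fast enough: the initial width will be logarithmic in \<open>n\<close>, so
  the number of steps is of order \<open>ln (ln n)\<close>.\<close>

lemma width_final:
  assumes "\<And>L. L > m \<Longrightarrow> 2 * next_width D L \<le> L"
  shows "width D m l (floor_log l + 1) \<le> m"
proof -
  have "l < 2 ^ (floor_log l + 1)" using floor_log_exp2_gt[of l] by simp
  then have "l div 2 ^ (floor_log l + 1) = 0" by simp
  moreover have "width D m l (floor_log l + 1) \<le> max m (l div 2 ^ (floor_log l + 1))"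
    by (rule width_le(1)) (rule assms)
  ultimately show ?thesis by (metis max_0R)
qed

lemma ex_width_threshold: "\<exists>m. \<forall>L>m. 2 * next_width D L \<le> L"
proof -
  have "eventually (\<lambda>L::nat. 2 * real D * (log 2 (2 * real L + 1) + 1) \<le> real L) at_top"
    by real_asymp
  then obtain m where m: "\<And>L. L \<ge> m \<Longrightarrow> 2 * real D * (log 2 (2 * real L + 1) + 1) \<le> real L"
    by (auto simp: eventually_at_top_linorder)
  have "2 * next_width D L \<le> L" if "L > m" for L
  proof -
    have "real (2 ^ floor_log (2 * L + 1)) \<le> real (2 * L + 1)"
      using floor_log_exp2_le[of "2 * L + 1"] by (intro of_nat_mono) simp
    then have "real (floor_log (2 * L + 1)) \<le> log 2 (2 * real L + 1)"
      by (intro le_log_of_power) auto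
    then have "2 * real D * (real (floor_log (2 * L + 1)) + 1) \<le> 2 * real D * (log 2 (2 * real L + 1) + 1)"
      by (intro mult_left_mono) auto
    moreover have "real (2 * next_width D L) = 2 * real D * (real (floor_log (2 * L + 1)) + 1)"
      by (simp add: next_width_def algebra_simps)
    ultimately have "real (2 * next_width D L) \<le> 2 * real D * (log 2 (2 * real L + 1) + 1)" by simp
    also have "\<dots> \<le> real L" using m that by simp
    finally show ?thesis by simp
  qed
  then show ?thesis by blast
qed

section \<open>Programs with bounded labels\<close>

primrec run :: "pgraph \<Rightarrow> (nat \<Rightarrow> nat list \<Rightarrow> nat) list \<Rightarrow> (nat \<Rightarrow> nat) \<Rightarrow> nat \<Rightarrow> nat" where
  "run G [] lam = lam"
| "run G (f # fs) lam = run G fs (\<lambda>v. f (lam v) (map lam (nbrs G v)))"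

lemma run_append: "run G (fs @ gs) lam = run G gs (run G fs lam)"
  by (induction fs arbitrary: lam) auto

lemma run_snoc: "run G (fs @ [f]) lam v = f (run G fs lam v) (map (run G fs lam) (nbrs G v))"
  by (simp add: run_append)

text \<open>Names enter a run only through the initial labels. So an anonymous execution equals one
  on the graph renamed by the random names.\<close>

lemma run_rename:
  assumes "\<And>v. v \<in> verts G \<Longrightarrow> nbrs G' (\<alpha> v) = map \<alpha> (nbrs G v)" "\<And>v. v \<in> verts G \<Longrightarrow> set (nbrs G v) \<subseteq> verts G"
    and "\<And>v. v \<in> verts G \<Longrightarrow> lam v = lam' (\<alpha> v)" "v \<in> verts G"
  shows "run G prog lam v = run G' prog lam' (\<alpha> v)"
  using assms(3,4)
proof (induction prog arbitrary: lam lam' v)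
  case (Cons f fs)
  have "map lam (nbrs G u) = map lam' (nbrs G' (\<alpha> u))" if "u \<in> verts G" for u
    using assms(1,2)[OF that] Cons.prems(1) by (auto simp: subset_iff)
  then show ?case using Cons by (auto intro!: Cons.IH)
qed simp

text \<open>One program and one injection \<open>e\<close> serve all instances. Bounding every value
  of every round function, on arbitrary arguments, bounds the messages; the name inside the code
  lets later rounds refer to nodes.\<close>

definition computes ::
  "(pgraph \<times> 'a) set \<Rightarrow> nat set \<Rightarrow> nat \<Rightarrow> (pgraph \<Rightarrow> 'a \<Rightarrow> nat \<Rightarrow> nat) \<Rightarrow> nat \<Rightarrow> (pgraph \<Rightarrow> 'a \<Rightarrow> nat \<Rightarrow> 'x) \<Rightarrow> 'x set \<Rightarrow> bool"
  where
  "computes Inst names N ini t \<Lambda> X \<longleftrightarrow>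
     (\<forall>(G, a)\<in>Inst. \<forall>v\<in>verts G. \<Lambda> G a v \<in> X) \<and>
     (\<exists>prog e. length prog = t \<and> (\<forall>f\<in>set prog. \<forall>x ms. f x ms < N) \<and>
        inj_on e (names \<times> X) \<and> e ` (names \<times> X) \<subseteq> {..<N} \<and>
        (\<forall>(G, a)\<in>Inst. \<forall>v\<in>verts G. run G prog (ini G a) v = e (v, \<Lambda> G a v)))"

section \<open>Gathering balls by views\<close>

datatype 'x view = Leaf 'x | Node "'x view" "(nat \<times> 'x view) list"

text \<open>Neighbours are recorded with their names, so a view determines the actual ball and not
  just its unfolding into a tree.\<close>

primrec view_of :: "pgraph \<Rightarrow> (nat \<Rightarrow> 'x) \<Rightarrow> nat \<Rightarrow> nat \<Rightarrow> 'x view" where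
  "view_of G \<Lambda> 0 v = Leaf (\<Lambda> v)"
| "view_of G \<Lambda> (Suc k) v = Node (view_of G \<Lambda> k v) (map (\<lambda>u. (u, view_of G \<Lambda> k u)) (nbrs G v))"

primrec views :: "nat set \<Rightarrow> nat \<Rightarrow> 'x set \<Rightarrow> nat \<Rightarrow> 'x view set" where
  "views names \<Delta> X 0 = Leaf ` X"
| "views names \<Delta> X (Suc k) = (\<lambda>(a, l). Node a l) `
     (views names \<Delta> X k \<times> {l. set l \<subseteq> names \<times> views names \<Delta> X k \<and> length l \<le> \<Delta>})"

lemma view_root: "view_of G \<Lambda> k v = view_of G' \<Lambda>' k v \<Longrightarrow> \<Lambda> v = \<Lambda>' v"
  by (induction k) auto

lemma view_nbrs:
  assumes "view_of G \<Lambda> (Suc k) v = view_of G' \<Lambda>' (Suc k) v"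
  shows "nbrs G v = nbrs G' v" "u \<in> set (nbrs G v) \<Longrightarrow> view_of G \<Lambda> k u = view_of G' \<Lambda>' k u"
proof -
  have eq: "map (\<lambda>u. (u, view_of G \<Lambda> k u)) (nbrs G v) = map (\<lambda>u. (u, view_of G' \<Lambda>' k u)) (nbrs G' v)"
    using assms by simp
  have "map fst (map (\<lambda>u. (u, view_of G \<Lambda> k u)) (nbrs G v)) = nbrs G v"
    "map fst (map (\<lambda>u. (u, view_of G' \<Lambda>' k u)) (nbrs G' v)) = nbrs G' v" by (simp_all add: o_def)
  then show nb: "nbrs G v = nbrs G' v" using eq by metis
  show "view_of G \<Lambda> k u = view_of G' \<Lambda>' k u" if "u \<in> set (nbrs G v)"
    using eq that unfolding nb[symmetric] by auto
qed

lemma view_nbh: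
  assumes "view_of G \<Lambda> (j + m) v = view_of G' \<Lambda>' (j + m) v" "w \<in> nbh G j v"
  shows "view_of G \<Lambda> m w = view_of G' \<Lambda>' m w \<and> w \<in> nbh G' j v"
  using assms
proof (induction j arbitrary: m w)
  case (Suc j)
  then obtain u where u: "u \<in> nbh G j v" "w = u \<or> w \<in> set (nbrs G u)" by (auto simp: nbh.simps(2))
  have "view_of G \<Lambda> (j + Suc m) v = view_of G' \<Lambda>' (j + Suc m) v"
    using Suc.prems(1) by (simp only: add_Suc add_Suc_right)
  then have view_u: "view_of G \<Lambda> (Suc m) u = view_of G' \<Lambda>' (Suc m) u" and uG': "u \<in> nbh G' j v"
    using Suc.IH u(1) by blast+
  have step: "view_of G \<Lambda> m u = view_of G' \<Lambda>' m u" using view_u by simp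
  note step = step view_nbrs[OF view_u]
  from u(2) show ?case
  proof
    assume "w = u"
    then show ?thesis using step(1) uG' unfolding nbh.simps(2) by blast
  next
    assume w: "w \<in> set (nbrs G u)"
    then have "w \<in> set (nbrs G' u)" using step(2) by simp
    then show ?thesis using step(3)[OF w] uG' unfolding nbh.simps(2) by blast
  qed
qed simp

lemma view_agr:
  assumes "view_of G \<Lambda> (Suc k) v = view_of G' \<Lambda>' (Suc k) v" "nbh G k v \<subseteq> verts G" "nbh G' k v \<subseteq> verts G'"
  shows "agr k G G' v \<and> (\<forall>w\<in>nbh G k v. \<Lambda> w = \<Lambda>' w)"
proof -
  have "view_of G \<Lambda> (Suc 0) w = view_of G' \<Lambda>' (Suc 0) w \<and> w \<in> nbh G' k v" if "w \<in> nbh G k v" for w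
    using view_nbh[of G \<Lambda> k "Suc 0" v G' \<Lambda>' w] assms(1) that by simp
  then show ?thesis using view_nbrs(1) view_root assms(2,3) unfolding agr_def by blast
qed

lemma card_lists_upto:
  assumes "finite A"
  shows "finite {l. set l \<subseteq> A \<and> length l \<le> n} \<and> card {l. set l \<subseteq> A \<and> length l \<le> n} \<le> (card A + 1) ^ n"
proof (induction n)
  case (Suc n)
  let ?F = "{l. set l \<subseteq> A \<and> length l \<le> n}"
  have sub: "{l. set l \<subseteq> A \<and> length l \<le> Suc n} \<subseteq> insert [] ((\<lambda>(x, l). x # l) ` (A \<times> ?F))"
  proof
    fix l assume "l \<in> {l. set l \<subseteq> A \<and> length l \<le> Suc n}"
    then show "l \<in> insert [] ((\<lambda>(x, l). x # l) ` (A \<times> ?F))" by (cases l) auto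
  qed
  have "card (insert [] ((\<lambda>(x, l). x # l) ` (A \<times> ?F))) \<le> Suc (card (A \<times> ?F))"
    using card_insert_le_m1[of "Suc (card (A \<times> ?F))"] card_image_le[of "A \<times> ?F" "\<lambda>(x, l). x # l"] Suc assms
    by simp
  also have "\<dots> = 1 + card A * card ?F" by (simp add: card_cartesian_product)
  also have "\<dots> \<le> (card A + 1) ^ n + card A * (card A + 1) ^ n"
    using Suc by (intro add_mono mult_left_mono) auto
  finally have "card (insert [] ((\<lambda>(x, l). x # l) ` (A \<times> ?F))) \<le> (card A + 1) ^ Suc n" by simp
  moreover have "finite (insert [] ((\<lambda>(x, l). x # l) ` (A \<times> ?F)))" using Suc assms by blast
  ultimately show ?case using sub by (meson card_mono finite_subset le_trans)
next
  case 0
  have "{l. set l \<subseteq> A \<and> length l \<le> 0} = {[]}" by auto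
  then show ?case by simp
qed

text \<open>A view one level deeper consists of one view and at most \<open>\<Delta>\<close> named
  views, and \<open>Q + 1 \<le> Q ^ 2\<close>; so each level raises the bound to the power
  \<open>2 * \<Delta> + 1\<close>. For constant depth the message length grows by a constant factor
  only.\<close>

lemma views_bound:
  assumes "finite names" "finite X" "card (names \<times> X) \<le> M" "2 \<le> M"
  shows "finite (views names \<Delta> X k) \<and> card (names \<times> views names \<Delta> X k) \<le> M ^ ((2 * \<Delta> + 1) ^ k)"
proof (induction k)
  case 0
  have "card (Leaf ` X) = card X" by (rule card_image) (auto simp: inj_on_def)
  then show ?case using assms by (simp add: card_cartesian_product)
next
  case (Suc k)
  let ?V = "views names \<Delta> X k"
  define Q where "Q = M ^ ((2 * \<Delta> + 1) ^ k)"
  have Q2: "2 \<le> Q" unfolding Q_def using assms(4) self_le_power[of M "(2 * \<Delta> + 1) ^ k"] by simp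
  let ?Ls = "{l. set l \<subseteq> names \<times> ?V \<and> length l \<le> \<Delta>}"
  have fin: "finite (names \<times> ?V)" using Suc assms by blast
  have Ls: "finite ?Ls" "card ?Ls \<le> (card (names \<times> ?V) + 1) ^ \<Delta>" using card_lists_upto[OF fin] by blast+
  have "card (names \<times> views names \<Delta> X (Suc k)) \<le> card names * card (?V \<times> ?Ls)"
    unfolding card_cartesian_product views.simps
    using card_image_le[of "?V \<times> ?Ls" "\<lambda>(a, l). Node a l"] Suc Ls by (simp add: card_cartesian_product)
  also have "\<dots> = card (names \<times> ?V) * card ?Ls" by (simp add: card_cartesian_product)
  also have "\<dots> \<le> Q * (Q + 1) ^ \<Delta>"
    using Suc Ls(2) power_mono[of "card (names \<times> ?V) + 1" "Q + 1" \<Delta>] unfolding Q_def[symmetric]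
    by (intro mult_mono) auto
  also have "\<dots> \<le> Q * (Q ^ 2) ^ \<Delta>"
  proof -
    have "Q + 1 \<le> Q * 2" using Q2 by simp
    also have "\<dots> \<le> Q ^ 2" using Q2 by (simp add: power2_eq_square)
    finally show ?thesis by (intro mult_left_mono power_mono) auto
  qed
  also have "\<dots> = M ^ ((2 * \<Delta> + 1) ^ Suc k)"
    by (simp add: Q_def power_mult[symmetric] power_add[symmetric] algebra_simps)
  finally show ?case using Suc Ls(1) by auto
qed

locale instances =
  fixes Inst :: "(pgraph \<times> 'a) set" and names :: "nat set" and N :: nat and ini :: "pgraph \<Rightarrow> 'a \<Rightarrow> nat \<Rightarrow> nat"
    and \<Delta> :: nat
  assumes Inst: "(G, a) \<in> Inst \<Longrightarrow> bgraph G \<Delta> \<and> verts G \<subseteq> names"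
    and fin_names: "finite names" and N_pos: "0 < N"
begin

abbreviation comp where "comp \<equiv> computes Inst names N ini"

lemma computes_round:
  assumes c: "comp t \<Lambda> X"
    and f: "\<And>G a v. (G, a) \<in> Inst \<Longrightarrow> v \<in> verts G \<Longrightarrow>
        \<Lambda>' G a v = f v (\<Lambda> G a v) (map (\<lambda>u. (u, \<Lambda> G a u)) (nbrs G v))"
    and Y: "\<And>G a v. (G, a) \<in> Inst \<Longrightarrow> v \<in> verts G \<Longrightarrow> \<Lambda>' G a v \<in> Y"
    and fin: "finite Y" "card (names \<times> Y) \<le> N"
  shows "comp (Suc t) \<Lambda>' Y"
proof -
  obtain prog e where p: "length prog = t" "\<And>f x ms. f \<in> set prog \<Longrightarrow> f x ms < N"
    "inj_on e (names \<times> X)" "e ` (names \<times> X) \<subseteq> {..<N}"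
    "\<And>G a v. (G, a) \<in> Inst \<Longrightarrow> v \<in> verts G \<Longrightarrow> run G prog (ini G a) v = e (v, \<Lambda> G a v)"
    and X: "\<And>G a v. (G, a) \<in> Inst \<Longrightarrow> v \<in> verts G \<Longrightarrow> \<Lambda> G a v \<in> X"
    using c unfolding computes_def by fast
  obtain e' where e': "inj_on e' (names \<times> Y)" "e' ` (names \<times> Y) \<subseteq> {..<N}"
    using ex_inj_on_card_le[of "names \<times> Y" N] fin fin_names by blast
  define dec where "dec = inv_into (names \<times> X) e"
  \<comment> \<open>Round functions must stay below \<open>N\<close> on all arguments, even on
    numbers that encode nothing; hence the default 0.\<close>
  define g where "g x ms = (let out = e' (fst (dec x), f (fst (dec x)) (snd (dec x)) (map dec ms))
    in if out < N then out else 0)" for x ms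
  have "run G (prog @ [g]) (ini G a) v = e' (v, \<Lambda>' G a v)" if Ga: "(G, a) \<in> Inst" and v: "v \<in> verts G" for G a v
  proof -
    interpret bgraph G \<Delta> using Inst Ga by blast
    have dec: "dec (run G prog (ini G a) u) = (u, \<Lambda> G a u)" if u: "u \<in> verts G" for u
      unfolding dec_def p(5)[OF Ga u] using p(3) X[OF Ga u] Inst[OF Ga] u by (intro inv_into_f_f) auto
    have m: "map dec (map (run G prog (ini G a)) (nbrs G v)) = map (\<lambda>u. (u, \<Lambda> G a u)) (nbrs G v)"
      using dec nbrs_verts[OF v] by simp
    have "e' (v, \<Lambda>' G a v) < N" using e'(2) Y[OF Ga v] Inst[OF Ga] v by blast
    then have lt: "e' (v, f v (\<Lambda> G a v) (map (\<lambda>u. (u, \<Lambda> G a u)) (nbrs G v))) < N"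
      unfolding f[OF Ga v] .
    show ?thesis
      unfolding run_snoc g_def Let_def dec[OF v] fst_conv snd_conv f[OF Ga v] m using lt by (simp only: if_True)
  qed
  moreover have "\<forall>f\<in>set (prog @ [g]). \<forall>x ms. f x ms < N" using p(2) N_pos by (auto simp: g_def Let_def)
  ultimately show ?thesis
    unfolding computes_def using p(1) e' Y
    by (intro conjI exI[of _ "prog @ [g]"] exI[of _ e']) auto
qed

lemma computes_view:
  assumes c: "comp t \<Lambda> X" and M: "finite X" "card (names \<times> X) \<le> M" "2 \<le> M"
    and N: "M ^ ((2 * \<Delta> + 1) ^ k) \<le> N"
  shows "comp (t + Suc k) (\<lambda>G a. view_of G (\<Lambda> G a) k) (views names \<Delta> X k)"
  using N
proof (induction k)
  case 0
  have "\<forall>G a v. (G, a) \<in> Inst \<longrightarrow> v \<in> verts G \<longrightarrow> \<Lambda> G a v \<in> X" using c unfolding computes_def by fast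
  moreover have "finite (views names \<Delta> X 0) \<and> card (names \<times> views names \<Delta> X 0) \<le> M ^ ((2 * \<Delta> + 1) ^ 0)"
    by (rule views_bound[OF fin_names M])
  ultimately have "comp (Suc t) (\<lambda>G a. view_of G (\<Lambda> G a) 0) (views names \<Delta> X 0)"
    using 0 by (intro computes_round[OF c, where f = "\<lambda>v l ms. Leaf l"]) auto
  then show ?case by (simp only: add_Suc_right add_0_right)
next
  case (Suc k)
  have pos: "0 < M" using M by simp
  have "M ^ ((2 * \<Delta> + 1) ^ k) \<le> M ^ ((2 * \<Delta> + 1) ^ Suc k)"
    using pos by (intro power_increasing) auto
  then have IH: "comp (t + Suc k) (\<lambda>G a. view_of G (\<Lambda> G a) k) (views names \<Delta> X k)" using Suc by simp
  then have mem: "view_of G (\<Lambda> G a) k v \<in> views names \<Delta> X k" if "(G, a) \<in> Inst" "v \<in> verts G" for G a v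
    using that unfolding computes_def by fast
  have "comp (Suc (t + Suc k)) (\<lambda>G a. view_of G (\<Lambda> G a) (Suc k)) (views names \<Delta> X (Suc k))"
  proof (rule computes_round[OF IH, where f = "\<lambda>v l ms. Node l ms"])
    show "view_of G (\<Lambda> G a) (Suc k) v \<in> views names \<Delta> X (Suc k)" if Ga: "(G, a) \<in> Inst" and v: "v \<in> verts G" for G a v
    proof -
      interpret bgraph G \<Delta> using Inst Ga by blast
      have "length (nbrs G v) \<le> \<Delta>" using deg v by (simp add: max_deg_le_def)
      then show ?thesis using mem[OF Ga] v nbrs_verts[OF v] Inst[OF Ga] by (auto simp: image_iff)
    qed
    show "finite (views names \<Delta> X (Suc k))" "card (names \<times> views names \<Delta> X (Suc k)) \<le> N"
      using views_bound[OF fin_names M, of \<Delta> "Suc k"] Suc.prems by auto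
  qed simp
  then show ?case by (simp only: add_Suc_right)
qed

text \<open>Locality makes the result a function of the view; the value is picked by
  \<open>SOME\<close> among all instances with that view. A view of depth \<open>Suc k\<close> takes
  \<open>k + 2\<close> rounds, and its evaluation takes one more.\<close>

lemma computes_local:
  assumes c: "comp t \<Lambda> X" and M: "finite X" "card (names \<times> X) \<le> M" "2 \<le> M"
    and N: "M ^ ((2 * \<Delta> + 1) ^ Suc k) \<le> N"
    and loc: "\<And>G a G' a' v. (G, a) \<in> Inst \<Longrightarrow> (G', a') \<in> Inst \<Longrightarrow> v \<in> verts G \<Longrightarrow> v \<in> verts G' \<Longrightarrow>
        agr k G G' v \<Longrightarrow> (\<And>w. w \<in> nbh G k v \<Longrightarrow> \<Lambda> G a w = \<Lambda> G' a' w) \<Longrightarrow> \<Lambda>' G a v = \<Lambda>' G' a' v"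
    and Y: "\<And>G a v. (G, a) \<in> Inst \<Longrightarrow> v \<in> verts G \<Longrightarrow> \<Lambda>' G a v \<in> Y"
    and fin: "finite Y" "card (names \<times> Y) \<le> N"
  shows "comp (t + (k + 3)) \<Lambda>' Y"
proof -
  define f where "f v l = (SOME y. \<exists>G a. (G, a) \<in> Inst \<and> v \<in> verts G \<and> view_of G (\<Lambda> G a) (Suc k) v = l \<and> \<Lambda>' G a v = y)" for v l
  have f: "f v (view_of G (\<Lambda> G a) (Suc k) v) = \<Lambda>' G a v" if Ga: "(G, a) \<in> Inst" and v: "v \<in> verts G" for G a v
  proof -
    let ?P = "\<lambda>y. \<exists>G' a'. (G', a') \<in> Inst \<and> v \<in> verts G' \<and> view_of G' (\<Lambda> G' a') (Suc k) v = view_of G (\<Lambda> G a) (Suc k) v \<and> \<Lambda>' G' a' v = y"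
    have "?P (f v (view_of G (\<Lambda> G a) (Suc k) v))" unfolding f_def by (rule someI[of ?P "\<Lambda>' G a v"]) (use Ga v in blast)
    then obtain G' a' where G': "(G', a') \<in> Inst" "v \<in> verts G'"
      "view_of G' (\<Lambda> G' a') (Suc k) v = view_of G (\<Lambda> G a) (Suc k) v" "\<Lambda>' G' a' v = f v (view_of G (\<Lambda> G a) (Suc k) v)" by blast
    have sub: "nbh G k v \<subseteq> verts G" "nbh G' k v \<subseteq> verts G'"
      using bgraph.nbh_verts Inst[OF Ga] Inst[OF G'(1)] v G'(2) by blast+
    have "\<Lambda>' G a v = \<Lambda>' G' a' v"
      using view_agr[OF G'(3)[symmetric] sub] by (intro loc[OF Ga G'(1) v G'(2)]) auto
    then show ?thesis using G'(4) by simp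
  qed
  have "comp (Suc (t + Suc (Suc k))) \<Lambda>' Y"
    by (rule computes_round[OF computes_view[OF c M N], where f = "\<lambda>v l ms. f v l"]) (use f Y fin in auto)
  then show ?thesis by (simp add: numeral_3_eq_3)
qed

text \<open>After each iteration the view is collapsed into a label from \<open>X\<close> again, so
  \<open>N\<close> does not grow with the number of iterations.\<close>

lemma computes_iterate:
  assumes c: "comp t (\<Lambda> 0) X" and M: "finite X" "card (names \<times> X) \<le> M" "2 \<le> M"
    and N: "M ^ ((2 * \<Delta> + 1) ^ Suc k) \<le> N"
    and loc: "\<And>j G a G' a' v. j < n \<Longrightarrow> (G, a) \<in> Inst \<Longrightarrow> (G', a') \<in> Inst \<Longrightarrow> v \<in> verts G \<Longrightarrow> v \<in> verts G' \<Longrightarrow>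
        agr k G G' v \<Longrightarrow> (\<And>w. w \<in> nbh G k v \<Longrightarrow> \<Lambda> j G a w = \<Lambda> j G' a' w) \<Longrightarrow> \<Lambda> (Suc j) G a v = \<Lambda> (Suc j) G' a' v"
    and X: "\<And>j G a v. j < n \<Longrightarrow> (G, a) \<in> Inst \<Longrightarrow> v \<in> verts G \<Longrightarrow> \<Lambda> (Suc j) G a v \<in> X"
  shows "comp (t + n * (k + 3)) (\<Lambda> n) X"
proof -
  have "M \<le> M ^ ((2 * \<Delta> + 1) ^ Suc k)" using M(3) by (intro self_le_power) auto
  then have XN: "card (names \<times> X) \<le> N" using M(2) N by linarith
  have "i \<le> n \<Longrightarrow> comp (t + i * (k + 3)) (\<Lambda> i) X" for i
  proof (induction i)
    case (Suc i)
    then have IH: "comp (t + i * (k + 3)) (\<Lambda> i) X" by simp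
    have "comp (t + i * (k + 3) + (k + 3)) (\<Lambda> (Suc i)) X"
      by (rule computes_local[OF IH M N]) (use Suc.prems loc X M(1) XN in auto)
    then show ?case by (simp add: algebra_simps)
  qed (use c in simp)
  then show ?thesis by blast
qed

end

section \<open>Programs as message passing algorithms\<close>

text \<open>The state pairs the current label with a round counter, as \<open>a_recv\<close> is not
  told the round. Unary coding is affordable because only messages are bounded in length.\<close>

definition enc_state :: "nat \<times> nat \<Rightarrow> bool list" where
  "enc_state x = replicate (to_nat x) True"

definition dec_state :: "bool list \<Rightarrow> nat \<times> nat" where
  "dec_state bs = from_nat (length bs)"

definition enc_msg :: "nat \<Rightarrow> nat \<Rightarrow> bool list" where
  "enc_msg w x = map (bit x) [0..<w]"

definition dec_msg :: "bool list \<Rightarrow> nat" where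
  "dec_msg bs = horner_sum of_bool 2 bs"

lemma dec_enc_state [simp]: "dec_state (enc_state x) = x"
  by (simp add: dec_state_def enc_state_def)

lemma dec_enc_msg: "x < 2 ^ w \<Longrightarrow> dec_msg (enc_msg w x) = x"
  by (simp add: dec_msg_def enc_msg_def horner_sum_bit_eq_take_bit take_bit_nat_eq_self)

definition mk_alg ::
  "(nat \<Rightarrow> (nat \<Rightarrow> nat list \<Rightarrow> nat) list) \<Rightarrow> (nat \<Rightarrow> nat) \<Rightarrow> (nat \<Rightarrow> 'i list \<Rightarrow> bool list \<Rightarrow> nat) \<Rightarrow>
   (nat \<Rightarrow> nat \<Rightarrow> nat \<Rightarrow> 'o) \<Rightarrow> (nat \<Rightarrow> nat) \<Rightarrow> (bool list, bool list, 'i, 'o) dalg" where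
  "mk_alg prog w i0 outp hb =
     \<lparr>a_init = \<lambda>n il bs. enc_state (0, i0 n il bs),
      a_send = \<lambda>n st j. enc_msg (w n) (snd (dec_state st)),
      a_recv = \<lambda>n st ms. enc_state (Suc (fst (dec_state st)), (prog n ! fst (dec_state st)) (snd (dec_state st)) (map dec_msg ms)),
      a_out = \<lambda>n st j. outp n (snd (dec_state st)) j,
      a_rounds = \<lambda>n. length (prog n),
      a_bits = hb\<rparr>"

lemma exec_mk_alg:
  assumes "\<And>il bs. i0 n il bs < 2 ^ w n" "\<And>f x ms. f \<in> set (prog n) \<Longrightarrow> f x ms < 2 ^ w n" "k \<le> length (prog n)"
  shows "exec (mk_alg prog w i0 outp hb) n G inp rb k v =
     enc_state (k, run G (take k (prog n)) (\<lambda>v. i0 n (map (inp v) (nbrs G v)) (rb v)) v)"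
  using assms(3)
proof (induction k arbitrary: v)
  case 0
  then show ?case by (simp add: mk_alg_def)
next
  case (Suc k)
  let ?R = "run G (take k (prog n)) (\<lambda>v. i0 n (map (inp v) (nbrs G v)) (rb v))"
  \<comment> \<open>Labels that fit into \<open>w n\<close> bits survive the transport in
    messages.\<close>
  have small: "?R u < 2 ^ w n" for u
  proof (cases k)
    case (Suc j)
    then have "take k (prog n) = take j (prog n) @ [prog n ! j]" using Suc.prems by (simp add: take_Suc_conv_app_nth)
    then show ?thesis using assms(2)[of "prog n ! j"] Suc.prems Suc by (simp add: run_append)
  qed (simp add: assms(1))
  have IH: "exec (mk_alg prog w i0 outp hb) n G inp rb k u = enc_state (k, ?R u)" for u
    using Suc by simp
  have "take (Suc k) (prog n) = take k (prog n) @ [prog n ! k]" using Suc.prems by (simp add: take_Suc_conv_app_nth)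
  then have "run G (take (Suc k) (prog n)) (\<lambda>v. i0 n (map (inp v) (nbrs G v)) (rb v)) v = (prog n ! k) (?R v) (map ?R (nbrs G v))"
    by (simp add: run_append)
  then show ?case
    unfolding exec.simps IH by (simp add: mk_alg_def dec_enc_msg[OF small] o_def)
qed

lemma alg_output_mk_alg:
  assumes "\<And>il bs. i0 n il bs < 2 ^ w n" "\<And>f x ms. f \<in> set (prog n) \<Longrightarrow> f x ms < 2 ^ w n"
  shows "alg_output (mk_alg prog w i0 outp hb) n G inp rb x y =
     outp n (run G (prog n) (\<lambda>v. i0 n (map (inp v) (nbrs G v)) (rb v)) x) (port_of G x y)"
proof -
  have r: "a_rounds (mk_alg prog w i0 outp hb) n = length (prog n)" by (simp add: mk_alg_def)
  have o: "a_out (mk_alg prog w i0 outp hb) n (enc_state (t, l)) j = outp n l j" for t l j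
    by (simp add: mk_alg_def)
  show ?thesis unfolding alg_output_def r
    by (subst exec_mk_alg) (use assms in \<open>simp_all add: o\<close>)
qed

lemma congest_mk_alg:
  assumes "\<And>n. 2 \<le> n \<Longrightarrow> real (w n) \<le> C * ln (real n)"
  shows "congest (mk_alg prog w i0 outp hb)"
  unfolding congest_def using assms by (intro exI[of _ C]) (simp add: mk_alg_def enc_msg_def)

section \<open>Failure events of a message passing algorithm\<close>

definition rbits :: "nat \<Rightarrow> (nat \<times> nat) set \<Rightarrow> nat \<Rightarrow> bool list" where
  "rbits h B u = map (\<lambda>i. (u, i) \<in> B) [0..<h]"

definition out_list where
  "out_list A n G inp B x = map (alg_output A n G inp (rbits (a_bits A n) B) x) (nbrs G x)"

text \<open>Outputs are kept as lists ordered by port, so that they can be compared across graphs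
  and renamings.\<close>

definition good_at :: "('i, 'o) lcl \<Rightarrow> pgraph \<Rightarrow> (nat \<Rightarrow> nat \<Rightarrow> 'i) \<Rightarrow> nat \<Rightarrow> (nat \<Rightarrow> 'o list) \<Rightarrow> bool" where
  "good_at P G inp v f \<longleftrightarrow> (\<exists>H\<in>constraints P. ball_iso G inp (\<lambda>x y. f x ! port_of G x y) (radius P) v H)"

definition fails where
  "fails P A n G inp v B \<longleftrightarrow> \<not> good_at P G inp v (out_list A n G inp B)"

definition sim :: "nat \<Rightarrow> pgraph \<Rightarrow> (nat \<Rightarrow> nat \<Rightarrow> 'i) \<Rightarrow> pgraph \<Rightarrow> (nat \<Rightarrow> nat \<Rightarrow> 'i) \<Rightarrow> nat \<Rightarrow> bool" where
  "sim k G inp G' inp' v \<longleftrightarrow> agr k G G' v \<and> (\<forall>x\<in>nbh G k v. \<forall>y\<in>set (nbrs G x). inp x y = inp' x y)"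

definition eqon :: "nat set \<Rightarrow> (nat \<times> nat) set \<Rightarrow> (nat \<times> nat) set \<Rightarrow> bool" where
  "eqon W S S' \<longleftrightarrow> (\<forall>w\<in>W. \<forall>i. (w, i) \<in> S \<longleftrightarrow> (w, i) \<in> S')"

lemma sim_agr: "sim k G inp G' inp' v \<Longrightarrow> agr k G G' v"
  by (simp add: sim_def)

lemma sim_sub: "sim k G inp G' inp' v \<Longrightarrow> w \<in> nbh G i v \<Longrightarrow> i + j \<le> k \<Longrightarrow> sim j G inp G' inp' w"
  using agr_sub[of k G G' v w i j] nbh_trans_le[of w G i v _ j k] unfolding sim_def by blast

lemma sim_mono: "sim k G inp G' inp' v \<Longrightarrow> j \<le> k \<Longrightarrow> sim j G inp G' inp' v"
  using sim_sub[of k G inp G' inp' v v 0 j] by simp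

lemma eqon_mono: "eqon W S S' \<Longrightarrow> W' \<subseteq> W \<Longrightarrow> eqon W' S S'"
  unfolding eqon_def by blast

lemma eqon_Int: "eqon W S S' \<Longrightarrow> S \<inter> (W \<times> V) = S' \<inter> (W \<times> V)"
  unfolding eqon_def by blast

lemma agr_nbrs: "agr k G G' v \<Longrightarrow> w \<in> nbh G k v \<Longrightarrow> nbrs G' w = nbrs G w"
  unfolding agr_def by simp

lemma port_of_nth:
  assumes "distinct (nbrs G x)" "y \<in> set (nbrs G x)"
  shows "port_of G x y < length (nbrs G x) \<and> nbrs G x ! port_of G x y = y"
proof -
  have "\<exists>!j. j < length (nbrs G x) \<and> nbrs G x ! j = y"
    using assms by (metis distinct_Ex1)
  then show ?thesis unfolding port_of_def by (rule theI')
qed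

lemma out_list_nth:
  assumes "distinct (nbrs G x)" "y \<in> set (nbrs G x)"
  shows "out_list A n G inp B x ! port_of G x y = alg_output A n G inp (rbits (a_bits A n) B) x y"
  using port_of_nth[OF assms] by (simp add: out_list_def)

lemma rbits_cong: "(\<And>i. i < h \<Longrightarrow> (x, i) \<in> B \<longleftrightarrow> (x, i) \<in> B') \<Longrightarrow> rbits h B x = rbits h B' x"
  by (simp add: rbits_def)

lemma out_list_sim:
  assumes "sim (a_rounds A n) G inp G' inp' x"
    and "B \<inter> (nbh G (a_rounds A n) x \<times> {..<a_bits A n}) = B' \<inter> (nbh G (a_rounds A n) x \<times> {..<a_bits A n})"
  shows "out_list A n G inp B x = out_list A n G' inp' B' x"
proof -
  have nb: "nbrs G' x = nbrs G x" using agr_nbrs[OF sim_agr[OF assms(1)] nbh_refl] .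
  have "exec A n G inp (rbits (a_bits A n) B) (a_rounds A n) x = exec A n G' inp' (rbits (a_bits A n) B') (a_rounds A n) x"
  proof (rule exec_cong)
    show "rbits (a_bits A n) B y = rbits (a_bits A n) B' y" if "y \<in> nbh G (a_rounds A n) x" for y
      by (rule rbits_cong) (use assms(2) that in blast)
  qed (use assms(1) in \<open>simp_all add: sim_def agr_def\<close>)
  then have "alg_output A n G inp (rbits (a_bits A n) B) x = alg_output A n G' inp' (rbits (a_bits A n) B') x"
    unfolding alg_output_def port_of_def nb by simp
  then show ?thesis unfolding out_list_def nb by simp
qed

lemma length_out_list [simp]: "length (out_list A n G inp B x) = length (nbrs G x)"
  by (simp add: out_list_def)

lemma good_at_sim:
  assumes G: "bgraph G \<Delta>" "bgraph G' \<Delta>'" and v: "v \<in> verts G" "v \<in> verts G'"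
    and sim: "sim (radius P) G inp G' inp' v"
    and f: "\<And>x. x \<in> nbh G (radius P) v \<Longrightarrow> f x = f' x"
  shows "good_at P G inp v f \<longleftrightarrow> good_at P G' inp' v f'"
proof -
  note agr = sim_agr[OF sim]
  have ball: "in_ball G (radius P) v w \<longleftrightarrow> w \<in> nbh G (radius P) v"
    "in_ball G' (radius P) v w \<longleftrightarrow> w \<in> nbh G (radius P) v" for w
    using bgraph.in_ball_nbh[OF G(1) v(1)] bgraph.in_ball_nbh[OF G(2) v(2)] agr_nbh[OF agr, of "radius P"] by simp_all
  have adj: "adj G x y \<longleftrightarrow> adj G' x y" "port_of G x y = port_of G' x y" if "x \<in> nbh G (radius P) v" for x y
    using agr that unfolding agr_def adj_def port_of_def by auto
  have inp: "inp x y = inp' x y" if "x \<in> nbh G (radius P) v" "adj G x y" for x y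
    using sim that unfolding sim_def adj_def by blast
  have "ball_iso G inp (\<lambda>x y. f x ! port_of G x y) (radius P) v H \<longleftrightarrow>
        ball_iso G' inp' (\<lambda>x y. f' x ! port_of G' x y) (radius P) v H" for H
    by (intro ball_iso_cong) (simp_all add: ball inp f adj)
  then show ?thesis by (simp add: good_at_def)
qed

lemma fails_sim:
  assumes G: "bgraph G \<Delta>" "bgraph G' \<Delta>'" and v: "v \<in> verts G" "v \<in> verts G'"
    and sim: "sim (radius P + a_rounds A n) G inp G' inp' v"
    and B: "B \<inter> (nbh G (radius P + a_rounds A n) v \<times> {..<a_bits A n})
      = B' \<inter> (nbh G (radius P + a_rounds A n) v \<times> {..<a_bits A n})"
  shows "fails P A n G inp v B \<longleftrightarrow> fails P A n G' inp' v B'"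
proof -
  have "out_list A n G inp B x = out_list A n G' inp' B' x" if x: "x \<in> nbh G (radius P) v" for x
  proof (rule out_list_sim)
    show "sim (a_rounds A n) G inp G' inp' x" by (rule sim_sub[OF sim x]) simp
    have "nbh G (a_rounds A n) x \<subseteq> nbh G (radius P + a_rounds A n) v" using nbh_trans[OF x] by blast
    then show "B \<inter> (nbh G (a_rounds A n) x \<times> {..<a_bits A n}) = B' \<inter> (nbh G (a_rounds A n) x \<times> {..<a_bits A n})"
      using B by blast
  qed
  then show ?thesis
    unfolding fails_def using good_at_sim[OF G v sim_mono[OF sim le_add1]] by blast
qed

lemma sim_self [simp]: "sim k G inp G inp v"
  by (simp add: sim_def agr_def)

lemma fails_depends:
  assumes "bgraph G \<Delta>" "v \<in> verts G" "radius P + a_rounds A n \<le> s"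
  shows "depends (blk G s (a_bits A n) v) (fails P A n G inp v)"
  unfolding depends_def
proof (intro allI impI)
  fix B B' assume eq: "B \<inter> blk G s (a_bits A n) v = B' \<inter> blk G s (a_bits A n) v"
  have "nbh G (radius P + a_rounds A n) v \<subseteq> nbh G s v" using assms(3) by (rule nbh_mono)
  then show "fails P A n G inp v B = fails P A n G inp v B'"
    using eq by (intro fails_sim[OF assms(1,1,2,2)]) (auto simp: blk_def)
qed

lemma bij_rbits:
  fixes V :: "nat set"
  shows "bij_betw (\<lambda>B. restrict (rbits h B) V) (Pow (V \<times> {..<h})) (PiE V (\<lambda>_. {bs. length bs = h}))"
proof (rule bij_betwI[where g = "\<lambda>rb :: nat \<Rightarrow> bool list. {(u, i). u \<in> V \<and> i < h \<and> rb u ! i}"])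
  fix rb :: "nat \<Rightarrow> bool list" assume rb: "rb \<in> PiE V (\<lambda>_. {bs. length bs = h})"
  show "restrict (rbits h {(u, i). u \<in> V \<and> i < h \<and> rb u ! i}) V = rb"
  proof
    fix u
    show "restrict (rbits h {(u, i). u \<in> V \<and> i < h \<and> rb u ! i}) V u = rb u"
      using rb by (cases "u \<in> V") (auto simp: rbits_def PiE_iff extensional_def intro!: nth_equalityI)
  qed
qed (auto simp: rbits_def)

lemma avg_indicator:
  "finite X \<Longrightarrow> avg X (\<lambda>B. of_bool (Q B)) {} = card {B \<in> Pow X. Q B} / 2 ^ card X"
  by (simp add: avg_def sum.If_cases of_bool_def Int_def)

lemma card_rand_space: "finite (verts G) \<Longrightarrow> card (rand_space G h) = 2 ^ (card (verts G \<times> {..<h}))"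
  using bij_betw_same_card[OF bij_rbits[of h "verts G"]] by (simp add: rand_space_def card_Pow)

text \<open>A violation at one node is a failure of the whole output; the rest translates between
  bit sets and random strings.\<close>

lemma local_failure:
  assumes G: "bgraph G \<Delta>" and v: "v \<in> verts G" and fp: "fail_prob A P n G inp \<le> \<epsilon>"
  shows "avg (verts G \<times> {..<a_bits A n}) (\<lambda>B. of_bool (fails P A n G inp v B)) {} \<le> \<epsilon>"
proof -
  interpret bgraph G \<Delta> by (rule G)
  let ?h = "a_bits A n" and ?R = "rand_space G (a_bits A n)"
  let ?X = "verts G \<times> {..<?h}"
  let ?rb = "\<lambda>B. restrict (rbits ?h B) (verts G)"
  have bij: "bij_betw ?rb (Pow ?X) ?R" unfolding rand_space_def by (rule bij_rbits)
  have notsolved: "\<not> lcl_solved P G inp (alg_output A n G inp (?rb B))" if "fails P A n G inp v B" for B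
  proof
    assume "lcl_solved P G inp (alg_output A n G inp (?rb B))"
    then obtain H where H: "H \<in> constraints P" "ball_iso G inp (alg_output A n G inp (?rb B)) (radius P) v H"
      using v by (auto simp: lcl_solved_def)
    have eq: "alg_output A n G inp (?rb B) x y = out_list A n G inp B x ! port_of G x y" if xy: "adj G x y" for x y
    proof -
      have x: "x \<in> verts G" "y \<in> set (nbrs G x)" using xy by (auto simp: adj_def)
      have "exec A n G inp (?rb B) (a_rounds A n) x = exec A n G inp (rbits ?h B) (a_rounds A n) x"
        using nbh_verts[OF x(1)] by (intro exec_cong) auto
      then show ?thesis unfolding out_list_nth[OF nbrs_distinct[OF x(1)] x(2)] by (simp add: alg_output_def)
    qed
    have "ball_iso G inp (\<lambda>x y. out_list A n G inp B x ! port_of G x y) (radius P) v H"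
      using H(2) by (subst ball_iso_cong[where G' = G and inp' = inp and outp' = "alg_output A n G inp (?rb B)"]) (auto simp: eq)
    then show False using that H(1) by (auto simp: fails_def good_at_def)
  qed
  have finR: "finite ?R" unfolding rand_space_def using bij bij_betw_finite[OF bij] by (simp add: rand_space_def)
  have "card {B \<in> Pow ?X. fails P A n G inp v B} = card (?rb ` {B \<in> Pow ?X. fails P A n G inp v B})"
    using bij by (intro card_image[symmetric]) (auto simp: bij_betw_def intro: inj_on_subset)
  also have "\<dots> \<le> card {rb \<in> ?R. \<not> lcl_solved P G inp (alg_output A n G inp rb)}"
    using notsolved bij finR by (intro card_mono) (auto simp: bij_betw_def)
  finally have "real (card {B \<in> Pow ?X. fails P A n G inp v B}) / 2 ^ card ?X \<le> fail_prob A P n G inp"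
    unfolding fail_prob_def by (simp add: card_rand_space divide_right_mono)
  then show ?thesis using fp by (simp add: avg_indicator)
qed

section \<open>Balls as trees of bounded size\<close>

definition ball_graph :: "pgraph \<Rightarrow> nat \<Rightarrow> nat \<Rightarrow> pgraph" where
  "ball_graph G k v = \<lparr>verts = nbh G k v, nbrs = \<lambda>x. filter (\<lambda>y. y \<in> nbh G k v) (nbrs G x)\<rparr>"

lemma ball_graph_simps [simp]:
  "verts (ball_graph G k v) = nbh G k v"
  "nbrs (ball_graph G k v) x = filter (\<lambda>y. y \<in> nbh G k v) (nbrs G x)"
  by (simp_all add: ball_graph_def)

lemma (in bgraph) ball_graph_tree:
  assumes acyclic: "\<not> (\<exists>cs. is_cycle G cs)" and v: "v \<in> verts G"
  shows "is_tree (ball_graph G k v)" "bgraph (ball_graph G k v) \<Delta>"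
proof -
  let ?H = "ball_graph G k v"
  have sub: "nbh G k v \<subseteq> verts G" by (rule nbh_verts[OF v])
  have wfH: "wf_pgraph ?H"
    unfolding wf_pgraph_def
  proof (intro conjI ballI)
    show "verts ?H \<noteq> {}" using nbh_refl[of v G k] by (metis ball_graph_simps(1) empty_iff)
    fix x assume "x \<in> verts ?H"
    then have x: "x \<in> nbh G k v" "x \<in> verts G" using sub by auto
    show "distinct (nbrs ?H x)" "x \<notin> set (nbrs ?H x)" using nbrs_distinct[OF x(2)] nbrs_irrefl[OF x(2)] by simp_all
    show "set (nbrs ?H x) \<subseteq> verts ?H" by auto
    show "x \<in> set (nbrs ?H u)" if "u \<in> set (nbrs ?H x)" for u
      using nbrs_sym[OF x(2), of u] x(1) that by simp
  qed simp
  have degH: "max_deg_le ?H \<Delta>"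
    unfolding max_deg_le_def using deg sub
    by (auto simp: max_deg_le_def intro: order_trans[OF length_filter_le])
  show "bgraph ?H \<Delta>" using wfH degH by unfold_locales
  have reach: "(adj ?H)\<^sup>*\<^sup>* v w \<and> (adj ?H)\<^sup>*\<^sup>* w v" if "w \<in> nbh G k v" for w
  proof -
    obtain j f where f: "j \<le> k" "f 0 = v" "f j = w" "\<forall>i<j. f (Suc i) \<in> set (nbrs G (f i))"
      using nbh_path[OF \<open>w \<in> nbh G k v\<close>] by blast
    have mem: "f i \<in> nbh G k v" if "i \<le> j" for i
    proof -
      have "f i \<in> nbh G i (f 0)" by (rule path_nbh) (use f that in auto)
      then show ?thesis using f that nbh_mono[of i k G v] by auto
    qed
    have "i \<le> j \<Longrightarrow> (adj ?H)\<^sup>*\<^sup>* v (f i) \<and> (adj ?H)\<^sup>*\<^sup>* (f i) v" for i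
    proof (induction i)
      case (Suc i)
      have m: "f i \<in> nbh G k v" "f (Suc i) \<in> nbh G k v" "f (Suc i) \<in> set (nbrs G (f i))" using mem f Suc by auto
      have "adj ?H (f i) (f (Suc i))" "adj ?H (f (Suc i)) (f i)"
        using m nbrs_sym[of "f i" "f (Suc i)"] sub by (auto simp: adj_def)
      then show ?case using Suc by (meson Suc_leD converse_rtranclp_into_rtranclp rtranclp.rtrancl_into_rtrancl)
    qed (use f in simp)
    then show ?thesis using f by blast
  qed
  have "connected_pg ?H"
    unfolding connected_pg_def using reach by (auto intro: rtranclp_trans)
  moreover have "\<not> is_cycle ?H cs" for cs
  proof
    assume "is_cycle ?H cs"
    then have "is_cycle G cs" using sub unfolding is_cycle_def by (auto simp: adj_def)
    then show False using acyclic by blast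
  qed
  ultimately show "is_tree ?H" using wfH by (simp add: is_tree_def)
qed

text \<open>The guarantee is applied to the ball of radius \<open>Suc s\<close> as a tree of its
  own. The outermost layer keeps the neighbour lists of all nodes within distance \<open>s\<close>
  complete, so the event at \<open>v\<close> is the same in both graphs.\<close>

lemma (in bgraph) failure_in_ball:
  assumes acyclic: "\<not> (\<exists>cs. is_cycle G cs)" and v: "v \<in> verts G"
    and sol: "solves_on_trees A P \<Delta> (\<lambda>n. 1 / real n)" and s: "radius P + a_rounds A n \<le> s" and n: "(\<Delta> + 2) ^ Suc s \<le> n"
  shows "avg (blk G s (a_bits A n) v) (\<lambda>B. of_bool (fails P A n G inp v B)) B0 \<le> 1 / real n"
proof -
  let ?H = "ball_graph G (Suc s) v" and ?h = "a_bits A n"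
  let ?X = "nbh G (Suc s) v \<times> {..<?h}"
  have H: "is_tree ?H" "bgraph ?H \<Delta>" using ball_graph_tree[OF acyclic v] by blast+
  have "1 \<le> n" using n one_le_power[of "\<Delta> + 2" "Suc s"] by linarith
  moreover have "card (verts ?H) \<le> n" using card_nbh[OF v, of "Suc s"] n by simp
  ultimately have fp: "fail_prob A P n ?H inp \<le> 1 / real n"
    using sol H unfolding solves_on_trees_def bgraph_def by blast
  have agr: "agr s G ?H v"
    unfolding agr_def
  proof (intro ballI conjI)
    fix w assume w: "w \<in> nbh G s v"
    then show "nbrs G w = nbrs ?H w" using nbh_step[OF w] by (simp add: filter_id_conv[THEN iffD2])
    have "w \<in> nbh G (Suc s) v" using w nbh_mono[of s "Suc s"] by auto
    then show "(w \<in> verts G) = (w \<in> verts ?H)" using nbh_verts[OF v] by auto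
  qed
  have simH: "sim (radius P + a_rounds A n) G inp ?H inp v"
    using agr_mono[OF agr s] by (simp add: sim_def)
  have eq: "fails P A n G inp v = fails P A n ?H inp v"
  proof
    show "fails P A n G inp v B = fails P A n ?H inp v B" for B
      by (rule fails_sim[OF bgraph_axioms H(2) v _ simH refl]) simp
  qed
  have dep: "depends (blk G s ?h v) (\<lambda>B. of_bool (fails P A n G inp v B) :: real)"
    by (rule depends_comp[OF fails_depends[OF bgraph_axioms v s]])
  have "avg (blk G s ?h v) (\<lambda>B. of_bool (fails P A n G inp v B)) B0
      = avg (blk G s ?h v) (\<lambda>B. of_bool (fails P A n G inp v B)) {}"
    by (rule dependsD[OF depends_avg[OF dep]]) simp
  also have "\<dots> = avg ?X (\<lambda>B. of_bool (fails P A n G inp v B)) {}"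
  proof -
    have "?X \<inter> blk G s ?h v = blk G s ?h v"
      using nbh_mono[of s "Suc s" G v] by (auto simp: blk_def)
    then show ?thesis using avg_Int[OF _ dep, of ?X "{}"] by simp
  qed
  also have "\<dots> \<le> 1 / real n"
    using local_failure[OF H(2) _ fp, of v] eq by simp
  finally show ?thesis .
qed

section \<open>Locality of the phases\<close>

lemma recolour_local:
  assumes "agr d G G' v" "\<And>w. w \<in> nbh G d v \<Longrightarrow> c w = c' w"
  shows "recolour G d L D c v = recolour G' d L D c' v"
proof -
  have nb: "nbh G' d v = nbh G d v" using agr_nbh[OF assms(1)] by simp
  have "signature G d c v = signature G' d c' v"
    unfolding signature_def nb using assms(2) nbh_refl by (intro image_cong) auto
  then show ?thesis by (simp add: recolour_def)
qed

lemma risk_local: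
  assumes "agr s G G' v" "E v = E' v" "depends (blk G s h v) (E v)" "eqon (nbh G s v) S S'" "eqon (nbh G s v) B B'"
  shows "risk G s h E S B v = risk G' s h E' S' B' v"
proof -
  have nb: "blk G' s h v = blk G s h v" using agr_nbh[OF assms(1), of s] by (simp add: blk_def)
  have U: "blk G s h v - S = blk G s h v - S'" using assms(4) by (auto simp: eqon_def blk_def)
  have "B \<inter> (blk G s h v - (blk G s h v - S)) = B' \<inter> (blk G s h v - (blk G s h v - S))"
    using assms(5) by (auto simp: eqon_def blk_def)
  then show ?thesis unfolding risk_def nb U[symmetric] assms(2)[symmetric]
    by (rule dependsD[OF depends_avg[OF depends_comp[OF assms(3)]]])
qed

lemma presampled_local:
  assumes "agr (2 * s) G G' u" "\<And>v. v \<in> nbh G s u \<Longrightarrow> E v = E' v \<and> depends (blk G s h v) (E v)"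
    and "eqon (nbh G (2 * s) u) (presampled G s h E \<theta> col B j) (presampled G' s h E' \<theta> col' B' j)"
    and "eqon (nbh G (2 * s) u) B B'" "col u = col' u"
  shows "(u, i) \<in> presampled G s h E \<theta> col B (Suc j) \<longleftrightarrow> (u, i) \<in> presampled G' s h E' \<theta> col' B' (Suc j)"
proof -
  have nb: "nbh G' s u = nbh G s u" using agr_nbh[OF assms(1), of s] by simp
  have "risk G s h E (presampled G s h E \<theta> col B j) B v = risk G' s h E' (presampled G' s h E' \<theta> col' B' j) B' v"
    if v: "v \<in> nbh G s u" for v
  proof (rule risk_local)
    have "nbh G s v \<subseteq> nbh G (2 * s) u" using nbh_trans_le[OF v] by auto
    then show "eqon (nbh G s v) (presampled G s h E \<theta> col B j) (presampled G' s h E' \<theta> col' B' j)" "eqon (nbh G s v) B B'"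
      using assms(3,4) eqon_mono by blast+
    show "agr s G G' v" by (rule agr_sub[OF assms(1) v]) simp
  qed (use assms(2)[OF v] in auto)
  moreover have "u \<in> nbh G (2 * s) u" "u \<in> verts G \<longleftrightarrow> u \<in> verts G'" using assms(1) unfolding agr_def by auto
  ultimately show ?thesis using assms(3,5) nb by (auto simp: sampled_def eqon_def)
qed

lemma aball_local:
  assumes "agr d G G' u" "\<And>w. w \<in> nbh G d u \<Longrightarrow> w \<in> A \<longleftrightarrow> w \<in> A'" "k \<le> d"
  shows "aball G A k u = aball G' A' k u"
  using assms(3)
proof (induction k)
  case (Suc k)
  have "insert x (set (nbrs G x) \<inter> A) = insert x (set (nbrs G' x) \<inter> A')" if "x \<in> aball G A k u" for x
  proof -
    have x: "x \<in> nbh G k u" using that aball_nbh by blast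
    then have "nbrs G' x = nbrs G x" using agr_nbrs[OF assms(1)] nbh_mono[of k d] Suc.prems by auto
    moreover have "y \<in> A \<longleftrightarrow> y \<in> A'" if "y \<in> set (nbrs G x)" for y
      using nbh_step[OF x that] nbh_mono[of "Suc k" d] Suc.prems assms(2) by blast
    ultimately show ?thesis by auto
  qed
  then show ?case using Suc by simp
qed simp

lemma removable_local:
  assumes "agr (Suc d) G G' u" "\<And>w. w \<in> nbh G (Suc d) u \<Longrightarrow> w \<in> A \<longleftrightarrow> w \<in> A'" "col u = col' u"
  shows "u \<in> removable G d K col A i \<longleftrightarrow> u \<in> removable G' d K col' A' i" "chain_mid G d A u \<longleftrightarrow> chain_mid G' d A' u"
proof -
  have deg: "adeg G A w = adeg G' A' w" if w: "w \<in> nbh G d u" for w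
  proof -
    have "nbrs G' w = nbrs G w" using agr_nbrs[OF assms(1)] w nbh_mono[of d "Suc d"] by auto
    moreover have "y \<in> A \<longleftrightarrow> y \<in> A'" if "y \<in> set (nbrs G w)" for y using nbh_step[OF w that] assms(2) by blast
    ultimately have "set (nbrs G w) \<inter> A = set (nbrs G' w) \<inter> A'" by auto
    then show ?thesis by (simp add: adeg_def)
  qed
  have "aball G A d u = aball G' A' d u"
  proof (rule aball_local)
    show "agr d G G' u" by (rule agr_mono[OF assms(1)]) simp
    show "w \<in> A \<longleftrightarrow> w \<in> A'" if "w \<in> nbh G d u" for w
      using assms(2) that nbh_mono[of d "Suc d" G u] by auto
  qed simp
  then show mid: "chain_mid G d A u \<longleftrightarrow> chain_mid G' d A' u"
    unfolding chain_mid_def using deg aball_nbh[of G A d u] by (metis subsetD)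
  show "u \<in> removable G d K col A i \<longleftrightarrow> u \<in> removable G' d K col' A' i"
    using mid deg[of u] assms(2)[of u] assms(3) by (simp add: removable_def)
qed

lemma zone_local:
  assumes "agr w G G' b" "eqon (nbh G w b) S S'"
  shows "zone G w h S b = zone G' w h S' b"
  using agr_nbh[OF assms(1), of w] assms(2) by (auto simp: zone_def eqon_def)

lemma zone_choice_local:
  assumes agr: "agr (w + 2 * s) G G' b"
    and E: "\<And>v. v \<in> nbh G (w + s) b \<Longrightarrow> E v = E' v \<and> depends (blk G s h v) (E v)"
    and S: "eqon (nbh G (w + 2 * s) b) S S'" and B: "eqon (nbh G (w + 2 * s) b) B B'"
  shows "zone_choice G s h E w S B b = zone_choice G' s h E' w S' B' b"
proof -
  have Z: "zone G w h S b = zone G' w h S' b"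
    by (rule zone_local) (use agr_mono[OF agr] eqon_mono[OF S nbh_mono] in auto)
  have nb: "nbh G' (w + s) b = nbh G (w + s) b" using agr_nbh[OF agr, of "w + s"] by simp
  have risk: "risk G s h E X Y v = risk G' s h E' X' Y' v"
    if v: "v \<in> nbh G (w + s) b" and X: "eqon (nbh G (w + 2 * s) b) X X'" "eqon (nbh G (w + 2 * s) b) Y Y'" for v X X' Y Y'
  proof (rule risk_local)
    show "agr s G G' v" by (rule agr_sub[OF agr v]) simp
    have "nbh G s v \<subseteq> nbh G (w + 2 * s) b" using nbh_trans_le[OF v] by auto
    then show "eqon (nbh G s v) X X'" "eqon (nbh G s v) Y Y'" using X eqon_mono by blast+
  qed (use E[OF v] in auto)
  have 1: "(\<Sum>v\<in>nbh G (w + s) b. risk G s h E S B v) = (\<Sum>v\<in>nbh G' (w + s) b. risk G' s h E' S' B' v)"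
    unfolding nb by (rule sum.cong[OF refl]) (rule risk[OF _ S B])
  have 2: "(\<Sum>v\<in>nbh G (w + s) b. risk G s h E (S \<union> zone G w h S b) ((B - zone G w h S b) \<union> W) v)
      = (\<Sum>v\<in>nbh G' (w + s) b. risk G' s h E' (S' \<union> zone G' w h S' b) ((B' - zone G' w h S' b) \<union> W) v)" for W
    unfolding nb Z by (rule sum.cong[OF refl], rule risk) (use S B in \<open>auto simp: eqon_def\<close>)
  show ?thesis unfolding zone_choice_def Z[symmetric] 1[symmetric]
    using 2 unfolding Z[symmetric] by simp
qed

text \<open>The node \<open>u\<close> may lie in the zone of a break at distance \<open>w\<close>;
  the choice there sums risks up to \<open>w + s\<close> further on, and their blocks reach another
  \<open>s\<close>. This adds up to \<open>2 * w + 2 * s\<close>.\<close>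

lemma zones_local:
  assumes G: "bgraph G \<Delta>" "bgraph G' \<Delta>'" and u: "u \<in> verts G" "u \<in> verts G'"
    and agr: "agr (2 * w + 2 * s) G G' u"
    and E: "\<And>v. v \<in> nbh G (2 * w + s) u \<Longrightarrow> E v = E' v \<and> depends (blk G s h v) (E v)"
    and S: "eqon (nbh G (2 * w + 2 * s) u) S S'" and B: "eqon (nbh G (2 * w + 2 * s) u) B B'"
    and Br: "\<And>b. b \<in> nbh G w u \<Longrightarrow> b \<in> Br \<longleftrightarrow> b \<in> Br'" "Br \<subseteq> verts G" "Br' \<subseteq> verts G'"
  shows "(u, i) \<in> zone_set G w h Br S \<longleftrightarrow> (u, i) \<in> zone_set G' w h Br' S'"
    "(u, i) \<in> zone_bits G s h E w Br S B \<longleftrightarrow> (u, i) \<in> zone_bits G' s h E' w Br' S' B'"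
proof -
  have nb: "nbh G' w u = nbh G w u" using agr_nbh[OF agr, of w] by simp
  have near: "b \<in> nbh G w u" if "b \<in> Br" "(u, i) \<in> zone G w h S b" for b
  proof -
    have "b \<in> verts G" "u \<in> nbh G w b" using that Br(2) by (auto simp: zone_def)
    then show ?thesis using bgraph.nbh_sym[OF G(1)] by blast
  qed
  have near': "b \<in> nbh G w u" if "b \<in> Br'" "(u, i) \<in> zone G' w h S' b" for b
  proof -
    have "b \<in> verts G'" "u \<in> nbh G' w b" using that Br(3) by (auto simp: zone_def)
    then show ?thesis using bgraph.nbh_sym[OF G(2)] nb by blast
  qed
  have Z: "zone G w h S b = zone G' w h S' b" if b: "b \<in> nbh G w u" for b
  proof (rule zone_local)
    show "agr w G G' b" by (rule agr_sub[OF agr b]) simp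
    show "eqon (nbh G w b) S S'" by (rule eqon_mono[OF S]) (use nbh_trans_le[OF b] in auto)
  qed
  have C: "zone_choice G s h E w S B b = zone_choice G' s h E' w S' B' b" if b: "b \<in> nbh G w u" for b
  proof (rule zone_choice_local)
    show "agr (w + 2 * s) G G' b" by (rule agr_sub[OF agr b]) simp
    show "eqon (nbh G (w + 2 * s) b) S S'" by (rule eqon_mono[OF S]) (use nbh_trans_le[OF b] in auto)
    show "eqon (nbh G (w + 2 * s) b) B B'" by (rule eqon_mono[OF B]) (use nbh_trans_le[OF b] in auto)
    show "E v = E' v \<and> depends (blk G s h v) (E v)" if "v \<in> nbh G (w + s) b" for v
      by (rule E) (use nbh_trans_le[OF b that] in auto)
  qed
  have SB: "(u, i) \<in> S \<longleftrightarrow> (u, i) \<in> S'" "(u, i) \<in> B \<longleftrightarrow> (u, i) \<in> B'"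
    using S B unfolding eqon_def by (meson nbh_refl)+
  have in_zone: "(\<exists>b\<in>Br. (u, i) \<in> zone G w h S b) \<longleftrightarrow> (\<exists>b\<in>Br'. (u, i) \<in> zone G' w h S' b)"
    using near near' Z Br(1) by metis
  show "(u, i) \<in> zone_set G w h Br S \<longleftrightarrow> (u, i) \<in> zone_set G' w h Br' S'"
    using in_zone SB by (simp add: zone_set_def)
  have "(\<exists>b\<in>Br. (u, i) \<in> zone_choice G s h E w S B b \<and> (u, i) \<in> zone G w h S b) \<longleftrightarrow>
      (\<exists>b\<in>Br'. (u, i) \<in> zone_choice G' s h E' w S' B' b \<and> (u, i) \<in> zone G' w h S' b)"
    using near near' Z C Br(1) by metis
  then show "(u, i) \<in> zone_bits G s h E w Br S B \<longleftrightarrow> (u, i) \<in> zone_bits G' s h E' w Br' S' B'"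
    using in_zone SB by (simp add: zone_bits_def)
qed

lemma states_local:
  fixes ol ol' :: "nat \<Rightarrow> (nat \<times> nat) set \<Rightarrow> 'o list"
  assumes agr: "agr (r + T) G G' x" and S: "eqon (nbh G (r + T) x) S S'"
    and ol: "\<And>y. y \<in> nbh G r x \<Longrightarrow> ol y B = ol' y B'" and good: "good x = good' x"
  shows "states G r T h ol good S B x = states G' r T h ol' good' S' B' x"
proof -
  have nb: "nbh G' r x = nbh G r x" using agr_nbh[OF agr, of r] by simp
  have nbrs: "nbrs G' y = nbrs G y" if "y \<in> nbh G r x" for y
    by (rule agr_nbrs[OF agr]) (use that nbh_mono[of r "r + T"] in auto)
  have fx: "fixed_at G T h S y \<longleftrightarrow> fixed_at G' T h S' y" if y: "y \<in> nbh G r x" for y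
  proof -
    have "nbh G' T y = nbh G T y" by (rule agr_nbh_sub[OF agr y]) simp
    moreover have "nbh G T y \<subseteq> nbh G (r + T) x" using nbh_trans[OF y] by blast
    ultimately show ?thesis using S unfolding fixed_at_def eqon_def by blast
  qed
  have "PiE (nbh G r x) (\<lambda>y. {os :: 'o list. length os = length (nbrs G y)}) =
      PiE (nbh G r x) (\<lambda>y. {os. length os = length (nbrs G' y)})"
    by (rule PiE_cong) (simp add: nbrs)
  moreover have "(\<forall>y\<in>nbh G r x. fixed_at G T h S y \<longrightarrow> q y = ol y B) \<longleftrightarrow>
      (\<forall>y\<in>nbh G r x. fixed_at G' T h S' y \<longrightarrow> q y = ol' y B')" for q :: "nat \<Rightarrow> 'o list"
    using fx ol by (intro ball_cong) auto
  ultimately show ?thesis unfolding states_def nb good by simp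
qed

lemma feas_local:
  fixes st st' :: "nat \<Rightarrow> (nat \<Rightarrow> 'o list) set"
  assumes agr: "agr (Suc r) G G' u" and st: "st u = st' u"
    and lab: "\<And>w. w \<in> nbh G 1 u \<Longrightarrow> (w \<in> Z \<longleftrightarrow> w \<in> Z') \<and> (w \<in> Br \<longleftrightarrow> w \<in> Br') \<and> lay w = lay' w \<and>
       feas G r Z Br lay st i w = feas G' r Z' Br' lay' st' i w"
  shows "feas G r Z Br lay st (Suc i) u = feas G' r Z' Br' lay' st' (Suc i) u"
proof -
  have nbrs: "nbrs G' u = nbrs G u" using agr_nbrs[OF agr nbh_refl] .
  have w1: "w \<in> nbh G 1 u" if "w \<in> set (nbrs G u)" for w using nbh_nbr[OF that nbh_refl, of 0] by simp
  have ag: "agreeing G r u w q q' \<longleftrightarrow> agreeing G' r u w q q'" if "w \<in> set (nbrs G u)" for w and q q' :: "nat \<Rightarrow> 'o list"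
    using agr_nbh[OF agr, of r] agr_nbh_sub[OF agr w1[OF that], of r] by (simp add: agreeing_def)
  have ch: "children G Z Br lay u = children G' Z' Br' lay' u"
    unfolding children_def nbrs
  proof (rule Collect_cong)
    fix w
    show "(w \<in> set (nbrs G u) \<and> w \<in> Z \<and> w \<notin> Br \<and> lay w < lay u) \<longleftrightarrow>
        (w \<in> set (nbrs G u) \<and> w \<in> Z' \<and> w \<notin> Br' \<and> lay' w < lay' u)"
      using lab[OF w1, of w] lab[OF nbh_refl] by auto
  qed
  have "(\<forall>w\<in>children G Z Br lay u. \<exists>q'\<in>feas G r Z Br lay st i w. agreeing G r u w q q') \<longleftrightarrow>
     (\<forall>w\<in>children G' Z' Br' lay' u. \<exists>q'\<in>feas G' r Z' Br' lay' st' i w. agreeing G' r u w q q')" for q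
    unfolding ch[symmetric] using lab w1 ag by (intro ball_cong refl) (auto simp: children_def)
  then show ?thesis using lab[OF nbh_refl] st by simp
qed

lemma pick_local:
  fixes F F' :: "nat \<Rightarrow> (nat \<Rightarrow> 'o list) set"
  assumes agr: "agr (Suc r) G G' u" and F: "F u = F' u"
    and lab: "\<And>w. w \<in> nbh G 1 u \<Longrightarrow> (w \<in> Z \<longleftrightarrow> w \<in> Z') \<and> (w \<in> Br \<longleftrightarrow> w \<in> Br') \<and> lay w = lay' w \<and>
       pick G r Z Br lay F I j w = pick G' r Z' Br' lay' F' I j w"
  shows "pick G r Z Br lay F I (Suc j) u = pick G' r Z' Br' lay' F' I (Suc j) u"
proof -
  have nbrs: "nbrs G' u = nbrs G u" using agr_nbrs[OF agr nbh_refl] .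
  have w1: "w \<in> nbh G 1 u" if "w \<in> set (nbrs G u)" for w using nbh_nbr[OF that nbh_refl, of 0] by simp
  have ag: "agreeing G r w u q q' \<longleftrightarrow> agreeing G' r w u q q'" if "w \<in> set (nbrs G u)" for w and q q' :: "nat \<Rightarrow> 'o list"
    using agr_nbh[OF agr, of r] agr_nbh_sub[OF agr w1[OF that], of r] by (simp add: agreeing_def)
  have pa: "parents G Z Br lay u = parents G' Z' Br' lay' u"
    using lab w1 lab[OF nbh_refl] unfolding parents_def nbrs by auto
  have "(\<forall>p\<in>parents G Z Br lay u. agreeing G r p u (pick G r Z Br lay F I j p) q) \<longleftrightarrow>
     (\<forall>p\<in>parents G' Z' Br' lay' u. agreeing G' r p u (pick G' r Z' Br' lay' F' I j p) q)" for q
    unfolding pa[symmetric] using lab w1 ag by (intro ball_cong refl) (auto simp: parents_def split: if_splits)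
  then show ?thesis using lab[OF nbh_refl] F by simp
qed

section \<open>The algorithm on graphs with named nodes\<close>

type_synonym ('i, 'o) label =
  "'i list \<times> nat set \<times> nat \<times> nat set \<times> bool \<times> bool \<times> nat \<times> bool \<times> (nat \<Rightarrow> 'o list) set \<times> (nat \<Rightarrow> 'o list)"

text \<open>One tuple type serves all stages; components of later stages hold constants until they
  are computed.\<close>

definition label ::
  "pgraph \<Rightarrow> (nat \<Rightarrow> nat \<Rightarrow> 'i) \<Rightarrow> (nat \<times> nat) set \<Rightarrow> (nat \<Rightarrow> nat) \<Rightarrow> (nat \<times> nat) set \<Rightarrow> nat set \<Rightarrow> nat set \<Rightarrow>
    (nat \<Rightarrow> nat) \<Rightarrow> nat set \<Rightarrow> (nat \<Rightarrow> (nat \<Rightarrow> 'o list) set) \<Rightarrow> (nat \<Rightarrow> nat \<Rightarrow> 'o list) \<Rightarrow> nat \<Rightarrow> ('i, 'o) label" where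
  "label G inp B c S Z a ly br fe pk v =
     (map (inp v) (nbrs G v), {i. (v, i) \<in> B}, c v, {i. (v, i) \<in> S}, v \<in> Z, v \<in> a, ly v, v \<in> br, fe v, pk v)"

abbreviation no_guess :: "nat \<Rightarrow> nat \<Rightarrow> 'o list" where
  "no_guess \<equiv> \<lambda>_ _. undefined"

definition start_label :: "pgraph \<Rightarrow> (nat \<Rightarrow> nat \<Rightarrow> 'i) \<Rightarrow> (nat \<times> nat) set \<Rightarrow> nat \<Rightarrow> ('i, 'o) label" where
  "start_label G inp B = label G inp B (\<lambda>u. u) {} {} {} (\<lambda>_. 0) {} (\<lambda>_. {}) no_guess"

lemma label_local:
  assumes agr: "agr k G G' v"
    and lab: "\<forall>w\<in>nbh G k v.
      label G inp B c S Z a ly br fe pk w = label G' inp' B' c' S' Z' a' ly' br' fe' pk' w"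
  shows "sim k G inp G' inp' v" "eqon (nbh G k v) B B'" "eqon (nbh G k v) S S'"
    "\<And>w. w \<in> nbh G k v \<Longrightarrow> c w = c' w" "\<And>w. w \<in> nbh G k v \<Longrightarrow> w \<in> Z \<longleftrightarrow> w \<in> Z'"
    "\<And>w. w \<in> nbh G k v \<Longrightarrow> w \<in> a \<longleftrightarrow> w \<in> a'" "\<And>w. w \<in> nbh G k v \<Longrightarrow> ly w = ly' w"
    "\<And>w. w \<in> nbh G k v \<Longrightarrow> w \<in> br \<longleftrightarrow> w \<in> br'" "\<And>w. w \<in> nbh G k v \<Longrightarrow> fe w = fe' w"
    "\<And>w. w \<in> nbh G k v \<Longrightarrow> pk w = pk' w"
proof -
  have *: "map (inp w) (nbrs G w) = map (inp' w) (nbrs G' w)" "{i. (w, i) \<in> B} = {i. (w, i) \<in> B'}"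
    "{i. (w, i) \<in> S} = {i. (w, i) \<in> S'}" "c w = c' w" "w \<in> Z \<longleftrightarrow> w \<in> Z'" "w \<in> a \<longleftrightarrow> w \<in> a'" "ly w = ly' w"
    "w \<in> br \<longleftrightarrow> w \<in> br'" "fe w = fe' w" "pk w = pk' w" if "w \<in> nbh G k v" for w
    using bspec[OF lab that] unfolding label_def by simp_all
  have "inp w y = inp' w y" if w: "w \<in> nbh G k v" and y: "y \<in> set (nbrs G w)" for w y
    using *(1)[OF w] y unfolding agr_nbrs[OF agr w] by simp
  then show "sim k G inp G' inp' v" using agr by (simp add: sim_def)
  show "eqon (nbh G k v) B B'" "eqon (nbh G k v) S S'" using *(2,3) unfolding eqon_def by blast+
  fix w assume w: "w \<in> nbh G k v"
  show "c w = c' w" "w \<in> Z \<longleftrightarrow> w \<in> Z'" "w \<in> a \<longleftrightarrow> w \<in> a'" "ly w = ly' w" "w \<in> br \<longleftrightarrow> w \<in> br'"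
    "fe w = fe' w" "pk w = pk' w" by (rule *[OF w])+
qed

locale scheme =
  fixes P :: "('i::finite, 'o::finite) lcl" and A :: "('s, 'm, 'i, 'o) dalg" and n0 \<Delta> s m l J L :: nat and \<theta> :: real
  assumes sol: "solves_on_trees A P \<Delta> (\<lambda>n. 1 / real n)"
    and s: "radius P + a_rounds A n0 \<le> s" "1 \<le> s"
    and n0: "(\<Delta> + 2) ^ Suc s \<le> n0" and p_le: "1 / real n0 \<le> 2 * \<theta>" and theta_pos: "0 < \<theta>"
    and lll: "4 * (2 * \<theta> * (\<Delta> + 2) ^ (radius P + s + s)) * (\<Delta> + 2) ^ (2 * s) \<le> 1"
    and m: "\<And>w. w > m \<Longrightarrow> 2 * next_width ((\<Delta> + 2) ^ (2 * (radius P + s + s))) w \<le> w"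
    and L_J: "L < 2 ^ J"
begin

abbreviation "r \<equiv> radius P"
abbreviation "T \<equiv> a_rounds A n0"
abbreviation "h \<equiv> a_bits A n0"
definition "d = 2 * (r + s + s)"
definition "z = 3 * (r + s + s)"
abbreviation "D \<equiv> (\<Delta> + 2) ^ d"
definition "K = (2::nat) ^ m"
definition "I = J * ((2 * d + 3) * K)"
definition "jc = floor_log l + 1"
text \<open>A common radius for all stages; the largest demand is \<open>z + s\<close>, which is at
  most \<open>10 * s\<close>.\<close>

definition "kk = 12 * s"
abbreviation "names \<equiv> {..<(2::nat) ^ l}"
abbreviation "E \<equiv> fails P A n0"
abbreviation "ol G inp \<equiv> (\<lambda>x B. out_list A n0 G inp B x)"

text \<open>Nodes are their own names here; the anonymous network is brought into this form by
  renaming.\<close>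

definition "Inst = {(G, inp :: nat \<Rightarrow> nat \<Rightarrow> 'i, B). is_tree G \<and> max_deg_le G \<Delta> \<and> verts G \<subseteq> names \<and> B \<subseteq> verts G \<times> {..<h}}"

definition "C j G = colouring G d D m l j"
definition "cf G = C jc G"
definition "presam j G inp B = presampled G s h (E G inp) \<theta> (cf G) B j"
definition "S0 G inp B = presam (K * h) G inp B"
text \<open>Phrased from the point of view of \<open>u\<close>, which must decide membership from
  its own ball; by symmetry of balls it is the region \<open>Zs\<close>.\<close>

definition "ZZ G inp B = {u \<in> verts G. \<exists>v\<in>nbh G z u. \<theta> < risk G s h (E G inp) (S0 G inp B) B v}"
definition "AL i G inp B = alive G d K (cf G) (ZZ G inp B) i"
definition "LY i G inp B = layer G d K (cf G) (ZZ G inp B) i"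
definition "BR i G inp B = breaks G d K (cf G) (ZZ G inp B) i"
definition "S1 G inp B = zone_set G (r + s) h (BR I G inp B) (S0 G inp B)"
definition "B1 G inp B = zone_bits G s h (E G inp) (r + s) (BR I G inp B) (S0 G inp B) B"
definition "ST G inp B = states G r T h (ol G inp) (good_at P G inp) (S1 G inp B) (B1 G inp B)"
definition "FE i G inp B = feas G r (ZZ G inp B) (BR I G inp B) (LY I G inp B) (ST G inp B) i"
definition "PK j G inp B = pick G r (ZZ G inp B) (BR I G inp B) (LY I G inp B) (FE I G inp B) I j"
definition "OUT G inp B = final_output (ZZ G inp B) (ol G inp) (B1 G inp B) (PK I G inp B)"

lemma InstD:
  assumes "(G, inp, B) \<in> Inst"
  shows "bgraph G \<Delta>" "verts G \<subseteq> names" "B \<subseteq> verts G \<times> {..<h}" "\<not> (\<exists>cs. is_cycle G cs)"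
  using assms by (auto simp: Inst_def is_tree_def bgraph_def)

lemma width_jc: "width D m l jc \<le> m" "width D m l j \<le> l"
proof -
  have m': "2 * next_width D w \<le> w" if "w > m" for w using m[OF that] by (simp add: d_def)
  show "width D m l jc \<le> m" unfolding jc_def by (rule width_final) (rule m')
  show "width D m l j \<le> l" by (rule width_le(2)) (rule m')
qed

lemma sampling:
  assumes I: "(G, inp, B) \<in> Inst"
  shows "sampling G \<Delta> s h (E G inp) \<theta> (1 / real n0) (cf G) K d"
proof -
  interpret bgraph G \<Delta> by (rule InstD(1)[OF I])
  have col: "distinct_col G d (cf G)" "\<And>v. v \<in> verts G \<Longrightarrow> cf G v < 2 ^ width D m l jc"
    using colouring_distinct[OF InstD(2)[OF I], of d D m jc] by (auto simp: cf_def C_def)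
  show ?thesis
  proof unfold_locales
    show "depends (blk G s h v) (E G inp v)" if "v \<in> verts G" for v
      by (rule fails_depends[OF bgraph_axioms that s(1)])
    show "avg (blk G s h v) (\<lambda>B. of_bool (E G inp v B)) B \<le> 1 / real n0" if "v \<in> verts G" for v B
      by (rule failure_in_ball[OF InstD(4)[OF I] that sol s(1) n0])
    show "cf G v < K" if "v \<in> verts G" for v
      using col(2)[OF that] power_increasing[OF width_jc(1), of "2::nat"] unfolding K_def by linarith
  qed (use p_le theta_pos col(1) in \<open>auto simp: d_def\<close>)
qed

lemma solver:
  assumes I: "(G, inp, B) \<in> Inst"
  shows "solver G \<Delta> s h (E G inp) \<theta> (1 / real n0) (cf G) K d (ol G inp) (good_at P G inp) r T z I L J"
proof -
  interpret Sm: sampling G \<Delta> s h "E G inp" \<theta> "1 / real n0" "cf G" K d by (rule sampling[OF I])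
  show ?thesis
  proof unfold_locales
    show "good_at P G inp v f \<longleftrightarrow> good_at P G inp v g"
      if "v \<in> verts G" "\<And>x. x \<in> nbh G r v \<Longrightarrow> f x = g x" for v f g
      by (rule good_at_sim[OF Sm.bgraph_axioms Sm.bgraph_axioms that(1,1) sim_self that(2)])
    show "depends (nbh G T x \<times> {..<h}) (ol G inp x)" for x
      unfolding depends_def by (intro allI impI out_list_sim) simp_all
  qed (use InstD(4)[OF I] s lll L_J in \<open>auto simp: fails_def d_def z_def I_def\<close>)
qed

text \<open>Stage by stage, the objects of the solver are identified with their locally phrased
  counterparts.\<close>

lemma correct:
  assumes I: "(G, inp, B) \<in> Inst" and v: "v \<in> verts G"
    and sh: "sampling.shattered G s h (E G inp) \<theta> (cf G) K z L B"
  shows "good_at P G inp v (OUT G inp B)"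
proof -
  interpret S: solver G \<Delta> s h "E G inp" \<theta> "1 / real n0" "cf G" K d "ol G inp" "good_at P G inp" r T z I L J
    by (rule solver[OF I])
  have S0: "S.S0 B = S0 G inp B" unfolding S.S0_def[OF sh] by (simp add: S0_def presam_def)
  have mk: "S.marked B = {v \<in> verts G. \<theta> < risk G s h (E G inp) (S0 G inp B) B v}"
    unfolding S.marked_def by (simp add: S0_def presam_def)
  have Z: "S.Zs B = ZZ G inp B"
    unfolding S.Zs_def[OF sh] mk ZZ_def using S.nbh_sym S.nbh_verts by blast
  have Br: "S.Br B = BR I G inp B" unfolding S.Br_def[OF sh] Z by (simp add: BR_def)
  have lay: "S.lay B = LY I G inp B" unfolding S.lay_def[OF sh] Z by (rule ext) (simp add: LY_def)
  have S1: "S.S1 B = S1 G inp B" unfolding S.S1_def[OF sh] S0 Br by (simp add: S1_def)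
  have B1: "S.B1 B = B1 G inp B" unfolding S.B1_def[OF sh] S0 Br by (simp add: B1_def)
  have st: "S.st B = ST G inp B" unfolding S.st_def[OF sh] S1 B1 by (simp add: ST_def)
  have F: "S.F B = FE I G inp B" unfolding S.F_def[OF sh] Z Br lay st by (rule ext) (simp add: FE_def)
  have pk: "S.pk B = PK I G inp B" unfolding S.pk_def[OF sh] Z Br lay F by (rule ext) (simp add: PK_def)
  show ?thesis using S.final_good[OF sh v] unfolding Z B1 pk by (simp add: OUT_def)
qed

subsection \<open>Computation with bounded labels\<close>

definition "balls = {W. W \<subseteq> names \<and> card W \<le> (\<Delta> + 2) ^ r}"
definition "outs = {os :: 'o list. length os \<le> \<Delta>}"
definition "guesses = (\<Union>W\<in>balls. PiE W (\<lambda>_. outs))"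
text \<open>Each set lives over one ball of constant size, so their number is polynomial in
  \<open>2 ^ l\<close>; arbitrary sets of guesses would be too many to be sent.\<close>

definition "guess_sets = (\<Union>W\<in>balls. Pow (PiE W (\<lambda>_. outs)))"
definition labels :: "('i, 'o) label set" where
  "labels = {il. length il \<le> \<Delta>} \<times> Pow {..<h} \<times> names \<times> Pow {..<h} \<times> UNIV \<times> UNIV \<times> {..I} \<times> UNIV \<times> guess_sets \<times> guesses"

lemma empty_guess: "(\<lambda>_. undefined) \<in> guesses" "{} \<in> guess_sets"
proof -
  have "{} \<in> balls" by (simp add: balls_def)
  then show "(\<lambda>_. undefined) \<in> guesses" "{} \<in> guess_sets"
    unfolding guesses_def guess_sets_def by (force simp: PiE_def extensional_def)+
qed

lemma label_in:
  assumes I: "(G, inp, B) \<in> Inst" and v: "v \<in> verts G" and B': "B' \<subseteq> UNIV \<times> {..<h}" and "c v < 2 ^ l" "S \<subseteq> UNIV \<times> {..<h}" "ly v \<le> I"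
    "fe v \<in> guess_sets" "pk v \<in> guesses"
  shows "label G inp B' c S Z a ly br fe pk v \<in> labels"
proof -
  have "length (nbrs G v) \<le> \<Delta>" using InstD(1)[OF I] v by (simp add: bgraph_def max_deg_le_def)
  then show ?thesis using assms(3-) by (auto simp: label_def labels_def)
qed

lemma colour_small: "(G, inp, B) \<in> Inst \<Longrightarrow> v \<in> verts G \<Longrightarrow> C j G v < 2 ^ l"
proof -
  assume I: "(G, inp, B) \<in> Inst" and v: "v \<in> verts G"
  interpret bgraph G \<Delta> by (rule InstD(1)[OF I])
  have "C j G v < 2 ^ width D m l j"
    using colouring_distinct[OF InstD(2)[OF I], of d D m j] v by (simp add: C_def)
  also have "\<dots> \<le> 2 ^ l" using width_jc(2) by (intro power_increasing) auto
  finally show ?thesis .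
qed

lemma sampled_sub: "presam j G inp B \<subseteq> UNIV \<times> {..<h}"
  unfolding presam_def by (induction j) (auto simp: sampled_def)

lemma layer_le: "LY i G inp B v \<le> i"
  unfolding LY_def by (induction i) auto

lemma ZZ_verts: "ZZ G inp B \<subseteq> verts G"
  by (auto simp: ZZ_def)

lemma AL_verts: "AL i G inp B \<subseteq> verts G"
  unfolding AL_def by (induction i) (use ZZ_verts in auto)

lemma BR_verts: "BR i G inp B \<subseteq> verts G"
  unfolding BR_def by (induction i) (auto simp: removable_def dest: subsetD[OF AL_verts[unfolded AL_def]])

lemma zones_sub:
  assumes "(G, inp, B) \<in> Inst"
  shows "S1 G inp B \<subseteq> UNIV \<times> {..<h}" "B1 G inp B \<subseteq> UNIV \<times> {..<h}"
  using sampled_sub[of "K * h" G inp B] InstD(3)[OF assms]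
  by (auto simp: S1_def B1_def S0_def zone_set_def zone_bits_def zone_def)

lemma ball_in: "(G, inp, B) \<in> Inst \<Longrightarrow> v \<in> verts G \<Longrightarrow> nbh G r v \<in> balls"
  using bgraph.card_nbh[OF InstD(1)] bgraph.nbh_verts[OF InstD(1)] InstD(2) unfolding balls_def by blast

lemma FE_sub:
  assumes I: "(G, inp, B) \<in> Inst" and v: "v \<in> verts G"
  shows "FE i G inp B v \<subseteq> PiE (nbh G r v) (\<lambda>_. outs)"
proof -
  have sub: "nbh G r v \<subseteq> verts G" by (rule bgraph.nbh_verts[OF InstD(1)[OF I] v])
  have deg: "length (nbrs G y) \<le> \<Delta>" if "y \<in> nbh G r v" for y
    using InstD(1)[OF I] sub that by (auto simp: bgraph_def max_deg_le_def)
  have "ST G inp B v \<subseteq> PiE (nbh G r v) (\<lambda>y. {os. length os = length (nbrs G y)})"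
    unfolding ST_def states_def by blast
  also have "\<dots> \<subseteq> PiE (nbh G r v) (\<lambda>_. outs)" using deg unfolding outs_def by (intro PiE_mono) auto
  finally have ST: "ST G inp B v \<subseteq> PiE (nbh G r v) (\<lambda>_. outs)" .
  show ?thesis unfolding FE_def by (induction i) (use ST in auto)
qed

lemma FE_in: "(G, inp, B) \<in> Inst \<Longrightarrow> v \<in> verts G \<Longrightarrow> FE i G inp B v \<in> guess_sets"
  unfolding guess_sets_def by (rule UN_I[where a = "nbh G r v"]) (rule ball_in PowI[OF FE_sub]; assumption)+

lemma PK_in:
  assumes I: "(G, inp, B) \<in> Inst" and v: "v \<in> verts G"
  shows "PK j G inp B v \<in> guesses"
proof -
  have *: "pick_from Q \<in> guesses" if "Q \<subseteq> FE I G inp B v" for Q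
  proof (cases "Q = {}")
    case True
    then show ?thesis using empty_guess(1) by (simp add: pick_from_def)
  next
    case False
    then have "pick_from Q \<in> Q" by (rule pick_from_in)
    then have "pick_from Q \<in> PiE (nbh G r v) (\<lambda>_. outs)" using that FE_sub[OF I v] by (meson subsetD)
    then show ?thesis unfolding guesses_def by (rule UN_I[OF ball_in[OF I v]])
  qed
  show ?thesis unfolding PK_def by (induction j) (use * empty_guess in auto)
qed

text \<open>The label families of the stages: colouring, sampling, raking, feasible guesses,
  downward choice. \<open>LP 0\<close> equals \<open>LC jc\<close> and \<open>LD 0\<close> equals
  \<open>LF I\<close>, so these transitions cost no rounds.\<close>

definition LC :: "nat \<Rightarrow> pgraph \<Rightarrow> (nat \<Rightarrow> nat \<Rightarrow> 'i) \<times> (nat \<times> nat) set \<Rightarrow> nat \<Rightarrow> ('i, 'o) label" where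
  "LC j G a = label G (fst a) (snd a) (C j G) {} {} {} (\<lambda>_. 0) {} (\<lambda>_. {}) no_guess"
definition LP :: "nat \<Rightarrow> pgraph \<Rightarrow> (nat \<Rightarrow> nat \<Rightarrow> 'i) \<times> (nat \<times> nat) set \<Rightarrow> nat \<Rightarrow> ('i, 'o) label" where
  "LP j G a = label G (fst a) (snd a) (cf G) (presam j G (fst a) (snd a)) {} {} (\<lambda>_. 0) {} (\<lambda>_. {}) no_guess"
definition LR :: "nat \<Rightarrow> pgraph \<Rightarrow> (nat \<Rightarrow> nat \<Rightarrow> 'i) \<times> (nat \<times> nat) set \<Rightarrow> nat \<Rightarrow> ('i, 'o) label" where
  "LR i G a = label G (fst a) (snd a) (cf G) (S0 G (fst a) (snd a)) (ZZ G (fst a) (snd a))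
  (AL i G (fst a) (snd a)) (LY i G (fst a) (snd a)) (BR i G (fst a) (snd a)) (\<lambda>_. {}) no_guess"
definition "LF i G a = label G (fst a) (B1 G (fst a) (snd a)) (cf G) (S1 G (fst a) (snd a)) (ZZ G (fst a) (snd a))
  (AL I G (fst a) (snd a)) (LY I G (fst a) (snd a)) (BR I G (fst a) (snd a)) (FE i G (fst a) (snd a)) no_guess"
definition "LD j G a = label G (fst a) (B1 G (fst a) (snd a)) (cf G) (S1 G (fst a) (snd a)) (ZZ G (fst a) (snd a))
  (AL I G (fst a) (snd a)) (LY I G (fst a) (snd a)) (BR I G (fst a) (snd a)) (FE I G (fst a) (snd a)) (PK j G (fst a) (snd a))"

lemma labels_in:
  assumes I: "(G, a) \<in> Inst" and v: "v \<in> verts G" and i: "i \<le> I"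
  shows "LC j G a v \<in> labels" "LP j G a v \<in> labels" "LR i G a v \<in> labels" "LF j G a v \<in> labels" "LD j G a v \<in> labels"
proof -
  obtain inp B where a: "a = (inp, B)" by (cases a)
  have I': "(G, inp, B) \<in> Inst" using I a by simp
  have B: "B \<subseteq> UNIV \<times> {..<h}" using InstD(3)[OF I'] by blast
  note facts = B colour_small[OF I' v] sampled_sub zones_sub[OF I'] FE_in[OF I' v] PK_in[OF I' v] empty_guess
  have cf: "cf G v < 2 ^ l" using colour_small[OF I' v] by (simp add: cf_def)
  have LY: "LY i G inp B v \<le> I" "LY I G inp B v \<le> I" using layer_le i order_trans by blast+
  show "LC j G a v \<in> labels" unfolding LC_def a fst_conv snd_conv by (rule label_in[OF I' v]) (use facts in auto)
  show "LP j G a v \<in> labels" unfolding LP_def a fst_conv snd_conv by (rule label_in[OF I' v]) (use facts cf in auto)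
  show "LR i G a v \<in> labels" unfolding LR_def a fst_conv snd_conv
    by (rule label_in[OF I' v]) (use facts cf LY in \<open>auto simp: S0_def\<close>)
  show "LF j G a v \<in> labels" unfolding LF_def a fst_conv snd_conv by (rule label_in[OF I' v]) (use facts cf LY in auto)
  show "LD j G a v \<in> labels" unfolding LD_def a fst_conv snd_conv by (rule label_in[OF I' v]) (use facts cf LY in auto)
qed

section \<open>Every stage reads a ball of radius \<open>kk\<close>\<close>

lemma E_local:
  assumes I: "(G, inp, B) \<in> Inst" "(G', inp', B') \<in> Inst" and v: "v \<in> verts G" "v \<in> verts G'"
    and sim: "sim kk G inp G' inp' v" and x: "x \<in> nbh G i v" "i + s \<le> kk"
  shows "E G inp x = E G' inp' x \<and> depends (blk G s h x) (E G inp x)"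
proof -
  have xv: "x \<in> verts G" using bgraph.nbh_verts[OF InstD(1)[OF I(1)] v(1)] x(1) by blast
  have "x \<in> nbh G kk v" using x nbh_mono[of i kk G v] by auto
  then have xv': "x \<in> verts G'" using sim xv unfolding sim_def agr_def by blast
  have "E G inp x Q = E G' inp' x Q" for Q
    by (rule fails_sim[OF InstD(1)[OF I(1)] InstD(1)[OF I(2)] xv xv' sim_sub[OF sim x(1)] refl]) (use s x(2) in simp)
  then show ?thesis using fails_depends[OF InstD(1)[OF I(1)] xv s(1)] by blast
qed

context
  fixes G G' :: pgraph and inp inp' :: "nat \<Rightarrow> nat \<Rightarrow> 'i" and B B' :: "(nat \<times> nat) set" and v :: nat
  assumes I1: "(G, inp, B) \<in> Inst" and I2: "(G', inp', B') \<in> Inst" and v1: "v \<in> verts G" and v2: "v \<in> verts G'"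
    and agr: "agr kk G G' v"
begin

lemma r_s: "r \<le> s" "r + T \<le> s" "1 \<le> s"
  using s by auto

lemma kk_ge: "d \<le> kk" "Suc d \<le> kk" "2 * s \<le> kk" "z + s \<le> kk" "2 * (r + s) + 2 * s \<le> kk" "Suc r \<le> kk" "r + T \<le> kk" "1 \<le> kk"
  using r_s by (auto simp: kk_def d_def z_def)

lemma step_LC:
  assumes eq: "\<forall>w\<in>nbh G kk v. (LC j G (inp, B) w) = LC j G' (inp', B') w"
  shows "(LC (Suc j) G (inp, B) v) = LC (Suc j) G' (inp', B') v"
proof -
  note loc = label_local[OF agr eq[unfolded LC_def fst_conv snd_conv]]
  have c: "C (Suc j) G v = C (Suc j) G' v"
  proof (cases "width D m l j \<le> m")
    case True
    then show ?thesis using loc(4)[of v] by (simp add: C_def)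
  next
    case False
    have "recolour G d (width D m l j) D (C j G) v = recolour G' d (width D m l j) D (C j G') v"
      by (rule recolour_local) (use agr_mono[OF agr kk_ge(1)] loc(4) nbh_mono[OF kk_ge(1)] in auto)
    then show ?thesis using False by (simp add: C_def)
  qed
  show ?thesis using bspec[OF eq nbh_refl] c by (simp add: LC_def label_def)
qed

lemma step_LP:
  assumes eq: "\<forall>w\<in>nbh G kk v. (LP j G (inp, B) w) = LP j G' (inp', B') w"
  shows "(LP (Suc j) G (inp, B) v) = LP (Suc j) G' (inp', B') v"
proof -
  note loc = label_local[OF agr eq[unfolded LP_def fst_conv snd_conv]]
  have "(v, i) \<in> presam (Suc j) G inp B \<longleftrightarrow> (v, i) \<in> presam (Suc j) G' inp' B'" for i
    unfolding presam_def
  proof (rule presampled_local)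
    show "agr (2 * s) G G' v" by (rule agr_mono[OF agr kk_ge(3)])
    show "E G inp x = E G' inp' x \<and> depends (blk G s h x) (E G inp x)" if "x \<in> nbh G s v" for x
      by (rule E_local[OF I1 I2 v1 v2 loc(1) that]) (use kk_ge(3) in linarith)
    show "eqon (nbh G (2 * s) v) (presampled G s h (E G inp) \<theta> (cf G) B j) (presampled G' s h (E G' inp') \<theta> (cf G') B' j)"
      using eqon_mono[OF loc(3) nbh_mono[OF kk_ge(3)]] by (simp add: presam_def)
    show "eqon (nbh G (2 * s) v) B B'" by (rule eqon_mono[OF loc(2) nbh_mono[OF kk_ge(3)]])
    show "cf G v = cf G' v" by (rule loc(4)) simp
  qed
  then show ?thesis using bspec[OF eq nbh_refl] by (simp add: LP_def label_def)
qed

lemma step_Z: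
  assumes eq: "\<forall>w\<in>nbh G kk v. (LP (K * h) G (inp, B) w) = LP (K * h) G' (inp', B') w"
  shows "(LR 0 G (inp, B) v) = LR 0 G' (inp', B') v"
proof -
  note loc = label_local[OF agr eq[unfolded LP_def fst_conv snd_conv]]
  have nb: "nbh G' z v = nbh G z v" using agr_nbh[OF agr, of z] kk_ge(4) by simp
  have "risk G s h (E G inp) (S0 G inp B) B x = risk G' s h (E G' inp') (S0 G' inp' B') B' x" if x: "x \<in> nbh G z v" for x
  proof (rule risk_local)
    show "agr s G G' x" by (rule agr_sub[OF agr x kk_ge(4)])
    have sub: "nbh G s x \<subseteq> nbh G kk v" using nbh_trans_le[OF x _ kk_ge(4)] by blast
    show "eqon (nbh G s x) (S0 G inp B) (S0 G' inp' B')" using eqon_mono[OF loc(3) sub] by (simp add: S0_def)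
    show "eqon (nbh G s x) B B'" by (rule eqon_mono[OF loc(2) sub])
  qed (use E_local[OF I1 I2 v1 v2 loc(1) x kk_ge(4)] in auto)
  then have "v \<in> ZZ G inp B \<longleftrightarrow> v \<in> ZZ G' inp' B'" using v1 v2 nb by (simp add: ZZ_def)
  then show ?thesis using bspec[OF eq nbh_refl] by (simp add: LP_def LR_def label_def AL_def LY_def BR_def S0_def)
qed

lemma step_LR:
  assumes eq: "\<forall>w\<in>nbh G kk v. (LR i G (inp, B) w) = LR i G' (inp', B') w"
  shows "(LR (Suc i) G (inp, B) v) = LR (Suc i) G' (inp', B') v"
proof -
  note loc = label_local[OF agr eq[unfolded LR_def fst_conv snd_conv]]
  have "v \<in> removable G d K (cf G) (AL i G inp B) i \<longleftrightarrow> v \<in> removable G' d K (cf G') (AL i G' inp' B') i"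
    "chain_mid G d (AL i G inp B) v \<longleftrightarrow> chain_mid G' d (AL i G' inp' B') v"
    using agr_mono[OF agr kk_ge(2)] loc(4)[of v] loc(6) nbh_mono[OF kk_ge(2)] by (intro removable_local; auto)+
  then have "v \<in> AL (Suc i) G inp B \<longleftrightarrow> v \<in> AL (Suc i) G' inp' B'" "LY (Suc i) G inp B v = LY (Suc i) G' inp' B' v"
    "v \<in> BR (Suc i) G inp B \<longleftrightarrow> v \<in> BR (Suc i) G' inp' B'"
    using loc(6)[of v] loc(7)[of v] loc(8)[of v] by (simp_all add: AL_def LY_def BR_def)
  then show ?thesis using bspec[OF eq nbh_refl] by (simp add: LR_def label_def)
qed

lemma step_zones:
  assumes eq: "\<forall>w\<in>nbh G kk v. (LR I G (inp, B) w) = LR I G' (inp', B') w"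
  shows "(LF 0 G (inp, B) v) = LF 0 G' (inp', B') v"
proof -
  note loc = label_local[OF agr eq[unfolded LR_def fst_conv snd_conv]]
  note sub = nbh_mono[OF kk_ge(5)]
  have E: "E G inp x = E G' inp' x \<and> depends (blk G s h x) (E G inp x)" if "x \<in> nbh G (2 * (r + s) + s) v" for x
    by (rule E_local[OF I1 I2 v1 v2 loc(1) that]) (use kk_ge(5) in linarith)
  have Br: "b \<in> BR I G inp B \<longleftrightarrow> b \<in> BR I G' inp' B'" if "b \<in> nbh G (r + s) v" for b
  proof -
    have "nbh G (r + s) v \<subseteq> nbh G kk v" using kk_ge(5) by (intro nbh_mono) simp
    then show ?thesis using loc(8) that by blast
  qed
  have "(v, i) \<in> S1 G inp B \<longleftrightarrow> (v, i) \<in> S1 G' inp' B'" "(v, i) \<in> B1 G inp B \<longleftrightarrow> (v, i) \<in> B1 G' inp' B'" for i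
    unfolding S1_def B1_def
    by (rule zones_local[OF InstD(1)[OF I1] InstD(1)[OF I2] v1 v2 agr_mono[OF agr kk_ge(5)] E
          eqon_mono[OF loc(3) sub] eqon_mono[OF loc(2) sub] Br BR_verts BR_verts]; assumption)+
  then show ?thesis using bspec[OF eq nbh_refl] by (simp add: LR_def LF_def label_def FE_def)
qed

lemma step_LF:
  assumes eq: "\<forall>w\<in>nbh G kk v. (LF i G (inp, B) w) = LF i G' (inp', B') w"
  shows "(LF (Suc i) G (inp, B) v) = LF (Suc i) G' (inp', B') v"
proof -
  note loc = label_local[OF agr eq[unfolded LF_def fst_conv snd_conv]]
  have "ST G inp B v = ST G' inp' B' v"
    unfolding ST_def
  proof (rule states_local)
    show "agr (r + T) G G' v" by (rule agr_mono[OF agr kk_ge(7)])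
    show "eqon (nbh G (r + T) v) (S1 G inp B) (S1 G' inp' B')" by (rule eqon_mono[OF loc(3) nbh_mono[OF kk_ge(7)]])
    show "out_list A n0 G inp (B1 G inp B) y = out_list A n0 G' inp' (B1 G' inp' B') y" if y: "y \<in> nbh G r v" for y
    proof (rule out_list_sim)
      show "sim T G inp G' inp' y" by (rule sim_sub[OF loc(1) y kk_ge(7)])
      have sub: "nbh G T y \<subseteq> nbh G kk v" using nbh_trans_le[OF y _ kk_ge(7)] by blast
      show "B1 G inp B \<inter> (nbh G T y \<times> {..<h}) = B1 G' inp' B' \<inter> (nbh G T y \<times> {..<h})"
        by (rule eqon_Int[OF eqon_mono[OF loc(2) sub]])
    qed
    have "sim r G inp G' inp' v" by (rule sim_mono[OF loc(1)]) (use kk_ge(6) in simp)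
    then show "good_at P G inp v = good_at P G' inp' v"
      using good_at_sim[OF InstD(1)[OF I1] InstD(1)[OF I2] v1 v2] by blast
  qed
  moreover have sub: "nbh G 1 v \<subseteq> nbh G kk v" by (rule nbh_mono[OF kk_ge(8)])
  ultimately have "FE (Suc i) G inp B v = FE (Suc i) G' inp' B' v"
    unfolding FE_def
    by (intro feas_local agr_mono[OF agr kk_ge(6)])
      (use loc(5,7,8,9) in \<open>auto simp: FE_def subset_iff\<close>)
  then show ?thesis using bspec[OF eq nbh_refl] by (simp add: LF_def label_def)
qed

lemma step_LD:
  assumes eq: "\<forall>w\<in>nbh G kk v. (LD j G (inp, B) w) = LD j G' (inp', B') w"
  shows "(LD (Suc j) G (inp, B) v) = LD (Suc j) G' (inp', B') v"
proof -
  note loc = label_local[OF agr eq[unfolded LD_def fst_conv snd_conv]]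
  have sub: "nbh G 1 v \<subseteq> nbh G kk v" by (rule nbh_mono[OF kk_ge(8)])
  have "FE I G inp B v = FE I G' inp' B' v" by (rule loc(9)[OF nbh_refl])
  then have "PK (Suc j) G inp B v = PK (Suc j) G' inp' B' v"
    unfolding PK_def
    by (intro pick_local agr_mono[OF agr kk_ge(6)])
      (use loc(5,7,8,10) sub in \<open>auto simp: PK_def subset_iff\<close>)
  then show ?thesis using bspec[OF eq nbh_refl] by (simp add: LD_def label_def)
qed

lemma step_out:
  assumes eq: "\<forall>w\<in>nbh G kk v. (LD I G (inp, B) w) = LD I G' (inp', B') w"
  shows "OUT G inp B v = OUT G' inp' B' v"
proof -
  note loc = label_local[OF agr eq[unfolded LD_def fst_conv snd_conv]]
  have T: "T \<le> kk" using kk_ge(7) by simp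
  have "out_list A n0 G inp (B1 G inp B) v = out_list A n0 G' inp' (B1 G' inp' B') v"
    by (rule out_list_sim[OF sim_mono[OF loc(1) T] eqon_Int[OF eqon_mono[OF loc(2) nbh_mono[OF T]]]])
  then show ?thesis using loc(5)[of v] loc(10)[of v] by (simp add: OUT_def final_output_def)
qed

end

text \<open>From \<open>guesses\<close> a guess is only known to live on some ball, possibly one
  without \<open>v\<close>; its value at \<open>v\<close> is then the default.\<close>

lemma OUT_in: "(G, inp, B) \<in> Inst \<Longrightarrow> v \<in> verts G \<Longrightarrow> OUT G inp B v \<in> insert undefined outs"
proof -
  assume I: "(G, inp, B) \<in> Inst" and v: "v \<in> verts G"
  have "length (nbrs G v) \<le> \<Delta>" using InstD(1)[OF I] v by (simp add: bgraph_def max_deg_le_def)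
  moreover have "q v \<in> insert undefined outs" if "q \<in> guesses" for q
    using that unfolding guesses_def by (auto simp: PiE_def extensional_def Pi_def)
  ultimately show ?thesis using PK_in[OF I v] unfolding OUT_def final_output_def by (auto simp: outs_def)
qed

definition "total_rounds = (jc + K * h + 1 + I + 1 + I + I + 1) * (kk + 3)"

lemma program:
  assumes M: "finite labels" "card (names \<times> labels) \<le> M" "2 \<le> M"
    and outs: "finite outs" "card (names \<times> insert undefined outs) \<le> M"
    and N: "N = M ^ ((2 * \<Delta> + 1) ^ Suc kk)"
  shows "\<exists>prog (e0 :: nat \<times> ('i, 'o) label \<Rightarrow> nat) dec.
     length prog = total_rounds \<and> (\<forall>f\<in>set prog. \<forall>x ms. f x ms < N) \<and> e0 ` (names \<times> labels) \<subseteq> {..<N} \<and>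
     (\<forall>G inp B v. (G, inp, B) \<in> Inst \<longrightarrow> v \<in> verts G \<longrightarrow>
        dec (run G prog (\<lambda>v. e0 (v, start_label G inp B v)) v) = OUT G inp B v)"
proof -
  have MN: "M \<le> N" unfolding N using M(3) by (intro self_le_power) auto
  have "finite (names \<times> labels)" "card (names \<times> labels) \<le> N" using M MN by auto
  from ex_inj_on_card_le[OF this]
  obtain e0 where e0: "inj_on e0 (names \<times> labels)" "e0 ` (names \<times> labels) \<subseteq> {..<N}" by blast
  define ini where "ini G a v = e0 (v, start_label G (fst a) (snd a) v)" for G and a :: "(nat \<Rightarrow> nat \<Rightarrow> 'i) \<times> (nat \<times> nat) set" and v
  interpret instances Inst names N ini \<Delta>
  proof
    show "bgraph G \<Delta> \<and> verts G \<subseteq> names" if "(G, a) \<in> Inst" for G a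
      using that InstD by (cases a) blast
    show "0 < N" using MN M(3) by simp
  qed simp
  have start: "start_label G (fst a) (snd a) = LC 0 G a" for G and a :: "(nat \<Rightarrow> nat \<Rightarrow> 'i) \<times> (nat \<times> nat) set"
    by (simp add: start_label_def LC_def C_def)
  have c0: "comp 0 (LC 0) labels"
    unfolding computes_def using labels_in(1)[OF _ _ order_refl] e0
    by (auto intro!: exI[of _ "[]"] exI[of _ e0] simp: ini_def start)
  have Nle: "M ^ ((2 * \<Delta> + 1) ^ Suc kk) \<le> N" using N by simp
  have c1: "comp (0 + jc * (kk + 3)) (LC jc) labels"
  proof (rule computes_iterate[where \<Lambda> = LC, OF c0 M Nle])
    fix j G a G' a' v
    show "LC (Suc j) G a v = LC (Suc j) G' a' v" if "(G, a) \<in> Inst" "(G', a') \<in> Inst" "v \<in> verts G" "v \<in> verts G'"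
      "agr kk G G' v" "\<And>w. w \<in> nbh G kk v \<Longrightarrow> LC j G a w = LC j G' a' w"
      using that step_LC[of G "fst a" "snd a" G' "fst a'" "snd a'" v j] by simp
  qed (rule labels_in(1)[OF _ _ order_refl])
  have "LC jc = LP 0" by (intro ext) (simp add: LC_def LP_def presam_def cf_def)
  then have "comp (jc * (kk + 3)) (LP 0) labels" using c1 by simp
  then have c2: "comp (jc * (kk + 3) + (K * h) * (kk + 3)) (LP (K * h)) labels"
  proof (rule computes_iterate[where \<Lambda> = LP, OF _ M Nle])
    fix j G a G' a' v
    show "LP (Suc j) G a v = LP (Suc j) G' a' v" if "(G, a) \<in> Inst" "(G', a') \<in> Inst" "v \<in> verts G" "v \<in> verts G'"
      "agr kk G G' v" "\<And>w. w \<in> nbh G kk v \<Longrightarrow> LP j G a w = LP j G' a' w"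
      using that step_LP[of G "fst a" "snd a" G' "fst a'" "snd a'" v j] by simp
  qed (rule labels_in(2)[OF _ _ order_refl])
  have XN: "card (names \<times> labels) \<le> N" using M(2) MN by simp
  have c3: "comp (jc * (kk + 3) + (K * h) * (kk + 3) + (kk + 3)) (LR 0) labels"
  proof (rule computes_local[OF c2 M Nle])
    fix G a G' a' v
    show "LR 0 G a v = LR 0 G' a' v" if "(G, a) \<in> Inst" "(G', a') \<in> Inst" "v \<in> verts G" "v \<in> verts G'"
      "agr kk G G' v" "\<And>w. w \<in> nbh G kk v \<Longrightarrow> LP (K * h) G a w = LP (K * h) G' a' w"
      using that step_Z[of G "fst a" "snd a" G' "fst a'" "snd a'" v] by simp
  qed (use labels_in(3) M(1) XN in auto)
  have c4: "comp (jc * (kk + 3) + (K * h) * (kk + 3) + (kk + 3) + I * (kk + 3)) (LR I) labels"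
  proof (rule computes_iterate[where \<Lambda> = LR, OF c3 M Nle])
    fix j G a G' a' v
    show "LR (Suc j) G a v = LR (Suc j) G' a' v" if "(G, a) \<in> Inst" "(G', a') \<in> Inst" "v \<in> verts G" "v \<in> verts G'"
      "agr kk G G' v" "\<And>w. w \<in> nbh G kk v \<Longrightarrow> LR j G a w = LR j G' a' w"
      using that step_LR[of G "fst a" "snd a" G' "fst a'" "snd a'" v j] by simp
    show "LR (Suc j) G a v \<in> labels" if "j < I" "(G, a) \<in> Inst" "v \<in> verts G"
      using that by (intro labels_in(3)) auto
  qed
  have c5: "comp (jc * (kk + 3) + (K * h) * (kk + 3) + (kk + 3) + I * (kk + 3) + (kk + 3)) (LF 0) labels"
  proof (rule computes_local[OF c4 M Nle])
    fix G a G' a' v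
    show "LF 0 G a v = LF 0 G' a' v" if "(G, a) \<in> Inst" "(G', a') \<in> Inst" "v \<in> verts G" "v \<in> verts G'"
      "agr kk G G' v" "\<And>w. w \<in> nbh G kk v \<Longrightarrow> LR I G a w = LR I G' a' w"
      using that step_zones[of G "fst a" "snd a" G' "fst a'" "snd a'" v] by simp
  qed (use labels_in(4)[OF _ _ order_refl] M(1) XN in auto)
  have c6: "comp (jc * (kk + 3) + (K * h) * (kk + 3) + (kk + 3) + I * (kk + 3) + (kk + 3) + I * (kk + 3)) (LF I) labels"
  proof (rule computes_iterate[where \<Lambda> = LF, OF c5 M Nle])
    fix j G a G' a' v
    show "LF (Suc j) G a v = LF (Suc j) G' a' v" if "(G, a) \<in> Inst" "(G', a') \<in> Inst" "v \<in> verts G" "v \<in> verts G'"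
      "agr kk G G' v" "\<And>w. w \<in> nbh G kk v \<Longrightarrow> LF j G a w = LF j G' a' w"
      using that step_LF[of G "fst a" "snd a" G' "fst a'" "snd a'" v j] by simp
  qed (rule labels_in(4)[OF _ _ order_refl])
  have "LF I = LD 0" by (intro ext) (simp add: LF_def LD_def PK_def label_def)
  then have c7: "comp (jc * (kk + 3) + (K * h) * (kk + 3) + (kk + 3) + I * (kk + 3) + (kk + 3) + I * (kk + 3) + I * (kk + 3)) (LD I) labels"
    using c6
  proof (intro computes_iterate[where \<Lambda> = LD, OF _ M Nle])
    fix j G a G' a' v
    show "LD (Suc j) G a v = LD (Suc j) G' a' v" if "(G, a) \<in> Inst" "(G', a') \<in> Inst" "v \<in> verts G" "v \<in> verts G'"
      "agr kk G G' v" "\<And>w. w \<in> nbh G kk v \<Longrightarrow> LD j G a w = LD j G' a' w"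
      using that step_LD[of G "fst a" "snd a" G' "fst a'" "snd a'" v j] by simp
  qed (simp, rule labels_in(5)[OF _ _ order_refl])
  have c8: "comp (jc * (kk + 3) + (K * h) * (kk + 3) + (kk + 3) + I * (kk + 3) + (kk + 3) + I * (kk + 3) + I * (kk + 3) + (kk + 3))
      (\<lambda>G a. OUT G (fst a) (snd a)) (insert undefined outs)"
  proof (rule computes_local[OF c7 M Nle])
    fix G a G' a' v
    show "OUT G (fst a) (snd a) v = OUT G' (fst a') (snd a') v" if "(G, a) \<in> Inst" "(G', a') \<in> Inst" "v \<in> verts G" "v \<in> verts G'"
      "agr kk G G' v" "\<And>w. w \<in> nbh G kk v \<Longrightarrow> LD I G a w = LD I G' a' w"
      using that step_out[of G "fst a" "snd a" G' "fst a'" "snd a'" v] by simp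
    show "OUT G (fst a) (snd a) v \<in> insert undefined outs" if "(G, a) \<in> Inst" "v \<in> verts G"
      using that OUT_in by (cases a) auto
  qed (use outs MN in auto)
  then obtain prog e where prog: "length prog = jc * (kk + 3) + (K * h) * (kk + 3) + (kk + 3) + I * (kk + 3) + (kk + 3) + I * (kk + 3) + I * (kk + 3) + (kk + 3)"
    "\<forall>f\<in>set prog. \<forall>x ms. f x ms < N" "inj_on e (names \<times> insert undefined outs)"
    "\<And>G a v. (G, a) \<in> Inst \<Longrightarrow> v \<in> verts G \<Longrightarrow> run G prog (ini G a) v = e (v, OUT G (fst a) (snd a) v)"
    unfolding computes_def by fast
  define dec where "dec x = snd (inv_into (names \<times> insert undefined outs) e x)" for x
  have "dec (run G prog (\<lambda>v. e0 (v, start_label G inp B v)) v) = OUT G inp B v"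
    if I: "(G, inp, B) \<in> Inst" and v: "v \<in> verts G" for G inp B v
  proof -
    have "(\<lambda>v. e0 (v, start_label G inp B v)) = ini G (inp, B)" by (simp add: ini_def fun_eq_iff)
    then have "run G prog (\<lambda>v. e0 (v, start_label G inp B v)) v = e (v, OUT G inp B v)" using prog(4)[OF I v] by simp
    moreover have "(v, OUT G inp B v) \<in> names \<times> insert undefined outs" using OUT_in[OF I v] InstD(2)[OF I] v by blast
    ultimately show ?thesis unfolding dec_def by (simp add: inv_into_f_f[OF prog(3)])
  qed
  moreover have "length prog = total_rounds" unfolding prog(1) total_rounds_def by (simp add: algebra_simps)
  ultimately show ?thesis using prog(2) e0(2) by blast
qed

end

section \<open>The number of labels\<close>

lemma finite_lists_le: "finite {l :: 'x::finite list. length l \<le> n}"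
  using finite_lists_length_le[of "UNIV :: 'x set" n] by simp

context scheme
begin

definition "bsz = (\<Delta> + 2) ^ r"
text \<open>Collects the factors that depend neither on \<open>l\<close> nor on \<open>I\<close>, so
  it is the same for every \<open>n\<close>. The summands \<open>card outs + 3\<close> make room for
  output labels and for the lower bound 2.\<close>

definition "kap = card {il :: 'i list. length il \<le> \<Delta>} * 2 ^ h * 2 ^ h * 8 * 2 ^ (card outs ^ bsz) * card outs ^ bsz * 2 ^ (2 * bsz)
  + card outs + 3"
text \<open>The power of \<open>2 ^ l\<close> has four sources: the name, the colour, and the balls
  underlying the guess set and the guess.\<close>

definition "label_bound = kap * (I + 1) * (2 ^ l) ^ (2 + 2 * bsz)"

lemma finite_outs: "finite outs"
  unfolding outs_def by (rule finite_lists_le)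

lemma card_outs: "1 \<le> card outs"
proof -
  have "[] \<in> outs" by (simp add: outs_def)
  then show ?thesis using finite_outs by (metis One_nat_def Suc_leI card_gt_0_iff empty_iff)
qed

lemma balls_bound: "finite balls" "card balls \<le> 2 ^ bsz * (2 ^ l) ^ bsz"
proof -
  have b: "finite balls \<and> card balls \<le> (2 ^ l + 1) ^ bsz"
    using card_small_subsets[of names bsz] by (simp add: balls_def bsz_def)
  then show "finite balls" by simp
  have "(2 ^ l + 1 :: nat) \<le> 2 * 2 ^ l" by simp
  then have "(2 ^ l + 1 :: nat) ^ bsz \<le> (2 * 2 ^ l) ^ bsz" by (rule power_mono) simp
  then show "card balls \<le> 2 ^ bsz * (2 ^ l) ^ bsz" using b by (simp add: power_mult_distrib)
qed

lemma PiE_outs: "W \<in> balls \<Longrightarrow> finite (PiE W (\<lambda>_. outs)) \<and> card (PiE W (\<lambda>_. outs)) \<le> card outs ^ bsz"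
proof -
  assume W: "W \<in> balls"
  then have fin: "finite W" using finite_subset by (auto simp: balls_def)
  moreover have "card W \<le> bsz" using W by (simp add: balls_def bsz_def)
  ultimately show ?thesis
    using finite_outs card_outs by (simp add: finite_PiE card_PiE power_increasing)
qed

lemma guesses_bound: "finite guesses" "card guesses \<le> 2 ^ bsz * (2 ^ l) ^ bsz * card outs ^ bsz"
proof -
  show "finite guesses" unfolding guesses_def using balls_bound(1) PiE_outs by blast
  have "card guesses \<le> (\<Sum>W\<in>balls. card (PiE W (\<lambda>_. outs)))"
    unfolding guesses_def by (rule card_UN_le[OF balls_bound(1)])
  also have "\<dots> \<le> (\<Sum>W\<in>balls. card outs ^ bsz)" using PiE_outs by (intro sum_mono) blast
  also have "\<dots> = card balls * card outs ^ bsz" by simp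
  also have "\<dots> \<le> 2 ^ bsz * (2 ^ l) ^ bsz * card outs ^ bsz" using balls_bound(2) by (rule mult_right_mono) simp
  finally show "card guesses \<le> 2 ^ bsz * (2 ^ l) ^ bsz * card outs ^ bsz" .
qed

lemma guess_sets_bound: "finite guess_sets" "card guess_sets \<le> 2 ^ bsz * (2 ^ l) ^ bsz * 2 ^ (card outs ^ bsz)"
proof -
  show "finite guess_sets" unfolding guess_sets_def using balls_bound(1) PiE_outs by blast
  have "card guess_sets \<le> (\<Sum>W\<in>balls. card (Pow (PiE W (\<lambda>_. outs))))"
    unfolding guess_sets_def by (rule card_UN_le[OF balls_bound(1)])
  also have "\<dots> \<le> (\<Sum>W\<in>balls. 2 ^ (card outs ^ bsz))" using PiE_outs
    by (intro sum_mono) (simp add: card_Pow power_increasing)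
  also have "\<dots> = card balls * 2 ^ (card outs ^ bsz)" by simp
  also have "\<dots> \<le> 2 ^ bsz * (2 ^ l) ^ bsz * 2 ^ (card outs ^ bsz)" using balls_bound(2) by (rule mult_right_mono) simp
  finally show "card guess_sets \<le> 2 ^ bsz * (2 ^ l) ^ bsz * 2 ^ (card outs ^ bsz)" .
qed

lemma labels_bound: "finite labels" "card (names \<times> labels) \<le> label_bound" "2 \<le> label_bound"
    "card (names \<times> insert undefined outs) \<le> label_bound"
proof -
  show "finite labels"
    unfolding labels_def by (intro finite_cartesian_product finite_lists_le guesses_bound(1) guess_sets_bound(1)) simp_all
  define ci where "ci = card {il :: 'i list. length il \<le> \<Delta>}"
  define NN where "NN = (2::nat) ^ l"
  have NN1: "1 \<le> NN" by (simp add: NN_def)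
  have "card (names \<times> labels) = NN * (ci * (2 ^ h * (NN * (2 ^ h * (2 * (2 * ((I + 1) * (2 * (card guess_sets * card guesses)))))))))"
    unfolding labels_def ci_def NN_def by (simp add: card_cartesian_product card_Pow)
  also have "\<dots> \<le> NN * (ci * (2 ^ h * (NN * (2 ^ h * (2 * (2 * ((I + 1) * (2 *
      ((2 ^ bsz * NN ^ bsz * 2 ^ (card outs ^ bsz)) * (2 ^ bsz * NN ^ bsz * card outs ^ bsz))))))))))"
    using guesses_bound(2) guess_sets_bound(2) unfolding NN_def by (intro mult_le_mono order_refl)
  also have "\<dots> = (ci * 2 ^ h * 2 ^ h * 8 * 2 ^ (card outs ^ bsz) * card outs ^ bsz * 2 ^ (2 * bsz)) * (I + 1) * NN ^ (2 + 2 * bsz)"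
  proof -
    have 1: "(2::nat) ^ (2 * bsz) = 2 ^ bsz * 2 ^ bsz" by (simp add: mult_2 power_add)
    have 2: "NN ^ (2 + 2 * bsz) = NN * NN * (NN ^ bsz * NN ^ bsz)" by (simp add: mult_2 power_add power2_eq_square)
    have 3: "(8::nat) = 2 * 2 * 2" by simp
    show ?thesis unfolding 1 2 3 by (simp only: mult_ac)
  qed
  also have "\<dots> \<le> kap * (I + 1) * NN ^ (2 + 2 * bsz)"
    unfolding kap_def ci_def by (intro mult_le_mono order_refl) simp
  finally show "card (names \<times> labels) \<le> label_bound" unfolding label_bound_def NN_def .
  have NNp: "1 \<le> NN ^ (1 + 2 * bsz)" using NN1 by (rule one_le_power)
  have ge: "kap * NN \<le> label_bound"
  proof -
    have "kap * NN * 1 \<le> kap * NN * ((I + 1) * NN ^ (1 + 2 * bsz))" using NNp by (intro mult_le_mono) (auto simp: Suc_le_eq)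
    also have "\<dots> = label_bound" unfolding label_bound_def NN_def[symmetric] by (simp add: algebra_simps)
    finally show ?thesis by simp
  qed
  have "card (names \<times> insert undefined outs) \<le> NN * (card outs + 1)"
    unfolding card_cartesian_product NN_def using card_insert_le_m1[of "card outs + 1" outs undefined] by (intro mult_le_mono) auto
  also have "\<dots> \<le> NN * kap" unfolding kap_def by (intro mult_le_mono) auto
  finally show "card (names \<times> insert undefined outs) \<le> label_bound" using ge by (simp add: mult.commute)
  have "2 * 1 \<le> kap * NN" using NN1 unfolding kap_def by (intro mult_le_mono) auto
  then show "2 \<le> label_bound" using ge by simp
qed

end

section \<open>Renaming the nodes\<close>

definition rename :: "(nat \<Rightarrow> nat) \<Rightarrow> pgraph \<Rightarrow> pgraph" where
  "rename \<alpha> G = \<lparr>verts = \<alpha> ` verts G, nbrs = \<lambda>x. map \<alpha> (nbrs G (inv_into (verts G) \<alpha> x))\<rparr>"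

definition rename_in :: "(nat \<Rightarrow> nat) \<Rightarrow> pgraph \<Rightarrow> (nat \<Rightarrow> nat \<Rightarrow> 'i) \<Rightarrow> nat \<Rightarrow> nat \<Rightarrow> 'i" where
  "rename_in \<alpha> G inp x y = inp (inv_into (verts G) \<alpha> x) (inv_into (verts G) \<alpha> y)"

locale renaming = bgraph +
  fixes \<alpha> :: "nat \<Rightarrow> nat"
  assumes inj: "inj_on \<alpha> (verts G)"
begin

abbreviation "G' \<equiv> rename \<alpha> G"

lemma rename_simps: "verts G' = \<alpha> ` verts G" "v \<in> verts G \<Longrightarrow> nbrs G' (\<alpha> v) = map \<alpha> (nbrs G v)"
  using inj by (simp_all add: rename_def)

lemma rename_in: "v \<in> verts G \<Longrightarrow> w \<in> verts G \<Longrightarrow> rename_in \<alpha> G inp (\<alpha> v) (\<alpha> w) = inp v w"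
  using inj by (simp add: rename_in_def)

lemma image_mem: "v \<in> verts G \<Longrightarrow> W \<subseteq> verts G \<Longrightarrow> \<alpha> v \<in> \<alpha> ` W \<longleftrightarrow> v \<in> W"
  using inj by (rule inj_on_image_mem_iff)

lemma nbrs_sub: "v \<in> verts G \<Longrightarrow> set (nbrs G v) \<subseteq> verts G"
  using nbrs_verts by blast

lemma adj_rename: "v \<in> verts G \<Longrightarrow> w \<in> verts G \<Longrightarrow> adj G' (\<alpha> v) (\<alpha> w) \<longleftrightarrow> adj G v w"
  using image_mem[of w "set (nbrs G v)"] nbrs_sub by (simp add: adj_def rename_simps)

lemma bgraph_rename: "bgraph G' \<Delta>"
proof
  show "max_deg_le G' \<Delta>" using deg by (auto simp: max_deg_le_def rename_simps)
  show "wf_pgraph G'"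
    unfolding wf_pgraph_def rename_simps(1)
  proof (intro conjI ballI)
    show "\<alpha> ` verts G \<noteq> {}" using wf by (simp add: wf_pgraph_def)
    fix x assume "x \<in> \<alpha> ` verts G"
    then obtain v where v: "x = \<alpha> v" "v \<in> verts G" by blast
    show "distinct (nbrs G' x)" using v nbrs_distinct nbrs_sub inj
      by (auto simp: rename_simps distinct_map intro: inj_on_subset)
    show "x \<notin> set (nbrs G' x)" using v image_mem[OF v(2) nbrs_sub[OF v(2)]] nbrs_irrefl by (simp add: rename_simps)
    show "set (nbrs G' x) \<subseteq> \<alpha> ` verts G" using v nbrs_sub by (auto simp: rename_simps)
    fix u assume "u \<in> set (nbrs G' x)"
    then obtain w where w: "u = \<alpha> w" "w \<in> set (nbrs G v)" using v by (auto simp: rename_simps)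
    have "w \<in> verts G" "v \<in> set (nbrs G w)" using nbrs_verts[OF v(2) w(2)] nbrs_sym[OF v(2) w(2)] by blast+
    then show "x \<in> set (nbrs G' u)" unfolding v(1) w(1) by (simp add: rename_simps(2))
  qed simp
qed

lemma nbh_rename: "v \<in> verts G \<Longrightarrow> nbh G' k (\<alpha> v) = \<alpha> ` nbh G k v"
proof (induction k)
  case (Suc k)
  have "insert (\<alpha> u) (set (nbrs G' (\<alpha> u))) = \<alpha> ` insert u (set (nbrs G u))" if "u \<in> nbh G k v" for u
    using that nbh_verts[OF Suc.prems, of k] by (auto simp: rename_simps)
  then show ?case using Suc by (auto simp: nbh.simps(2) image_UN)
qed simp

lemma port_rename:
  assumes v: "v \<in> verts G" and w: "w \<in> set (nbrs G v)"
  shows "port_of G' (\<alpha> v) (\<alpha> w) = port_of G v w"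
proof -
  have "(j < length (nbrs G' (\<alpha> v)) \<and> nbrs G' (\<alpha> v) ! j = \<alpha> w) \<longleftrightarrow> (j < length (nbrs G v) \<and> nbrs G v ! j = w)" for j
  proof (cases "j < length (nbrs G v)")
    case True
    then have "nbrs G v ! j \<in> verts G" "w \<in> verts G" using nbrs_sub[OF v] w by auto
    then have "\<alpha> (nbrs G v ! j) = \<alpha> w \<longleftrightarrow> nbrs G v ! j = w" by (rule inj_on_eq_iff[OF inj])
    then show ?thesis using True v by (simp add: rename_simps)
  qed (use v in \<open>simp add: rename_simps\<close>)
  then show ?thesis by (simp add: port_of_def)
qed

lemma tree_rename:
  assumes tree: "is_tree G"
  shows "is_tree G'"
proof -
  have "(adj G')\<^sup>*\<^sup>* (\<alpha> v) (\<alpha> w)" if "(adj G)\<^sup>*\<^sup>* v w" "v \<in> verts G" for v w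
    using that
  proof (induction rule: rtranclp_induct)
    case (step w w')
    have "w \<in> verts G" "w' \<in> verts G" using step(2) nbrs_verts by (auto simp: adj_def)
    then have "adj G' (\<alpha> w) (\<alpha> w')" using adj_rename step(2) by blast
    then show ?case using step by auto
  qed simp
  then have "connected_pg G'" using tree by (auto simp: is_tree_def connected_pg_def rename_simps)
  moreover have "\<not> is_cycle G' cs" for cs
  proof
    assume c: "is_cycle G' cs"
    define ds where "ds = map (inv_into (verts G) \<alpha>) cs"
    have V: "set ds \<subseteq> verts G" using c unfolding ds_def is_cycle_def rename_simps by (auto intro: inv_into_into)
    have cs: "cs = map \<alpha> ds" unfolding ds_def using c
      by (auto simp: is_cycle_def rename_simps f_inv_into_f subset_iff intro!: nth_equalityI)
    have len: "length ds = length cs" by (simp add: ds_def)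
    have "is_cycle G ds"
      unfolding is_cycle_def
    proof (intro conjI allI impI)
      show "3 \<le> length ds" using c len by (simp add: is_cycle_def)
      show "distinct ds" using c unfolding is_cycle_def cs by (simp add: distinct_map)
      show "set ds \<subseteq> verts G" by (rule V)
      fix i assume i: "i < length ds"
      let ?j = "(i + 1) mod length ds"
      have j: "?j < length ds" using i by (intro mod_less_divisor) auto
      have "adj G' (cs ! i) (cs ! ((i + 1) mod length cs))" using c i len by (simp add: is_cycle_def)
      then have "adj G' (\<alpha> (ds ! i)) (\<alpha> (ds ! ?j))" unfolding len[symmetric] using i j cs by simp
      moreover have "ds ! i \<in> verts G" "ds ! ?j \<in> verts G" using V i j by (meson nth_mem subsetD)+
      ultimately show "adj G (ds ! i) (ds ! ?j)" using adj_rename by blast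
    qed
    then show False using tree by (auto simp: is_tree_def)
  qed
  ultimately show ?thesis using bgraph_rename by (simp add: is_tree_def bgraph_def)
qed

text \<open>Renaming keeps the order of neighbour lists, so port numbers and with them the output
  lists carry over.\<close>

lemma good_at_rename:
  assumes v: "v \<in> verts G" and good: "good_at P G' (rename_in \<alpha> G inp) (\<alpha> v) f"
  shows "\<exists>H\<in>constraints P. ball_iso G inp (\<lambda>x y. f (\<alpha> x) ! port_of G x y) (radius P) v H"
proof -
  interpret R: bgraph G' \<Delta> by (rule bgraph_rename)
  obtain H g where H: "H \<in> constraints P"
    and g: "bij_betw g {w. in_ball G' (radius P) (\<alpha> v) w} (lverts H)" "g (\<alpha> v) = lcenter H"
      "\<And>x y. in_ball G' (radius P) (\<alpha> v) x \<Longrightarrow> in_ball G' (radius P) (\<alpha> v) y \<Longrightarrow>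
         (adj G' x y \<longleftrightarrow> ladj H (g x) (g y)) \<and>
         (adj G' x y \<longrightarrow> rename_in \<alpha> G inp x y = llin H (g x) (g y) \<and> f x ! port_of G' x y = llout H (g x) (g y))"
    using good unfolding good_at_def ball_iso_def by blast
  have \<alpha>v: "\<alpha> v \<in> verts G'" using v by (simp add: rename_simps)
  have sub: "nbh G (radius P) v \<subseteq> verts G" by (rule nbh_verts[OF v])
  have balls: "{w. in_ball G' (radius P) (\<alpha> v) w} = \<alpha> ` nbh G (radius P) v" "{w. in_ball G (radius P) v w} = nbh G (radius P) v"
    using R.in_ball_nbh[OF \<alpha>v] in_ball_nbh[OF v] nbh_rename[OF v] by auto
  have in_ball: "in_ball G' (radius P) (\<alpha> v) (\<alpha> w)" if "w \<in> nbh G (radius P) v" for w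
    using that balls(1) by blast
  have "ball_iso G inp (\<lambda>x y. f (\<alpha> x) ! port_of G x y) (radius P) v H"
    unfolding ball_iso_def balls(2)
  proof (intro exI[of _ "g \<circ> \<alpha>"] conjI ballI impI)
    show "bij_betw (g \<circ> \<alpha>) (nbh G (radius P) v) (lverts H)"
      using g(1) unfolding balls(1) by (rule bij_betw_trans[rotated]) (use inj sub in \<open>auto simp: bij_betw_def intro: inj_on_subset\<close>)
    show "(g \<circ> \<alpha>) v = lcenter H" using g(2) by simp
    fix x y assume xy: "x \<in> nbh G (radius P) v" "y \<in> nbh G (radius P) v"
    then have V: "x \<in> verts G" "y \<in> verts G" using sub by blast+
    note gxy = g(3)[OF in_ball[OF xy(1)] in_ball[OF xy(2)]]
    show "adj G x y = ladj H ((g \<circ> \<alpha>) x) ((g \<circ> \<alpha>) y)" using gxy adj_rename[OF V] by simp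
    assume a: "adj G x y"
    then have p: "port_of G' (\<alpha> x) (\<alpha> y) = port_of G x y" using port_rename[OF V(1)] by (simp add: adj_def)
    show "inp x y = llin H ((g \<circ> \<alpha>) x) ((g \<circ> \<alpha>) y)" using gxy a adj_rename[OF V] by (simp add: rename_in[OF V])
    show "f (\<alpha> x) ! port_of G x y = llout H ((g \<circ> \<alpha>) x) ((g \<circ> \<alpha>) y)" using gxy a adj_rename[OF V] p by simp
  qed
  then show ?thesis using H by blast
qed

end

section \<open>Counting random strings\<close>

lemma finite_rand_space: "finite (verts G) \<Longrightarrow> finite (rand_space G h)"
  unfolding rand_space_def using finite_lists_length_eq[of "UNIV :: bool set" h] by (intro finite_PiE) auto

lemma card_rand_space_power: "finite (verts G) \<Longrightarrow> card (rand_space G h) = (2 ^ h) ^ card (verts G)"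
  by (simp add: card_rand_space card_cartesian_product power_mult[symmetric] mult.commute)

text \<open>The string of \<open>u\<close> can be recovered from that of \<open>v\<close>, so
  forgetting it is injective.\<close>

lemma card_collision:
  assumes fin: "finite (verts G)" and uv: "u \<in> verts G" "v \<in> verts G" "u \<noteq> v"
  shows "card {a \<in> rand_space G l. a u = a v} * 2 ^ l \<le> card (rand_space G l)"
proof -
  let ?S = "PiE (verts G - {u}) (\<lambda>_. {bs :: bool list. length bs = l})"
  let ?f = "\<lambda>a. restrict a (verts G - {u})"
  have cl: "card {bs :: bool list. length bs = l} = 2 ^ l"
    using card_lists_length_eq[of "UNIV :: bool set" l] by simp
  have finL: "finite {bs :: bool list. length bs = l}" using finite_lists_length_eq[of "UNIV :: bool set" l] by simp
  have "inj_on ?f {a \<in> rand_space G l. a u = a v}"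
  proof (rule inj_onI)
    fix a b assume a: "a \<in> {a \<in> rand_space G l. a u = a v}" and b: "b \<in> {a \<in> rand_space G l. a u = a v}" and eq: "?f a = ?f b"
    have same: "a x = b x" if "x \<in> verts G - {u}" for x using fun_cong[OF eq, of x] that by simp
    show "a = b"
    proof
      fix x
      show "a x = b x"
      proof (cases "x \<in> verts G")
        case True
        then show ?thesis using same[of x] same[of v] a b uv by (cases "x = u") auto
      next
        case False
        then show ?thesis using a b by (auto simp: rand_space_def PiE_iff extensional_def)
      qed
    qed
  qed
  then have "card {a \<in> rand_space G l. a u = a v} = card (?f ` {a \<in> rand_space G l. a u = a v})"
    by (simp add: card_image)
  also have "\<dots> \<le> card ?S"
  proof (rule card_mono)
    show "finite ?S" using fin finL by (intro finite_PiE) auto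
    show "?f ` {a \<in> rand_space G l. a u = a v} \<subseteq> ?S"
      by (rule image_subsetI) (simp add: restrict_PiE_iff, auto simp: rand_space_def PiE_iff)
  qed
  also have "\<dots> = (2 ^ l) ^ (card (verts G) - 1)" using fin uv cl by (simp add: card_PiE)
  finally have "card {a \<in> rand_space G l. a u = a v} * 2 ^ l \<le> (2 ^ l) ^ (card (verts G) - 1) * 2 ^ l" by simp
  also have "\<dots> = (2 ^ l) ^ Suc (card (verts G) - 1)" by simp
  also have "Suc (card (verts G) - 1) = card (verts G)" using fin uv(1) by (metis One_nat_def Suc_pred card_gt_0_iff empty_iff)
  finally show ?thesis using fin by (simp add: card_rand_space_power)
qed

lemma card_not_inj:
  assumes fin: "finite (verts G)"
  shows "real (card {a \<in> rand_space G l. \<not> inj_on a (verts G)}) \<le> card (verts G) ^ 2 / 2 ^ l * card (rand_space G l)"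
proof -
  let ?Q = "{p \<in> verts G \<times> verts G. fst p \<noteq> snd p}"
  let ?C = "\<lambda>p. {a \<in> rand_space G l. a (fst p) = a (snd p)}"
  have finQ: "finite ?Q" using fin by simp
  have cQ: "card ?Q \<le> card (verts G) ^ 2"
    using card_mono[of "verts G \<times> verts G" ?Q] fin by (auto simp: card_cartesian_product power2_eq_square)
  have finC: "finite (?C p)" for p using finite_rand_space[OF fin] by simp
  have "{a \<in> rand_space G l. \<not> inj_on a (verts G)} \<subseteq> (\<Union>p\<in>?Q. ?C p)"
    by (auto simp: inj_on_def)
  then have "card {a \<in> rand_space G l. \<not> inj_on a (verts G)} \<le> card (\<Union>p\<in>?Q. ?C p)"
    using finQ finC by (intro card_mono) blast+
  also have "\<dots> \<le> (\<Sum>p\<in>?Q. card (?C p))" by (rule card_UN_le[OF finQ])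
  finally have "real (card {a \<in> rand_space G l. \<not> inj_on a (verts G)}) \<le> real (\<Sum>p\<in>?Q. card (?C p))"
    by (rule of_nat_mono)
  also have "\<dots> = (\<Sum>p\<in>?Q. real (card (?C p)))" by simp
  also have "\<dots> \<le> (\<Sum>p\<in>?Q. real (card (rand_space G l)) / 2 ^ l)"
  proof (rule sum_mono)
    fix p assume "p \<in> ?Q"
    then have "real (card (?C p) * 2 ^ l) \<le> real (card (rand_space G l))"
      using card_collision[OF fin, of "fst p" "snd p" l] by (intro of_nat_mono) auto
    then show "real (card (?C p)) \<le> real (card (rand_space G l)) / 2 ^ l"
      by (simp add: field_simps)
  qed
  also have "\<dots> = real (card ?Q) * (real (card (rand_space G l)) / 2 ^ l)" by simp
  also have "\<dots> \<le> real (card (verts G) ^ 2) * (real (card (rand_space G l)) / 2 ^ l)"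
    using cQ by (intro mult_right_mono of_nat_mono) auto
  finally show ?thesis by simp
qed

text \<open>The first \<open>l\<close> bits of a node form its name, the others are sampled. For
  each injective choice of names, \<open>bad\<close> bounds the conditional failure; the remaining
  choices are covered by \<open>card_not_inj\<close>.\<close>

lemma split_rand_space:
  fixes \<epsilon> :: real
  assumes fin: "finite (verts G)" and \<epsilon>: "0 \<le> \<epsilon>"
    and bad: "\<And>a. a \<in> rand_space G l \<Longrightarrow> inj_on a (verts G) \<Longrightarrow>
      real (card {y \<in> rand_space G h. Q a y}) \<le> \<epsilon> * card (rand_space G h)"
    and sub: "\<And>rb. rb \<in> rand_space G (l + h) \<Longrightarrow> F rb \<Longrightarrow> inj_on (\<lambda>v. take l (rb v)) (verts G) \<Longrightarrow>
      Q (restrict (\<lambda>v. take l (rb v)) (verts G)) (restrict (\<lambda>v. drop l (rb v)) (verts G))"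
  shows "real (card {rb \<in> rand_space G (l + h). F rb}) / card (rand_space G (l + h)) \<le> card (verts G) ^ 2 / 2 ^ l + \<epsilon>"
proof -
  let ?R = "rand_space G (l + h)" and ?R1 = "rand_space G l" and ?R2 = "rand_space G h"
  let ?N = "{a \<in> ?R1. \<not> inj_on a (verts G)}" and ?Y = "{a \<in> ?R1. inj_on a (verts G)}"
  let ?f = "\<lambda>rb. (restrict (\<lambda>v. take l (rb v)) (verts G), restrict (\<lambda>v. drop l (rb v)) (verts G))"
  have fin1: "finite ?R1" "finite ?R2" using finite_rand_space[OF fin] by blast+
  have inj: "inj_on ?f ?R"
  proof (rule inj_onI)
    fix a b assume a: "a \<in> ?R" and b: "b \<in> ?R" and eq: "?f a = ?f b"
    show "a = b"
    proof
      fix x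
      show "a x = b x"
      proof (cases "x \<in> verts G")
        case True
        then have "take l (a x) = take l (b x)" "drop l (a x) = drop l (b x)"
          using eq by (auto dest: fun_cong[of _ _ x])
        then show ?thesis by (metis append_take_drop_id)
      next
        case False
        then show ?thesis using a b by (auto simp: rand_space_def PiE_iff extensional_def)
      qed
    qed
  qed
  have mem: "?f rb \<in> ?R1 \<times> ?R2" if "rb \<in> ?R" for rb
    using that by (auto simp: rand_space_def PiE_iff)
  have "?f ` {rb \<in> ?R. F rb} \<subseteq> (?N \<times> ?R2) \<union> (SIGMA a:?Y. {y \<in> ?R2. Q a y})"
  proof
    fix p assume "p \<in> ?f ` {rb \<in> ?R. F rb}"
    then obtain rb where rb: "p = ?f rb" "rb \<in> ?R" "F rb" by blast
    have "inj_on (restrict (\<lambda>v. take l (rb v)) (verts G)) (verts G) \<longleftrightarrow> inj_on (\<lambda>v. take l (rb v)) (verts G)"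
      by (rule inj_on_cong) simp
    then show "p \<in> (?N \<times> ?R2) \<union> (SIGMA a:?Y. {y \<in> ?R2. Q a y})"
      using mem[OF rb(2)] sub[OF rb(2,3)] unfolding rb(1) by auto
  qed
  then have "card (?f ` {rb \<in> ?R. F rb}) \<le> card ((?N \<times> ?R2) \<union> (SIGMA a:?Y. {y \<in> ?R2. Q a y}))"
    using fin1 by (intro card_mono) auto
  also have "\<dots> \<le> card (?N \<times> ?R2) + card (SIGMA a:?Y. {y \<in> ?R2. Q a y})" by (rule card_Un_le)
  also have "\<dots> = card ?N * card ?R2 + (\<Sum>a\<in>?Y. card {y \<in> ?R2. Q a y})"
    using fin1 by (simp add: card_cartesian_product card_SigmaI)
  finally have "card {rb \<in> ?R. F rb} \<le> card ?N * card ?R2 + (\<Sum>a\<in>?Y. card {y \<in> ?R2. Q a y})"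
    using inj by (subst (asm) card_image) (auto intro: inj_on_subset)
  then have "real (card {rb \<in> ?R. F rb}) \<le> real (card ?N * card ?R2 + (\<Sum>a\<in>?Y. card {y \<in> ?R2. Q a y}))" by (rule of_nat_mono)
  also have "\<dots> = real (card ?N) * card ?R2 + (\<Sum>a\<in>?Y. real (card {y \<in> ?R2. Q a y}))" by simp
  also have "\<dots> \<le> (card (verts G) ^ 2 / 2 ^ l * card ?R1) * card ?R2 + (\<Sum>a\<in>?Y. \<epsilon> * card ?R2)"
    using card_not_inj[OF fin, of l] bad by (intro add_mono mult_right_mono sum_mono) auto
  also have "(\<Sum>a\<in>?Y. \<epsilon> * card ?R2) \<le> \<epsilon> * (card ?R1 * card ?R2)"
    using card_mono[OF fin1(1), of ?Y] \<epsilon> by (auto intro!: mult_left_mono mult_right_mono simp: mult.left_commute)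
  finally have "real (card {rb \<in> ?R. F rb}) \<le> (card (verts G) ^ 2 / 2 ^ l + \<epsilon>) * (card ?R1 * card ?R2)"
    by (simp add: algebra_simps)
  also have "card ?R1 * card ?R2 = card ?R"
    by (simp add: card_rand_space_power[OF fin] power_add power_mult_distrib)
  finally show ?thesis
    using card_rand_space_power[OF fin, of "l + h"] by (simp add: pos_divide_le_eq)
qed

section \<open>From random strings to initial labels\<close>

lemma dec_msg_less: "length bs = l \<Longrightarrow> dec_msg bs < 2 ^ l"
  unfolding dec_msg_def using horner_sum_of_bool_2_less[of bs] by simp

lemma enc_dec_msg: "length bs = l \<Longrightarrow> enc_msg l (dec_msg bs) = bs"
  by (rule nth_equalityI) (simp_all add: enc_msg_def dec_msg_def bit_horner_sum_bit_iff)

lemma dec_msg_inj: "length bs = length bs' \<Longrightarrow> dec_msg bs = dec_msg bs' \<Longrightarrow> bs = bs'"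
  using enc_dec_msg by metis

definition node_label :: "nat \<Rightarrow> nat \<Rightarrow> 'i list \<Rightarrow> bool list \<Rightarrow> nat \<times> ('i, 'o) label" where
  "node_label l h il bs =
     (dec_msg (take l bs), il, {i. i < h \<and> bs ! (l + i)}, dec_msg (take l bs), {}, False, False, 0, False, {}, \<lambda>_. undefined)"

text \<open>The cut-off makes the bound \<open>N\<close> hold for every argument, even for strings
  that do not come from an instance.\<close>

definition start_value :: "nat \<Rightarrow> (nat \<times> ('i, 'o) label \<Rightarrow> nat) \<Rightarrow> nat \<Rightarrow> nat \<Rightarrow> 'i list \<Rightarrow> bool list \<Rightarrow> nat" where
  "start_value N e0 l h il bs = (if e0 (node_label l h il bs) < N then e0 (node_label l h il bs) else 0)"

definition name_bits :: "pgraph \<Rightarrow> nat \<Rightarrow> (nat \<Rightarrow> nat) \<Rightarrow> (nat \<Rightarrow> bool list) \<Rightarrow> (nat \<times> nat) set" where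
  "name_bits G h \<alpha> y = {(\<alpha> u, i) | u i. u \<in> verts G \<and> i < h \<and> y u ! i}"

context scheme
begin

abbreviation "is_shattered G inp B \<equiv> sampling.shattered G s h (E G inp) \<theta> (cf G) K z L B"

text \<open>For fixed injective names the sampling bits are still uniform, and the run is an
  execution on a renamed instance, which is correct unless its region fails to shatter. The two
  terms of the bound stand for colliding names and for failed shattering.\<close>

lemma failure_bound:
  assumes prog: "e0 ` (names \<times> (labels :: ('i, 'o) label set)) \<subseteq> {..<N}"
      "\<And>G inp B v. (G, inp, B) \<in> Inst \<Longrightarrow> v \<in> verts G \<Longrightarrow>
        dec (run G prog (\<lambda>v. e0 (v, start_label G inp B v)) v) = OUT G inp B v"
    and G: "is_tree G" "max_deg_le G \<Delta>"
    and mm: "1 \<le> mm" "L = mm * (\<Delta> + 2) ^ (z + 2 * s)"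
    and ratio: "4 * ((\<Delta> + 2) ^ (2 * (2 * (z + 2 * s) + 1))) * (1 / real n0 / \<theta>) \<le> 1"
    and outp: "\<And>rb x y. outp rb x y =
        dec (run G prog (\<lambda>v. start_value N e0 l h (map (inp v) (nbrs G v)) (rb v)) x) ! port_of G x y"
  shows "real (card {rb \<in> rand_space G (l + h). \<not> lcl_solved P G inp (outp rb)}) / card (rand_space G (l + h))
    \<le> card (verts G) ^ 2 / 2 ^ l + card (verts G) / 4 ^ mm"
proof (rule split_rand_space)
  interpret bgraph G \<Delta> using G by (simp add: is_tree_def bgraph_def)
  define nm where "nm a v = dec_msg (a v)" for a :: "nat \<Rightarrow> bool list" and v :: nat
  define Q where "Q a y \<longleftrightarrow> \<not> is_shattered (rename (nm a) G) (rename_in (nm a) G inp) (name_bits G h (nm a) y)" for a y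
  show "finite (verts G)" "0 \<le> card (verts G) / 4 ^ mm" by simp_all
  \<comment> \<open>The instance with no bits serves to enter the sampling locale, which does not
    mention an assignment.\<close>
  have nm: "renaming G \<Delta> (nm a)" "\<And>y. y \<in> rand_space G h \<Longrightarrow> (rename (nm a) G, rename_in (nm a) G inp, name_bits G h (nm a) y) \<in> Inst"
    "(rename (nm a) G, rename_in (nm a) G inp, {}) \<in> Inst"
    if a: "a \<in> rand_space G l" "inj_on a (verts G)" for a
  proof -
    have len: "length (a v) = l" if "v \<in> verts G" for v using a(1) that by (auto simp: rand_space_def PiE_iff)
    have "inj_on (nm a) (verts G)"
      unfolding nm_def using a(2) len dec_msg_inj by (metis (no_types, lifting) inj_on_def)
    then show R: "renaming G \<Delta> (nm a)" by unfold_locales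
    interpret R: renaming G \<Delta> "nm a" by (rule R)
    have "is_tree R.G'" "max_deg_le R.G' \<Delta>" "verts R.G' \<subseteq> names"
      using R.tree_rename[OF G(1)] R.bgraph_rename dec_msg_less[OF len]
      by (auto simp: bgraph_def R.rename_simps nm_def)
    then show "(rename (nm a) G, rename_in (nm a) G inp, {}) \<in> Inst"
      "(rename (nm a) G, rename_in (nm a) G inp, name_bits G h (nm a) y) \<in> Inst" for y
      by (auto simp: Inst_def name_bits_def R.rename_simps)
  qed
  show "real (card {y \<in> rand_space G h. Q a y}) \<le> card (verts G) / 4 ^ mm * card (rand_space G h)"
    if a: "a \<in> rand_space G l" "inj_on a (verts G)" for a
  proof -
    interpret R: renaming G \<Delta> "nm a" by (rule nm(1)[OF a])
    let ?inp = "rename_in (nm a) G inp"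
    interpret Sm: sampling R.G' \<Delta> s h "E R.G' ?inp" \<theta> "1 / real n0" "cf R.G'" K d
      by (rule sampling[OF nm(3)[OF a]])
    let ?X = "verts R.G' \<times> {..<h}"
    have cV: "card (verts R.G') = card (verts G)" using R.inj by (simp add: R.rename_simps card_image)
    have cX: "2 ^ card ?X = card (rand_space G h)"
      using cV by (simp add: card_rand_space_power card_cartesian_product power_mult[symmetric] mult.commute)
    have inj: "inj_on (name_bits G h (nm a)) {y \<in> rand_space G h. Q a y}"
    proof (rule inj_onI)
      fix y y' assume y: "y \<in> {y \<in> rand_space G h. Q a y}" "y' \<in> {y \<in> rand_space G h. Q a y}"
        and eq: "name_bits G h (nm a) y = name_bits G h (nm a) y'"
      have mem: "(nm a u, i) \<in> name_bits G h (nm a) w \<longleftrightarrow> w u ! i" if "u \<in> verts G" "i < h" for u i w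
        using that R.inj by (auto simp: name_bits_def inj_on_def)
      show "y = y'"
      proof
        fix u
        show "y u = y' u"
        proof (cases "u \<in> verts G")
          case True
          then have "length (y u) = h" "length (y' u) = h" using y by (auto simp: rand_space_def PiE_iff)
          moreover have "y u ! i = y' u ! i" if "i < h" for i
            using mem[OF True that, of y] mem[OF True that, of y'] eq by simp
          ultimately show ?thesis by (intro nth_equalityI) auto
        next
          case False
          then show ?thesis using y by (auto simp: rand_space_def PiE_iff extensional_def)
        qed
      qed
    qed
    have "card {y \<in> rand_space G h. Q a y} = card (name_bits G h (nm a) ` {y \<in> rand_space G h. Q a y})"
      by (rule card_image[OF inj, symmetric])
    also have "\<dots> \<le> card {B \<in> Pow ?X. \<not> is_shattered R.G' ?inp B}"
      by (rule card_mono) (auto simp: Q_def name_bits_def R.rename_simps)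
    finally have "real (card {y \<in> rand_space G h. Q a y}) \<le> real (card {B \<in> Pow ?X. \<not> is_shattered R.G' ?inp B})"
      by (rule of_nat_mono)
    also have "\<dots> = avg ?X (\<lambda>B. of_bool (\<not> is_shattered R.G' ?inp B)) {} * 2 ^ card ?X"
      by (simp add: avg_indicator)
    also have "\<dots> \<le> card (verts R.G') / 4 ^ mm * 2 ^ card ?X"
      using Sm.prob_not_shattered[OF mm(1) ratio] unfolding mm(2) by (intro mult_right_mono) auto
    also have "(2::real) ^ card ?X = card (rand_space G h)" unfolding cX[symmetric] by simp
    finally show ?thesis unfolding cV by simp
  qed
  fix rb assume rb: "rb \<in> rand_space G (l + h)" and unsolved: "\<not> lcl_solved P G inp (outp rb)"
    and inj: "inj_on (\<lambda>v. take l (rb v)) (verts G)"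
  define a where "a = restrict (\<lambda>v. take l (rb v)) (verts G)"
  define y where "y = restrict (\<lambda>v. drop l (rb v)) (verts G)"
  have len: "length (rb v) = l + h" if "v \<in> verts G" for v using rb that by (auto simp: rand_space_def PiE_iff)
  have a: "a \<in> rand_space G l" and y: "y \<in> rand_space G h"
    using len by (auto simp: a_def y_def rand_space_def)
  have a_inj: "inj_on a (verts G)" unfolding a_def using inj by (subst inj_on_cong[of _ _ "\<lambda>v. take l (rb v)"]) auto
  interpret R: renaming G \<Delta> "nm a" by (rule nm(1)[OF a a_inj])
  let ?inp = "rename_in (nm a) G inp" and ?B = "name_bits G h (nm a) y"
  have I: "(R.G', ?inp, ?B) \<in> Inst" by (rule nm(2)[OF a a_inj y])
  have "Q a y"
  proof (rule ccontr)
    assume "\<not> Q a y"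
    then have sh: "is_shattered R.G' ?inp ?B" by (simp add: Q_def)
    have lab: "start_value N e0 l h (map (inp v) (nbrs G v)) (rb v) = e0 (nm a v, start_label R.G' ?inp ?B (nm a v))"
      if v: "v \<in> verts G" for v
    proof -
      have "map (?inp (nm a v)) (nbrs R.G' (nm a v)) = map (inp v) (nbrs G v)"
        using v R.nbrs_sub[OF v] by (auto simp: R.rename_simps R.rename_in subset_iff)
      moreover have "{i. (nm a v, i) \<in> ?B} = {i. i < h \<and> rb v ! (l + i)}"
        using v R.inj len[OF v] by (auto simp: name_bits_def inj_on_def y_def)
      moreover have "nm a v = dec_msg (take l (rb v))" using v by (simp add: nm_def a_def)
      ultimately have eq: "node_label l h (map (inp v) (nbrs G v)) (rb v) = (nm a v, start_label R.G' ?inp ?B (nm a v))"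
        by (simp add: node_label_def start_label_def label_def)
      have v': "nm a v \<in> verts R.G'" using v by (simp add: R.rename_simps)
      have "start_label R.G' ?inp ?B (nm a v) \<in> (labels :: ('i, 'o) label set)"
        using labels_in(1)[OF I v' order_refl, of 0] by (simp add: LC_def C_def start_label_def)
      moreover have "nm a v \<in> names" using InstD(2)[OF I] v' by blast
      ultimately have "e0 (nm a v, start_label R.G' ?inp ?B (nm a v)) < N" using prog(1) by blast
      then show ?thesis unfolding start_value_def eq by simp
    qed
    have out: "outp rb x w = OUT R.G' ?inp ?B (nm a x) ! port_of G x w" if x: "x \<in> verts G" for x w
    proof -
      have x': "nm a x \<in> verts R.G'" using x by (simp add: R.rename_simps)
      have "run G prog (\<lambda>v. start_value N e0 l h (map (inp v) (nbrs G v)) (rb v)) x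
          = run R.G' prog (\<lambda>v. e0 (v, start_label R.G' ?inp ?B v)) (nm a x)"
        by (rule run_rename) (use x lab R.nbrs_sub R.rename_simps in auto)
      then show ?thesis unfolding outp by (simp add: prog(2)[OF I x'])
    qed
    have "\<exists>H\<in>constraints P. ball_iso G inp (outp rb) (radius P) v H" if v: "v \<in> verts G" for v
    proof -
      have v': "nm a v \<in> verts R.G'" using v by (simp add: R.rename_simps)
      obtain H where H: "H \<in> constraints P"
        "ball_iso G inp (\<lambda>x w. OUT R.G' ?inp ?B (nm a x) ! port_of G x w) (radius P) v H"
        using R.good_at_rename[OF v correct[OF I v' sh]] by blast
      have "ball_iso G inp (outp rb) (radius P) v H"
        using H(2) by (subst ball_iso_cong[where G' = G and inp' = inp
              and outp' = "\<lambda>x w. OUT R.G' ?inp ?B (nm a x) ! port_of G x w"]) (auto simp: out adj_def)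
      then show ?thesis using H(1) by blast
    qed
    then show False using unsolved by (simp add: lcl_solved_def)
  qed
  then show "Q (restrict (\<lambda>v. take l (rb v)) (verts G)) (restrict (\<lambda>v. drop l (rb v)) (verts G))"
    by (simp add: a_def y_def)
qed

end

section \<open>Choice of the parameters\<close>

text \<open>The little-o bound makes \<open>a ^ (51 * T n)\<close> at most the square root of
  \<open>n\<close>, as \<open>102 = 2 * 51\<close>; the fixed factor for \<open>r + 1\<close> and
  the factor 32 are absorbed by the other square root. The exponent 51 is the sum of 46, for the
  walks of the shattering bound, and 5, for the local lemma; correspondingly
  \<open>32 = 4 * 8\<close>.\<close>

lemma ex_base_size:
  fixes T :: "nat \<Rightarrow> nat" and a r :: nat
  assumes T: "(\<lambda>n. real (T n)) \<in> o(\<lambda>n. ln (real n))" and a: "2 \<le> a"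
  shows "\<exists>n. 32 * real a ^ (51 * (T n + r + 1)) \<le> real n"
proof -
  define q where "q = ln (real a)"
  have q: "0 < q" using a by (simp add: q_def)
  define C where "C = exp (51 * q * (real r + 1))"
  have C: "0 < C" by (simp add: C_def)
  have "eventually (\<lambda>n. norm (real (T n)) \<le> 1 / (102 * q) * norm (ln (real n))) sequentially"
    using landau_o.smallD[OF T, of "1 / (102 * q)"] q by simp
  moreover have "eventually (\<lambda>n::nat. 32 * C * exp (ln (real n) / 2) \<le> real n) sequentially"
    using C by real_asymp
  ultimately have "eventually (\<lambda>n. 1 \<le> n \<and> norm (real (T n)) \<le> 1 / (102 * q) * norm (ln (real n)) \<and>
      32 * C * exp (ln (real n) / 2) \<le> real n) sequentially"
    using eventually_ge_at_top[of "1::nat"] by eventually_elim auto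
  then obtain n where n: "1 \<le> n" "norm (real (T n)) \<le> 1 / (102 * q) * norm (ln (real n))"
    "32 * C * exp (ln (real n) / 2) \<le> real n"
    using eventually_happens by (metis (no_types, lifting) eventually_happens' sequentially_bot)
  have "real (T n) \<le> ln (real n) / (102 * q)" using n(1,2) by simp
  then have "51 * q * real (T n) \<le> 51 * q * (ln (real n) / (102 * q))" using q by (intro mult_left_mono) auto
  also have "\<dots> = ln (real n) / 2" using q by simp
  finally have le: "51 * q * real (T n) \<le> ln (real n) / 2" .
  have "real a ^ (51 * (T n + r + 1)) = exp (real (51 * (T n + r + 1)) * q)"
    using a unfolding q_def exp_of_nat_mult by simp
  also have "real (51 * (T n + r + 1)) * q = 51 * q * real (T n) + 51 * q * (real r + 1)"
    by (simp add: algebra_simps)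
  also have "exp \<dots> \<le> exp (ln (real n) / 2) * C" unfolding C_def exp_add using le by simp
  finally have "32 * real a ^ (51 * (T n + r + 1)) \<le> 32 * (exp (ln (real n) / 2) * C)" by simp
  also have "\<dots> = 32 * C * exp (ln (real n) / 2)" by simp
  finally have "32 * real a ^ (51 * (T n + r + 1)) \<le> 32 * C * exp (ln (real n) / 2)" .
  then show ?thesis using n(3) order_trans by blast
qed

lemma floor_log_le: "floor_log x \<le> x"
proof (cases "x = 0")
  case False
  have "floor_log x < 2 ^ floor_log x" by simp
  also have "\<dots> \<le> x" using False floor_log_exp2_le[of x] by simp
  finally show ?thesis by simp
qed simp

lemma floor_log_log: "1 \<le> x \<Longrightarrow> real (floor_log x) \<le> log 2 (real x)"
proof -
  assume "1 \<le> x"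
  then have "real (2 ^ floor_log x) \<le> real x" using floor_log_exp2_le[of x] by (intro of_nat_mono) simp
  then show ?thesis by (intro le_log_of_power) auto
qed

lemma floor_log_mult_le:
  assumes "1 \<le> b" "1 \<le> F" "real F \<le> log 2 (real n) + 1" "x \<le> b * F"
  shows "real (floor_log x) \<le> log 2 (real b) + log 2 (log 2 (real n) + 1)"
proof -
  have "real (floor_log x) \<le> real (floor_log (b * F))" using floor_log_le_iff[OF assms(4)] by simp
  also have "\<dots> \<le> log 2 (real (b * F))" using assms by (intro floor_log_log) (simp add: Suc_le_eq)
  also have "\<dots> = log 2 (real b) + log 2 (real F)" using assms by (simp add: log_mult)
  also have "\<dots> \<le> log 2 (real b) + log 2 (log 2 (real n) + 1)" using assms by simp
  finally show ?thesis .
qed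


theorem mainTheorem3:
  fixes P :: "('i::finite, 'o::finite) lcl"
    and c :: real and \<Delta> :: nat
    and A :: "('s, 'm, 'i, 'o) dalg"
  assumes "c \<ge> 1"
    and "is_lcl P"
    and "(\<lambda>n. real (a_rounds A n)) \<in> o(\<lambda>n. ln (real n))"
    and "solves_on_trees A P \<Delta> (\<lambda>n. 1 / real n)"
  shows "\<exists>B :: (bool list, bool list, 'i, 'o) dalg.
           congest B \<and>
           (\<lambda>n. real (a_rounds B n)) \<in> O(\<lambda>n. ln (ln (real n))) \<and>
           solves_on_trees B P \<Delta> (\<lambda>n. 1 / real n powr c)"
proof -
  define a where "a = real (\<Delta> + 2)"
  have a2: "2 \<le> a" by (simp add: a_def)
  obtain n0 where "32 * real (\<Delta> + 2) ^ (51 * (a_rounds A n0 + radius P + 1)) \<le> real n0"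
    using ex_base_size[OF assms(3), of "\<Delta> + 2" "radius P"] by auto
  define s where "s = a_rounds A n0 + radius P + 1"
  have n0: "32 * a ^ (51 * s) \<le> real n0" unfolding a_def s_def by fact
  \<comment> \<open>Makes \<open>8 * \<theta> * a ^ (5 * s)\<close> equal to 1, which yields the
    local lemma condition because \<open>radius P \<le> s\<close>.\<close>
  define \<theta> where "\<theta> = 1 / (8 * a ^ (5 * s))"
  have \<theta>: "0 < \<theta>" using a2 by (simp add: \<theta>_def)
  have rs: "radius P \<le> s" "1 \<le> s" by (simp_all add: s_def)
  have apow: "a ^ i \<le> a ^ j" if "i \<le> j" for i j using that a2 by (intro power_increasing) auto
  have apos: "0 < a ^ i" for i using a2 by simp
  have pow: "real ((\<Delta> + 2) ^ i) = a ^ i" for i by (simp only: a_def of_nat_power)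
  obtain m where m: "\<And>w. w > m \<Longrightarrow> 2 * next_width ((\<Delta> + 2) ^ (2 * (radius P + s + s))) w \<le> w"
    using ex_width_threshold by blast
  define k where "k = nat \<lceil>c\<rceil>"
  \<comment> \<open>\<open>2 ^ F n\<close> is at least \<open>n\<close>. So \<open>2 ^ l n\<close>
    is at least \<open>n ^ (k + 3)\<close>, against \<open>n ^ 2\<close> pairs of names, and
    \<open>4 ^ mm n\<close> is at least \<open>2 * n ^ (k + 1)\<close>; for \<open>n \<ge> 2\<close>
    each contributes at most half of \<open>1 / n ^ k\<close>.\<close>
  define F where "F n = floor_log n + 1" for n
  define l where "l n = (k + 3) * F n" for n
  define mm where "mm n = (k + 1) * F n + 1" for n
  \<comment> \<open>The ball size in \<open>prob_not_shattered\<close>, with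
    \<open>z + 2 * s\<close> written out.\<close>
  define c0 where "c0 = (\<Delta> + 2) ^ (3 * (radius P + s + s) + 2 * s)"
  define L where "L n = mm n * c0" for n
  define J where "J n = floor_log (L n) + 1" for n
  define h where "h = a_bits A n0"
  have scheme: "scheme P A n0 \<Delta> s m (J n) (L n) \<theta>" for n
  proof
    show "solves_on_trees A P \<Delta> (\<lambda>n. 1 / real n)" by (rule assms(4))
    have "real ((\<Delta> + 2) ^ Suc s) = a ^ Suc s" by (rule pow)
    also have "\<dots> \<le> a ^ (51 * s)" using rs by (intro apow) simp
    also have "\<dots> \<le> real n0" using n0 apos[of "51 * s"] by linarith
    finally show "(\<Delta> + 2) ^ Suc s \<le> n0" by (simp only: of_nat_le_iff)
    have "4 * a ^ (5 * s) \<le> real n0" using n0 apow[of "5 * s" "51 * s"] apos[of "51 * s"] by linarith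
    then show "1 / real n0 \<le> 2 * \<theta>"
      unfolding \<theta>_def using apos[of "5 * s"] by (simp add: field_simps)
    have "4 * (2 * \<theta> * real ((\<Delta> + 2) ^ (radius P + s + s))) * real ((\<Delta> + 2) ^ (2 * s)) = 8 * \<theta> * a ^ (radius P + s + s + 2 * s)"
      unfolding pow power_add[of a "radius P + s + s" "2 * s"] by (simp only: mult_ac)
    also have "\<dots> \<le> 8 * \<theta> * a ^ (5 * s)" using \<theta> rs by (intro mult_left_mono apow) auto
    also have "\<dots> = 1" using a2 by (simp add: \<theta>_def)
    finally show "4 * (2 * \<theta> * real ((\<Delta> + 2) ^ (radius P + s + s))) * real ((\<Delta> + 2) ^ (2 * s)) \<le> 1" .
    show "L n < 2 ^ J n" unfolding J_def using floor_log_exp2_gt[of "L n"] by simp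
  qed (use \<theta> m in \<open>auto simp: s_def\<close>)
  \<comment> \<open>The radii, the number of colours and \<open>kap\<close> do not depend on
    \<open>n\<close>; the instance for 0 provides names for them.\<close>
  interpret S0: scheme P A n0 \<Delta> s m "l 0" "J 0" "L 0" \<theta> by (rule scheme)
  have ratio: "real (4 * (\<Delta> + 2) ^ (2 * (2 * (S0.z + 2 * s) + 1))) * (1 / real n0 / \<theta>) \<le> 1"
  proof -
    \<comment> \<open>\<open>z + 2 * s\<close> is at most \<open>11 * s\<close>, so the exponent is
      at most \<open>44 * s + 2\<close>.\<close>
    have "2 * (2 * (S0.z + 2 * s) + 1) \<le> 46 * s" using rs by (simp add: S0.z_def)
    then have "4 * a ^ (2 * (2 * (S0.z + 2 * s) + 1)) * (8 * a ^ (5 * s)) \<le> 4 * a ^ (46 * s) * (8 * a ^ (5 * s))"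
      using apos by (intro mult_right_mono mult_left_mono apow) (auto simp: less_imp_le)
    also have "\<dots> = 32 * a ^ (51 * s)" by (simp add: power_add[symmetric])
    also have "\<dots> \<le> real n0" by (rule n0)
    finally have "4 * a ^ (2 * (2 * (S0.z + 2 * s) + 1)) * (8 * a ^ (5 * s)) / real n0 \<le> 1"
      using n0 apos[of "51 * s"] by (simp add: divide_le_eq)
    moreover have "real (4 * (\<Delta> + 2) ^ (2 * (2 * (S0.z + 2 * s) + 1))) = 4 * a ^ (2 * (2 * (S0.z + 2 * s) + 1))"
      by (simp only: of_nat_mult of_nat_numeral pow)
    moreover have "1 / real n0 / \<theta> = 8 * a ^ (5 * s) / real n0" by (simp add: \<theta>_def)
    ultimately show ?thesis by (simp only: times_divide_eq_right)
  qed
  define c1 where "c1 = (2 * S0.d + 3) * S0.K"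
  \<comment> \<open>Every factor of the label bound becomes a power of 2 with exponent linear in
    \<open>F n\<close>; the last factor of \<open>W0\<close> pays for the views.\<close>
  define W0 where "W0 = (S0.kap * (((k + 2) * c0 + 1) * c1 + 1) + (k + 3) * (2 + 2 * S0.bsz)) * (2 * \<Delta> + 1) ^ Suc S0.kk"
  define w where "w n = W0 * F n" for n
  have F1: "1 \<le> F n" for n by (simp add: F_def)
  have Flog: "real (F n) \<le> log 2 (real n) + 1" if "2 \<le> n" for n
    using floor_log_log[of n] that by (simp add: F_def)
  have L_le: "L n \<le> ((k + 2) * c0) * F n" for n
  proof -
    have "mm n \<le> (k + 2) * F n" using F1[of n] by (simp add: mm_def)
    then have "L n \<le> (k + 2) * F n * c0" unfolding L_def by (rule mult_right_mono) simp
    then show ?thesis by (simp only: mult_ac)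
  qed
  define X where "X n = log 2 (log 2 (real n) + 1)" for n
  define R where "R n = (log 2 (real (k + 3)) + X n + 1 + (real (S0.K * h) + 3 + 3 * ((log 2 (real ((k + 2) * c0)) + X n + 1) * real c1)))
    * (real S0.kk + 3)" for n
  define good where "good n prog (e0 :: nat \<times> ('i, 'o) label \<Rightarrow> nat) (dec :: nat \<Rightarrow> 'o list) \<longleftrightarrow> real (length prog) \<le> R n \<and> (\<forall>f\<in>set prog. \<forall>x ms. f x ms < 2 ^ w n) \<and>
    (\<forall>G inp. is_tree G \<longrightarrow> max_deg_le G \<Delta> \<longrightarrow>
       real (card {rb \<in> rand_space G (l n + h). \<not> lcl_solved P G inp (\<lambda>x y. dec (run G prog
          (\<lambda>v. start_value (2 ^ w n) e0 (l n) h (map (inp v) (nbrs G v)) (rb v)) x) ! port_of G x y)})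
        / card (rand_space G (l n + h)) \<le> card (verts G) ^ 2 / 2 ^ l n + card (verts G) / 4 ^ mm n)" for n prog e0 dec
  have ex: "\<exists>prog e0 dec. good n prog e0 dec" if n: "2 \<le> n" for n
  proof -
    interpret Sn: scheme P A n0 \<Delta> s m "l n" "J n" "L n" \<theta> by (rule scheme)
    define N where "N = Sn.label_bound ^ ((2 * \<Delta> + 1) ^ Suc S0.kk)"
    have I_le: "Sn.I + 1 \<le> (((k + 2) * c0 + 1) * c1 + 1) * F n"
    proof -
      have "J n \<le> L n + 1" using floor_log_le[of "L n"] by (simp add: J_def)
      also have "\<dots> \<le> ((k + 2) * c0 + 1) * F n" using L_le[of n] F1[of n] by (simp add: algebra_simps)
      finally have "Sn.I \<le> ((k + 2) * c0 + 1) * F n * c1" unfolding Sn.I_def c1_def by (rule mult_right_mono) simp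
      then show ?thesis using F1[of n] by (simp add: algebra_simps)
    qed
    have N_le: "N \<le> 2 ^ w n"
    proof -
      have "S0.kap * (Sn.I + 1) \<le> S0.kap * ((((k + 2) * c0 + 1) * c1 + 1) * F n)" using I_le by (rule mult_left_mono) simp
      \<comment> \<open>A crude exponential bound suffices, as \<open>I\<close> is at most a
        constant times \<open>F n\<close> and the exponent may be of order
        \<open>ln n\<close>.\<close>
      moreover have "S0.kap * (Sn.I + 1) \<le> 2 ^ (S0.kap * (Sn.I + 1))" by (rule less_imp_le) (rule less_exp)
      ultimately have 1: "S0.kap * (Sn.I + 1) \<le> 2 ^ (S0.kap * ((((k + 2) * c0 + 1) * c1 + 1) * F n))"
        by (meson le_trans one_le_numeral power_increasing)
      have "Sn.label_bound \<le> 2 ^ (S0.kap * ((((k + 2) * c0 + 1) * c1 + 1) * F n)) * (2 ^ l n) ^ (2 + 2 * S0.bsz)"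
        unfolding Sn.label_bound_def using 1 by (rule mult_right_mono) simp
      also have "\<dots> = 2 ^ ((S0.kap * (((k + 2) * c0 + 1) * c1 + 1) + (k + 3) * (2 + 2 * S0.bsz)) * F n)"
        unfolding l_def power_mult[symmetric] power_add[symmetric] by (rule arg_cong[of _ _ "(^) 2"]) (simp add: algebra_simps)
      finally have "N \<le> (2 ^ ((S0.kap * (((k + 2) * c0 + 1) * c1 + 1) + (k + 3) * (2 + 2 * S0.bsz)) * F n)) ^ ((2 * \<Delta> + 1) ^ Suc S0.kk)"
        unfolding N_def by (rule power_mono) simp
      also have "\<dots> = 2 ^ w n" unfolding w_def W0_def power_mult[symmetric] by (simp only: mult_ac)
      finally show ?thesis .
    qed
    from Sn.program[OF Sn.labels_bound(1-3) Sn.finite_outs Sn.labels_bound(4) N_def]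
    obtain prog and e0 :: "nat \<times> ('i, 'o) label \<Rightarrow> nat" and dec where all:
      "length prog = Sn.total_rounds \<and> (\<forall>f\<in>set prog. \<forall>x ms. f x ms < N) \<and> e0 ` (Sn.names \<times> Sn.labels) \<subseteq> {..<N} \<and>
       (\<forall>G inp B v. (G, inp, B) \<in> Sn.Inst \<longrightarrow> v \<in> verts G \<longrightarrow>
          dec (run G prog (\<lambda>v. e0 (v, start_label G inp B v)) v) = Sn.OUT G inp B v)"
      by (elim exE)
    have prog: "length prog = Sn.total_rounds" "\<forall>f\<in>set prog. \<forall>x ms. f x ms < N"
      "e0 ` (Sn.names \<times> Sn.labels) \<subseteq> {..<N}"
      "(G, inp, B) \<in> Sn.Inst \<Longrightarrow> v \<in> verts G \<Longrightarrow>
        dec (run G prog (\<lambda>v. e0 (v, start_label G inp B v)) v) = Sn.OUT G inp B v" for G inp B v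
      using all by simp_all
    have e0: "e0 ` (Sn.names \<times> Sn.labels) \<subseteq> {..<2 ^ w n}" using prog(3) N_le by fastforce
    have "real (length prog) \<le> R n"
    proof -
      have "real (floor_log (l n)) \<le> log 2 (real (k + 3)) + X n"
        unfolding X_def by (rule floor_log_mult_le[OF _ F1 Flog[OF n]]) (simp_all add: l_def)
      then have jc: "real Sn.jc \<le> log 2 (real (k + 3)) + X n + 1" by (simp add: Sn.jc_def)
      have "1 \<le> c0" unfolding c0_def by (rule one_le_power) simp
      then have "1 \<le> (k + 2) * c0" using mult_le_mono[of 1 "k + 2" 1 c0] by simp
      then have "real (floor_log (L n)) \<le> log 2 (real ((k + 2) * c0)) + X n"
        unfolding X_def by (rule floor_log_mult_le[OF _ F1 Flog[OF n] L_le])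
      then have "real (J n) \<le> log 2 (real ((k + 2) * c0)) + X n + 1" by (simp add: J_def)
      then have "real (J n) * real c1 \<le> (log 2 (real ((k + 2) * c0)) + X n + 1) * real c1" by (rule mult_right_mono) simp
      then have I: "real Sn.I \<le> (log 2 (real ((k + 2) * c0)) + X n + 1) * real c1"
        unfolding Sn.I_def c1_def by (simp only: of_nat_mult)
      have "real (length prog) = (real Sn.jc + (real (S0.K * h) + 3 + 3 * real Sn.I)) * (real S0.kk + 3)"
        unfolding prog(1) Sn.total_rounds_def h_def by (simp add: algebra_simps)
      also have "\<dots> \<le> R n" unfolding R_def using jc I by (intro mult_right_mono add_mono mult_left_mono order_refl) auto
      finally show ?thesis .
    qed
    moreover have "\<forall>f\<in>set prog. \<forall>x ms. f x ms < 2 ^ w n" using prog(2) N_le by (meson less_le_trans)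
    moreover have "real (card {rb \<in> rand_space G (l n + h). \<not> lcl_solved P G inp (\<lambda>x y. dec (run G prog
          (\<lambda>v. start_value (2 ^ w n) e0 (l n) h (map (inp v) (nbrs G v)) (rb v)) x) ! port_of G x y)})
        / card (rand_space G (l n + h)) \<le> card (verts G) ^ 2 / 2 ^ l n + card (verts G) / 4 ^ mm n"
      if G: "is_tree G" "max_deg_le G \<Delta>" for G inp
      unfolding h_def
    proof (rule Sn.failure_bound[where prog = prog and dec = dec, OF e0 _ G _ _ ratio])
      show "dec (run G prog (\<lambda>v. e0 (v, start_label G inp B v)) v) = Sn.OUT G inp B v"
        if "(G, inp, B) \<in> Sn.Inst" "v \<in> verts G" for G inp B v
        by (rule prog(4)[OF that])
      show "1 \<le> mm n" by (simp add: mm_def)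
      show "L n = mm n * (\<Delta> + 2) ^ (S0.z + 2 * s)" by (simp add: L_def c0_def S0.z_def)
    qed auto
    ultimately show ?thesis unfolding good_def by blast
  qed
  \<comment> \<open>Program, encoding and decoding belong together, so one triple is chosen for each
    \<open>n\<close>.\<close>
  define t where "t n = (SOME t. good n (fst t) (fst (snd t)) (snd (snd t)))" for n
  have t: "good n (fst (t n)) (fst (snd (t n))) (snd (snd (t n)))" if n: "2 \<le> n" for n
  proof -
    obtain prog e0 dec where "good n prog e0 dec" using ex[OF n] by blast
    then have "good n (fst (prog, e0, dec)) (fst (snd (prog, e0, dec))) (snd (snd (prog, e0, dec)))" by simp
    then show ?thesis unfolding t_def by (rule someI[where P = "\<lambda>t. good n (fst t) (fst (snd t)) (snd (snd t))"])
  qed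
  define prog where "prog n = fst (t n)" for n
  define e0 where "e0 n = fst (snd (t n))" for n
  define dec where "dec n = snd (snd (t n))" for n
  note good = t[folded prog_def e0_def dec_def, unfolded good_def]
  define i0 where "i0 n = start_value (2 ^ w n) (e0 n) (l n) h" for n
  define B :: "(bool list, bool list, 'i, 'o) dalg" where
    "B = mk_alg prog w i0 (\<lambda>n x j. dec n x ! j) (\<lambda>n. l n + h)"
  have "congest B"
    unfolding B_def
  proof (rule congest_mk_alg)
    fix n :: nat assume n: "2 \<le> n"
    have "1 \<le> log 2 (real n)" using n by simp
    then have "real (F n) \<le> 2 * log 2 (real n)" using Flog[OF n] by simp
    then have "real W0 * real (F n) \<le> real W0 * (2 * log 2 (real n))" by (rule mult_left_mono) simp
    then show "real (w n) \<le> (real W0 * 2 / ln 2) * ln (real n)" by (simp add: w_def log_def)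
  qed
  moreover have "(\<lambda>n. real (a_rounds B n)) \<in> O(\<lambda>n. ln (ln (real n)))"
  proof -
    have rounds: "a_rounds B n = length (prog n)" for n by (simp add: B_def mk_alg_def)
    have "(\<lambda>n. real (a_rounds B n)) \<in> O(R)"
    proof (rule bigoI)
      show "eventually (\<lambda>n. norm (real (a_rounds B n)) \<le> 1 * norm (R n)) sequentially"
        using eventually_ge_at_top[of 2]
      proof eventually_elim
        case (elim n)
        then show ?case using good[OF elim] unfolding rounds by simp
      qed
    qed
    moreover have "R \<in> O(\<lambda>n. ln (ln (real n)))"
    proof -
      have XO: "X \<in> O(\<lambda>n. ln (ln (real n)))" unfolding X_def by real_asymp
      have "(\<lambda>_. 1 :: real) \<in> O(\<lambda>n::nat. ln (ln (real n)))" by real_asymp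
      moreover have "(\<lambda>_::nat. x) \<in> O(\<lambda>_. 1 :: real)" for x :: real
        by (rule bigoI[where c = "\<bar>x\<bar>"]) simp
      ultimately have cO: "(\<lambda>_. x) \<in> O(\<lambda>n::nat. ln (ln (real n)))" for x :: real
        by (rule landau_o.big_trans[rotated])
      define \<beta> where "\<beta> = (1 + 3 * real c1) * (real S0.kk + 3)"
      define \<gamma> where "\<gamma> = (log 2 (real (k + 3)) + 1 + (real (S0.K * h) + 3 + 3 * ((log 2 (real ((k + 2) * c0)) + 1) * real c1)))
        * (real S0.kk + 3)"
      \<comment> \<open>Affine in the iterated logarithm \<open>X n\<close>, with coefficients free
        of \<open>n\<close>.\<close>
      have "R = (\<lambda>n. \<gamma> + \<beta> * X n)"
        unfolding R_def \<beta>_def \<gamma>_def by (rule ext) (simp only: distrib_left distrib_right mult_ac add_ac mult_1)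
      moreover have "(\<lambda>n. \<beta> * X n) \<in> O(\<lambda>n. ln (ln (real n)))" using XO by (cases "\<beta> = 0") simp_all
      ultimately show ?thesis using sum_in_bigo(1)[OF cO] by simp
    qed
    ultimately show ?thesis by (rule landau_o.big_trans)
  qed
  moreover have "solves_on_trees B P \<Delta> (\<lambda>n. 1 / real n powr c)"
    unfolding solves_on_trees_def
  proof (intro allI impI, elim conjE)
    fix n :: nat and G and inp :: "nat \<Rightarrow> nat \<Rightarrow> 'i"
    assume n: "1 \<le> n" and G: "is_tree G" "max_deg_le G \<Delta>" "card (verts G) \<le> n"
    show "fail_prob B P n G inp \<le> 1 / real n powr c"
    proof (cases "n = 1")
      \<comment> \<open>The allowed failure probability is 1 here; the program chosen for
        \<open>n = 1\<close> is arbitrary.\<close>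
      case True
      have "finite (rand_space G (a_bits B n))"
        by (rule finite_rand_space) (use G(1) in \<open>simp add: is_tree_def wf_pgraph_def\<close>)
      then have "card {rb \<in> rand_space G (a_bits B n). \<not> lcl_solved P G inp (alg_output B n G inp rb)}
          \<le> card (rand_space G (a_bits B n))" by (intro card_mono) auto
      then have "fail_prob B P n G inp \<le> 1" unfolding fail_prob_def by (simp add: divide_le_eq)
      then show ?thesis using True by simp
    next
      case False
      then have n2: "2 \<le> n" using n by simp
      have out: "alg_output B n G inp rb = (\<lambda>x y. dec n (run G (prog n)
          (\<lambda>v. start_value (2 ^ w n) (e0 n) (l n) h (map (inp v) (nbrs G v)) (rb v)) x) ! port_of G x y)" for rb
        unfolding B_def
      proof (intro ext, subst alg_output_mk_alg)
        show "i0 n il bs < 2 ^ w n" for il bs by (simp add: i0_def start_value_def)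
        show "f x ms < 2 ^ w n" if "f \<in> set (prog n)" for f x ms using good[OF n2] that by blast
      qed (simp add: i0_def)
      have bits: "a_bits B n = l n + h" by (simp add: B_def mk_alg_def)
      have nF: "real n \<le> 2 ^ F n"
      proof -
        have "n \<le> 2 ^ F n" using floor_log_exp2_gt[of n] by (simp add: F_def)
        then show ?thesis using of_nat_mono by fastforce
      qed
      have nk: "real n ^ i \<le> 2 ^ (i * F n)" for i
        using power_mono[OF nF, of i] by (simp add: power_mult[symmetric] mult.commute)
      have np: "0 < real n ^ i" for i using n by simp
      have "fail_prob B P n G inp \<le> card (verts G) ^ 2 / 2 ^ l n + card (verts G) / 4 ^ mm n"
        unfolding fail_prob_def bits out using good[OF n2] G(1,2) by blast
      also have "\<dots> \<le> real n ^ 2 / real n ^ (k + 3) + real n / (2 * real n ^ (k + 1))"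
      proof (rule add_mono; rule frac_le)
        show "real (card (verts G) ^ 2) \<le> real n ^ 2" using G(3) by (simp add: power_mono)
        show "real n ^ (k + 3) \<le> 2 ^ l n" unfolding l_def by (rule nk)
        have "2 * real n ^ (k + 1) \<le> 2 * 2 ^ ((k + 1) * F n)" using nk[of "k + 1"] by simp
        also have "\<dots> = 2 ^ mm n" by (simp add: mm_def)
        also have "\<dots> \<le> 4 ^ mm n" by (rule power_mono) auto
        finally show "2 * real n ^ (k + 1) \<le> 4 ^ mm n" .
      qed (use n G(3) in auto)
      also have "\<dots> \<le> 1 / real n ^ k"
      proof -
        have "real n ^ 2 / real n ^ (k + 3) = 1 / real n / real n ^ k" using n
          by (simp add: power_add field_simps power2_eq_square power3_eq_cube)
        also have "\<dots> \<le> 1 / 2 / real n ^ k" using n2 np by (intro divide_right_mono) (auto simp: field_simps)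
        finally have "real n ^ 2 / real n ^ (k + 3) \<le> 1 / 2 / real n ^ k" .
        moreover have "real n / (2 * real n ^ (k + 1)) = 1 / 2 / real n ^ k" using n by simp
        ultimately show ?thesis by simp
      qed
      also have "\<dots> \<le> 1 / real n powr c"
      proof (rule divide_left_mono)
        have "c \<le> real k" unfolding k_def by linarith
        then have "real n powr c \<le> real n powr real k" using n by (intro powr_mono) auto
        then show "real n powr c \<le> real n ^ k" using n by (simp add: powr_realpow)
      qed (use n in auto)
      finally show ?thesis .
    qed
  qed
  ultimately show ?thesis by blast
qed

end
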